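(* Let $\varphi:\mathbb{R}^n\times\mathbb{R}^m\to(-\infty,\infty]$ be a closed proper function, let $\bar x$ be a locally optimal solution to the problem of minimizing $\varphi(x,0)$ over $x\in\mathbb{R}^n$, with $\varphi(\bar x,0)$ finite, and assume the basic constraint qualification $$(0,y)\in\partial^\infty\varphi(\bar x,0)\implies y=0 .$$ Consider the conditions: (A) full stability holds at $\bar x$, and full multiplier prox-regularity holds at $\bar x$; (B) strong variational sufficiency holds at $\bar x$; (C) full substability holds at $\bar x$, and full multiplier prox-regularity holds at $\bar x$. Then (A) is equivalent to the combination of (C) with $$\limsup_{(v,u)\to(0,0)}|DM^{\delta,\alpha}_v(u)|^{-}<\infty, \qquad( * )$$ and (A) is likewise equivalent to the combination of (B) with $( * )$. Here $\delta>0$ is small enough and $\alpha>\varphi(\bar x,0)$ low enough that, on a neighborhood of $(0,0)$, $M^{\delta,\alpha}(v,u)$ is single-valued and equals $M_\delta(v,u)$ (such $\delta,\alpha$ exist under (C), hence under (B) or (A)).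
   Context: Subgradients $\partial$ are the general (limiting) subgradients and $\partial^\infty$ the horizon subgradients of variational analysis (Rockafellar–Wets); closed means lower semicontinuous. When a set is a singleton it is identified with its element. For $\delta>0$ and $(v,u)\in\mathbb{R}^n\times\mathbb{R}^m$, $$M_\delta(v,u)=\operatorname{argmin}_{|x-\bar x|<\delta}\{\varphi(x,u)-v\cdot[x-\bar x]\},\qquad m_\delta(v,u)=\inf_{|x-\bar x|<\delta}\{\varphi(x,u)-v\cdot[x-\bar x]\}.$$ Also $Y(x,u,v)=\{y\in\mathbb{R}^m : (v,y)\in\partial\varphi(x,u)\}$, $M(v,u)=\{x: Y(x,u,v)\ne\emptyset\}$, $\bar Y=Y(\bar x,0,0)$, and $$M^{\delta,\alpha}(v,u)=M(v,u)\cap\{x: |x-\bar x|<\delta,\ \varphi(x,u)<\alpha\},\qquad M^{\delta,\alpha}_v=M^{\delta,\alpha}(v,\cdot):u\mapsto M^{\delta,\alpha}(v,u).$$ The graphical derivative $DM^{\delta,\alpha}_v(u):\mathbb{R}^m\rightrightarrows\mathbb{R}^n$ is the (generally set-valued) mapping whose graph is the tangent (contingent) cone to $\operatorname{gph}M^{\delta,\alpha}_v$ at $(u,x)$ for $x=M^{\delta,\alpha}_v(u)$. Its inner norm is $$|DM^{\delta,\alpha}_v(u)|^{-}=\sup_{|\omega|\le1}\ \inf_{\xi\in DM^{\delta,\alpha}_v(u)(\omega)}|\xi|$$ (with the infimum over the empty set being $\infty$). Full stability at $\bar x$: for all small enough $\delta>0$, on some neighborhood of $(0,0)$, $M_\delta$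 is single-valued, $M_\delta(0,0)=\bar x$, and $M_\delta(v,u)$ and $m_\delta(v,u)$ are Lipschitz continuous in $(v,u)$. Full substability at $\bar x$: for all small enough $\delta>0$, on some neighborhood of $(0,0)$, $M_\delta$ is single-valued, $M_\delta(0,0)=\bar x$, and $M_\delta(v,u)$ and $m_\delta(v,u)$ are continuous in $(v,u)$ and Lipschitz continuous in $v$, locally uniformly in $u$. For a closed proper function $f$ on a Euclidean space, an open set $\mathcal{X}$ and $\alpha\in\mathbb{R}$, let $\mathcal{X}^\alpha_f=\{x\in\mathcal{X}: f(x)<\alpha\}$. $f$ is prox-regular at $\bar z$ for $\bar w\in\partial f(\bar z)$ if there are open neighborhoods $\mathcal{X}$ of $\bar z$, $\mathcal{W}$ of $\bar w$, some $\alpha>f(\bar z)$ and $r\in\mathbb{R}$ such that $f(z')\ge f(z)+w\cdot[z'-z]-\frac r2|z'-z|^2$ for all $z'\in\mathcal{X}$ and all $(z,w)\in(\mathcal{X}^\alpha_f\times\mathcal{W})\cap\operatorname{gph}\partial f$. A function $g$ is $s$-convex if $g-\frac s2|\cdot|^2$ is convex. $f$ is variationally $s$-convex at $\bar z$ for $\bar w\in\partial f(\bar z)$ if there are open convex neighborhoods $\mathcal{X}$ of $\bar z$, $\mathcal{W}$ of $\bar w$, some $\alpha>f(\bar z)$, and a closed proper $s$-convex function $\hat f$ such that $\hat f\le f$ on $\mathcal{X}$, $(\mathcal{X}\times\mathcal{W})\cap\operatorname{gph}\partial\hat f=(\mathcal{X}^\alpha_f\times\mathcal{W})\cap\operatorname{gph}\partial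 f$, and $\hat f(z)=f(z)$ for all $(z,w)$ in this truncated graph. It is variationally strongly convex there if this holds for some $s>0$. Full multiplier prox-regularity at $\bar x$: $\varphi$ is prox-regular at $(\bar x,0)$ for $(0,\bar y)$ for every $\bar y\in\bar Y$. Strong variational sufficiency at $\bar x$: for every $\bar y\in\bar Y$ there exists $e\ge0$ such that the function $\varphi_e(x,u)=\varphi(x,u)+\frac e2|u|^2$ is variationally strongly convex at $(\bar x,0)$ for the subgradient $(0,\bar y)\in\partial\varphi_e(\bar x,0)=\partial\varphi(\bar x,0)$. *)

theory Defs
  imports "HOL-Analysis.Analysis"
begin

definition lsc :: "('a::topological_space \<Rightarrow> ereal) \<Rightarrow> bool" where
  "lsc f \<longleftrightarrow> (\<forall>z. f z \<le> Liminf (at z) f)"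

definition proper_fun :: "('a \<Rightarrow> ereal) \<Rightarrow> bool" where
  "proper_fun f \<longleftrightarrow> (\<forall>z. f z \<noteq> -\<infinity>) \<and> (\<exists>z. f z \<noteq> \<infinity>)"

definition closed_proper :: "('a::topological_space \<Rightarrow> ereal) \<Rightarrow> bool" where
  "closed_proper f \<longleftrightarrow> lsc f \<and> proper_fun f"

text \<open>Regular, general (limiting) and horizon subgradients, as in Rockafellar and Wets,
  Definition 8.3. All three sets are empty at points where the function is not finite.\<close>

definition regular_subdiff :: "('a::euclidean_space \<Rightarrow> ereal) \<Rightarrow> 'a \<Rightarrow> 'a set" where
  "regular_subdiff f z = {w. \<bar>f z\<bar> \<noteq> \<infinity> \<and>
     0 \<le> Liminf (at z) (\<lambda>z'. (f z' - f z - ereal (w \<bullet> (z' - z))) / ereal (norm (z' - z)))}"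

definition subdiff :: "('a::euclidean_space \<Rightarrow> ereal) \<Rightarrow> 'a \<Rightarrow> 'a set" where
  "subdiff f z = {w. \<bar>f z\<bar> \<noteq> \<infinity> \<and>
     (\<exists>zs ws. zs \<longlonglongrightarrow> z \<and> (\<lambda>k. f (zs k)) \<longlonglongrightarrow> f z \<and>
        (\<forall>k. ws k \<in> regular_subdiff f (zs k)) \<and> ws \<longlonglongrightarrow> w)}"

definition horizon_subdiff :: "('a::euclidean_space \<Rightarrow> ereal) \<Rightarrow> 'a \<Rightarrow> 'a set" where
  "horizon_subdiff f z = {w. \<bar>f z\<bar> \<noteq> \<infinity> \<and>
     (\<exists>zs ws t. zs \<longlonglongrightarrow> z \<and> (\<lambda>k. f (zs k)) \<longlonglongrightarrow> f z \<and>
        (\<forall>k. ws k \<in> regular_subdiff f (zs k)) \<and>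
        (\<forall>k. (0::real) < t k) \<and> t \<longlonglongrightarrow> 0 \<and> (\<lambda>k. t k *\<^sub>R ws k) \<longlonglongrightarrow> w)}"

definition gph_subdiff :: "('a::euclidean_space \<Rightarrow> ereal) \<Rightarrow> ('a \<times> 'a) set" where
  "gph_subdiff f = {(z, w). w \<in> subdiff f z}"

definition truncated :: "'a set \<Rightarrow> ('a \<Rightarrow> ereal) \<Rightarrow> real \<Rightarrow> 'a set" where
  "truncated X f \<alpha> = {z \<in> X. f z < ereal \<alpha>}"

definition prox_regular :: "('a::euclidean_space \<Rightarrow> ereal) \<Rightarrow> 'a \<Rightarrow> 'a \<Rightarrow> bool" where
  "prox_regular f zbar wbar \<longleftrightarrow> wbar \<in> subdiff f zbar \<and>
     (\<exists>X W \<alpha> r. open X \<and> zbar \<in> X \<and> open W \<and> wbar \<in> W \<and> f zbar < ereal \<alpha> \<and>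
        (\<forall>z'\<in>X. \<forall>(z, w) \<in> (truncated X f \<alpha> \<times> W) \<inter> gph_subdiff f.
           f z' \<ge> f z + ereal (w \<bullet> (z' - z) - r / 2 * (norm (z' - z))\<^sup>2)))"

definition convex_fun :: "('a::real_vector \<Rightarrow> ereal) \<Rightarrow> bool" where
  "convex_fun f \<longleftrightarrow> (\<forall>x y t. 0 < t \<and> t < 1 \<longrightarrow>
     f ((1 - t) *\<^sub>R x + t *\<^sub>R y) \<le> ereal (1 - t) * f x + ereal t * f y)"

definition s_convex :: "real \<Rightarrow> ('a::real_normed_vector \<Rightarrow> ereal) \<Rightarrow> bool" where
  "s_convex s g \<longleftrightarrow> convex_fun (\<lambda>z. g z - ereal (s / 2 * (norm z)\<^sup>2))"

definition variationally_s_convex ::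
    "real \<Rightarrow> ('a::euclidean_space \<Rightarrow> ereal) \<Rightarrow> 'a \<Rightarrow> 'a \<Rightarrow> bool" where
  "variationally_s_convex s f zbar wbar \<longleftrightarrow> wbar \<in> subdiff f zbar \<and>
     (\<exists>X W \<alpha> fhat.
        open X \<and> convex X \<and> zbar \<in> X \<and> open W \<and> convex W \<and> wbar \<in> W \<and> f zbar < ereal \<alpha> \<and>
        closed_proper fhat \<and> s_convex s fhat \<and>
        (\<forall>z\<in>X. fhat z \<le> f z) \<and>
        (X \<times> W) \<inter> gph_subdiff fhat = (truncated X f \<alpha> \<times> W) \<inter> gph_subdiff f \<and>
        (\<forall>(z, w) \<in> (truncated X f \<alpha> \<times> W) \<inter> gph_subdiff f. fhat z = f z))"

definition variationally_strongly_convex ::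
    "('a::euclidean_space \<Rightarrow> ereal) \<Rightarrow> 'a \<Rightarrow> 'a \<Rightarrow> bool" where
  "variationally_strongly_convex f zbar wbar \<longleftrightarrow>
     (\<exists>s>0. variationally_s_convex s f zbar wbar)"

definition m_delta ::
    "('x::euclidean_space \<times> 'u::euclidean_space \<Rightarrow> ereal) \<Rightarrow> 'x \<Rightarrow> real \<Rightarrow> 'x \<Rightarrow> 'u \<Rightarrow> ereal" where
  "m_delta \<phi> xbar \<delta> v u = (INF x\<in>ball xbar \<delta>. \<phi> (x, u) - ereal (v \<bullet> (x - xbar)))"

text \<open>By the usual convention, the argmin is empty when the infimum is \<open>\<infinity>\<close>. For
  \<open>\<phi> > -\<infinity>\<close>, the infimum is therefore finite wherever the argmin is nonempty, which
  justifies the use of \<^const>\<open>real_of_ereal\<close> in the stability notions below.\<close>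

definition M_delta ::
    "('x::euclidean_space \<times> 'u::euclidean_space \<Rightarrow> ereal) \<Rightarrow> 'x \<Rightarrow> real \<Rightarrow> 'x \<Rightarrow> 'u \<Rightarrow> 'x set" where
  "M_delta \<phi> xbar \<delta> v u =
     {x \<in> ball xbar \<delta>. \<phi> (x, u) - ereal (v \<bullet> (x - xbar)) = m_delta \<phi> xbar \<delta> v u \<and>
        m_delta \<phi> xbar \<delta> v u < \<infinity>}"

definition Y_set ::
    "('x::euclidean_space \<times> 'u::euclidean_space \<Rightarrow> ereal) \<Rightarrow> 'x \<Rightarrow> 'u \<Rightarrow> 'x \<Rightarrow> 'u set" where
  "Y_set \<phi> x u v = {y. (v, y) \<in> subdiff \<phi> (x, u)}"

definition Y_bar ::
    "('x::euclidean_space \<times> 'u::euclidean_space \<Rightarrow> ereal) \<Rightarrow> 'x \<Rightarrow> 'u set" where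
  "Y_bar \<phi> xbar = Y_set \<phi> xbar 0 0"

definition M_set ::
    "('x::euclidean_space \<times> 'u::euclidean_space \<Rightarrow> ereal) \<Rightarrow> 'x \<Rightarrow> 'u \<Rightarrow> 'x set" where
  "M_set \<phi> v u = {x. Y_set \<phi> x u v \<noteq> {}}"

definition M_trunc ::
    "('x::euclidean_space \<times> 'u::euclidean_space \<Rightarrow> ereal) \<Rightarrow> 'x \<Rightarrow> real \<Rightarrow> real \<Rightarrow> 'x \<Rightarrow> 'u \<Rightarrow> 'x set" where
  "M_trunc \<phi> xbar \<delta> \<alpha> v u =
     M_set \<phi> v u \<inter> {x. norm (x - xbar) < \<delta> \<and> \<phi> (x, u) < ereal \<alpha>}"

definition tangent_cone :: "'a::real_normed_vector set \<Rightarrow> 'a \<Rightarrow> 'a set" where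
  "tangent_cone S z = {w. \<exists>zs t. (\<forall>k. zs k \<in> S) \<and> zs \<longlonglongrightarrow> z \<and>
     (\<forall>k. (0::real) < t k) \<and> t \<longlonglongrightarrow> 0 \<and> (\<lambda>k. (zs k - z) /\<^sub>R t k) \<longlonglongrightarrow> w}"

definition gph :: "('u \<Rightarrow> 'x set) \<Rightarrow> ('u \<times> 'x) set" where
  "gph S = {(u, x). x \<in> S u}"

definition graphical_derivative ::
    "('u::real_normed_vector \<Rightarrow> 'x::real_normed_vector set) \<Rightarrow> 'u \<Rightarrow> 'x \<Rightarrow> 'u \<Rightarrow> 'x set" where
  "graphical_derivative S u x \<omega> = {\<xi>. (\<omega>, \<xi>) \<in> tangent_cone (gph S) (u, x)}"

text \<open>The infimum over the empty set is \<open>\<infinity>\<close> in \<^typ>\<open>ereal\<close>.\<close>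

definition inner_norm ::
    "('u::real_normed_vector \<Rightarrow> 'x::real_normed_vector set) \<Rightarrow> ereal" where
  "inner_norm H = (SUP \<omega>\<in>cball 0 1. INF \<xi>\<in>H \<omega>. ereal (norm \<xi>))"

definition full_stability ::
    "('x::euclidean_space \<times> 'u::euclidean_space \<Rightarrow> ereal) \<Rightarrow> 'x \<Rightarrow> bool" where
  "full_stability \<phi> xbar \<longleftrightarrow>
     (\<exists>\<delta>0>0. \<forall>\<delta>. 0 < \<delta> \<and> \<delta> < \<delta>0 \<longrightarrow>
        M_delta \<phi> xbar \<delta> 0 0 = {xbar} \<and>
        (\<exists>N. open N \<and> (0, 0) \<in> N \<and>
           (\<forall>(v, u)\<in>N. is_singleton (M_delta \<phi> xbar \<delta> v u)) \<and>
           (\<exists>L. L-lipschitz_on N (\<lambda>(v, u). the_elem (M_delta \<phi> xbar \<delta> v u))) \<and>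
           (\<exists>L. L-lipschitz_on N (\<lambda>(v, u). real_of_ereal (m_delta \<phi> xbar \<delta> v u)))))"

text \<open>The constant \<open>L\<close> below serves all \<open>u\<close> at once: the Lipschitz continuity in \<open>v\<close> is
  uniform in \<open>u\<close> locally around the reference point.\<close>

definition full_substability ::
    "('x::euclidean_space \<times> 'u::euclidean_space \<Rightarrow> ereal) \<Rightarrow> 'x \<Rightarrow> bool" where
  "full_substability \<phi> xbar \<longleftrightarrow>
     (\<exists>\<delta>0>0. \<forall>\<delta>. 0 < \<delta> \<and> \<delta> < \<delta>0 \<longrightarrow>
        M_delta \<phi> xbar \<delta> 0 0 = {xbar} \<and>
        (\<exists>N. open N \<and> (0, 0) \<in> N \<and>
           (\<forall>(v, u)\<in>N. is_singleton (M_delta \<phi> xbar \<delta> v u)) \<and>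
           continuous_on N (\<lambda>(v, u). the_elem (M_delta \<phi> xbar \<delta> v u)) \<and>
           continuous_on N (\<lambda>(v, u). real_of_ereal (m_delta \<phi> xbar \<delta> v u)) \<and>
           (\<exists>L. \<forall>u. L-lipschitz_on {v. (v, u) \<in> N} (\<lambda>v. the_elem (M_delta \<phi> xbar \<delta> v u))) \<and>
           (\<exists>L. \<forall>u. L-lipschitz_on {v. (v, u) \<in> N} (\<lambda>v. real_of_ereal (m_delta \<phi> xbar \<delta> v u)))))"

definition full_multiplier_prox_regularity ::
    "('x::euclidean_space \<times> 'u::euclidean_space \<Rightarrow> ereal) \<Rightarrow> 'x \<Rightarrow> bool" where
  "full_multiplier_prox_regularity \<phi> xbar \<longleftrightarrow>
     (\<forall>y\<in>Y_bar \<phi> xbar. prox_regular \<phi> (xbar, 0) (0, y))"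

definition strong_variational_sufficiency ::
    "('x::euclidean_space \<times> 'u::euclidean_space \<Rightarrow> ereal) \<Rightarrow> 'x \<Rightarrow> bool" where
  "strong_variational_sufficiency \<phi> xbar \<longleftrightarrow>
     (\<forall>y\<in>Y_bar \<phi> xbar. \<exists>e\<ge>0.
        variationally_strongly_convex
          (\<lambda>(x, u). \<phi> (x, u) + ereal (e / 2 * (norm u)\<^sup>2)) (xbar, 0) (0, y))"

definition suitable ::
    "('x::euclidean_space \<times> 'u::euclidean_space \<Rightarrow> ereal) \<Rightarrow> 'x \<Rightarrow> real \<Rightarrow> real \<Rightarrow> bool" where
  "suitable \<phi> xbar \<delta> \<alpha> \<longleftrightarrow> 0 < \<delta> \<and> \<phi> (xbar, 0) < ereal \<alpha> \<and>
     (\<forall>\<^sub>F (v, u) in nhds (0, 0).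
        is_singleton (M_trunc \<phi> xbar \<delta> \<alpha> v u) \<and>
        M_trunc \<phi> xbar \<delta> \<alpha> v u = M_delta \<phi> xbar \<delta> v u)"

text \<open>As in Rockafellar and Wets, the upper limit at a point takes the value at that point
  into account, whence \<^const>\<open>nhds\<close> instead of the punctured filter.\<close>

definition derivative_condition ::
    "('x::euclidean_space \<times> 'u::euclidean_space \<Rightarrow> ereal) \<Rightarrow> 'x \<Rightarrow> real \<Rightarrow> real \<Rightarrow> bool" where
  "derivative_condition \<phi> xbar \<delta> \<alpha> \<longleftrightarrow>
     Limsup (nhds (0, 0)) (\<lambda>(v, u).
       inner_norm (graphical_derivative (M_trunc \<phi> xbar \<delta> \<alpha> v) u
         (the_elem (M_trunc \<phi> xbar \<delta> \<alpha> v u)))) < \<infinity>"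

end

theory Submission
  imports Defs
begin

text \<open>Everything reduces to inequalities between values of \<open>\<phi>\<close>. By the constraint qualification, an
  exact penalty argument shows that near the reference point \<open>m_delta\<close> is Lipschitz continuous and that
  minimizers exist, stay near \<open>xbar\<close> and have multipliers, which are bounded. Strong variational
  sufficiency means that, uniformly over the multipliers, \<open>\<phi>\<close> grows quadratically in \<open>x\<close> and at worst
  decreases quadratically in \<open>u\<close> beyond its linearization at nearby subgradients; this gives
  substability directly. Under substability and prox-regularity, every nearby subgradient comes from
  the minimizer, so the truncated solution mapping is the argmin mapping; Lipschitz dependence on
  \<open>(v, u)\<close> then upgrades prox-regularity to the quadratic growth. Finally, a bound on the inner norm of
  the graphical derivative is equivalent to Lipschitz dependence on \<open>u\<close>.\<close>

section \<open>Lower semicontinuity and subgradients\<close>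

text \<open>Nothing here is differentiable, and a subgradient of \<open>\<phi>\<close> is only local
  information, so most existence claims follow one pattern: minimize an auxiliary function over a
  compact set, show that the minimizer is interior, and read off a subgradient or an equation. Two
  gaps need more than this. Variational convexity asks for an unknown convex function; it is rebuilt
  as a supremum of the quadratic minorants that growth supplies, while the penalty in u cancels the
  quadratic loss. And a nearby subgradient only expresses stationarity, whereas
  \<open>M_delta\<close> asks for a minimum over a whole ball; the two are matched by solving an
  equation whose slope lies just above the prox constant. Quadratic growth by itself controls
  minimizers in u only through a square-root modulus, and this is the gap that the derivative
  condition closes. Finally, the radius in \<open>suitable\<close> is given in advance while
  stability speaks of all small radii; near the reference point the minimizers for different radii
  coincide, so the radii may be exchanged.\<close>

lemma lsc_eventually_gt:
  assumes "lsc f" "c < f z"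
  shows "\<forall>\<^sub>F z' in nhds z. c < f z'"
proof -
  have "\<forall>\<^sub>F z' in at z. c < f z'"
    using assms less_LiminfD unfolding lsc_def by (metis order_less_le_trans)
  then show ?thesis
    using assms(2) by (auto simp: eventually_at_filter elim: eventually_mono)
qed

lemma lsc_limit_le:
  assumes "lsc f" "zs \<longlonglongrightarrow> z" "c \<longlonglongrightarrow> c0" "\<And>k. f (zs k) \<le> ereal (c k)"
  shows "f z \<le> ereal c0"
proof (rule ccontr)
  assume "\<not> f z \<le> ereal c0"
  then obtain d where d: "ereal c0 < ereal d" "ereal d < f z"
    using ereal_dense2 by (metis linorder_not_le)
  have "\<forall>\<^sub>F k in sequentially. ereal d < f (zs k)"
    using lsc_eventually_gt[OF assms(1) d(2)] assms(2) unfolding filterlim_iff by blast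
  moreover have "\<forall>\<^sub>F k in sequentially. c k < d"
    using assms(3) d(1) by (simp add: order_tendsto_iff)
  ultimately have "\<forall>\<^sub>F k in sequentially. False"
    by eventually_elim (use assms(4) in \<open>metis ereal_less_eq(3) leD order_less_le_trans less_imp_le\<close>)
  then show False by simp
qed

text \<open>Lower semicontinuity supplies the lower half of the convergence of values, so only the
  upper bounds \<open>c\<close> have to be produced.\<close>

lemma lsc_attentive:
  assumes "lsc f" "zs \<longlonglongrightarrow> z" "f z = ereal a" "c \<longlonglongrightarrow> a" "\<And>k. f (zs k) \<le> ereal (c k)"
  shows "(\<lambda>k. f (zs k)) \<longlonglongrightarrow> f z"
proof (rule order_tendstoI)
  fix b assume "b < f z"
  then show "\<forall>\<^sub>F k in sequentially. b < f (zs k)"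
    using lsc_eventually_gt[OF assms(1)] assms(2) unfolding filterlim_iff by blast
next
  fix b assume b: "f z < b"
  have "(\<lambda>k. ereal (c k)) \<longlonglongrightarrow> f z" using assms(3,4) by simp
  then have "\<forall>\<^sub>F k in sequentially. ereal (c k) < b" using b by (simp add: order_tendsto_iff)
  then show "\<forall>\<^sub>F k in sequentially. f (zs k) < b"
    by eventually_elim (use assms(5) order_le_less_trans in blast)
qed

lemma lsc_add_continuous:
  fixes f :: "'a::t2_space \<Rightarrow> ereal"
  assumes "lsc f" "\<And>z. f z \<noteq> -\<infinity>" "continuous_on UNIV q"
  shows "lsc (\<lambda>z. f z + ereal (q z))"
  unfolding lsc_def
proof
  fix z
  have "((\<lambda>z. ereal (q z)) \<longlongrightarrow> ereal (q z)) (at z)"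
    using assms(3) by (simp add: continuous_on_def)
  then have L: "Liminf (at z) (\<lambda>z. ereal (q z)) = ereal (q z)" if "at z \<noteq> bot"
    using that by (simp add: lim_imp_Liminf)
  show "f z + ereal (q z) \<le> Liminf (at z) (\<lambda>z. f z + ereal (q z))"
  proof (cases "at z = bot")
    case False
    show ?thesis
    proof (rule le_Liminf_iff[THEN iffD2], intro allI impI)
      fix y assume y: "y < f z + ereal (q z)"
      then have "y - ereal (q z) < f z"
        by (cases y; cases "f z") auto
      \<comment> \<open>A real number in between splits the strict inequality for the sum into one
        for each summand.\<close>
      then obtain d where d: "y - ereal (q z) < ereal d" "ereal d < f z"
        using ereal_dense2 by blast
      have 1: "\<forall>\<^sub>F x in at z. ereal d < f x"
        using lsc_eventually_gt[OF assms(1) d(2)] eventually_at_filter eventually_mono by fastforce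
      have "y - ereal d < ereal (q z)" using d(1) by (cases y) auto
      then have 2: "\<forall>\<^sub>F x in at z. y - ereal d < ereal (q x)"
        using \<open>((\<lambda>z. ereal (q z)) \<longlongrightarrow> ereal (q z)) (at z)\<close> by (rule order_tendstoD[rotated])
      show "\<forall>\<^sub>F x in at z. y < f x + ereal (q x)"
        using 1 2
      proof eventually_elim
        case (elim x)
        then show ?case using assms(2)[of x] by (cases y; cases "f x") auto
      qed
    qed
  qed simp
qed

text \<open>If every z in S had a strictly better \<open>g z\<close>, then f would exceed
  \<open>f (g z)\<close> near z. Among finitely many such neighborhoods covering S, take the least
  of the values \<open>f (g z)\<close>: its point \<open>g z0\<close> lies in one of the
  neighborhoods, which yields a smaller value.\<close>

lemma lsc_attains_min:
  fixes f :: "'a::heine_borel \<Rightarrow> ereal"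
  assumes "lsc f" "compact S" "S \<noteq> {}"
  shows "\<exists>z\<in>S. \<forall>z'\<in>S. f z \<le> f z'"
proof (rule ccontr)
  assume "\<not> ?thesis"
  then have *: "\<forall>z\<in>S. \<exists>z'\<in>S. f z' < f z" by (meson not_le)
  have "\<forall>z\<in>S. \<exists>z' U. z'\<in>S \<and> open U \<and> z \<in> U \<and> (\<forall>x\<in>U. f z' < f x)"
  proof
    fix z assume "z \<in> S"
    then obtain z' where "z' \<in> S" "f z' < f z" using * by blast
    then show "\<exists>z' U. z'\<in>S \<and> open U \<and> z \<in> U \<and> (\<forall>x\<in>U. f z' < f x)"
      using lsc_eventually_gt[OF assms(1), of "f z'" z] by (auto simp: eventually_nhds)
  qed
  then obtain g U where gU: "\<And>z. z\<in>S \<Longrightarrow> g z \<in> S \<and> open (U z) \<and> z \<in> U z \<and> (\<forall>x\<in>U z. f (g z) < f x)"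
    by metis
  obtain D where D: "D \<subseteq> S" "finite D" "S \<subseteq> (\<Union>z\<in>D. U z)"
    by (rule compactE_image[OF assms(2), of S U]) (use gU in auto)
  have "D \<noteq> {}" using D assms(3) by auto
  define z0 where "z0 = arg_min_on (\<lambda>z. f (g z)) D"
  have z0: "z0 \<in> D" "\<And>z. z \<in> D \<Longrightarrow> f (g z0) \<le> f (g z)"
    unfolding z0_def using arg_min_if_finite[OF D(2) \<open>D \<noteq> {}\<close>] by (auto intro: arg_min_least D(2) \<open>D \<noteq> {}\<close>)
  have "g z0 \<in> S" using z0 D gU by blast
  then obtain z where "z \<in> D" "g z0 \<in> U z" using D by blast
  then have "f (g z) < f (g z0)" using gU D by blast
  then show False using z0(2)[OF \<open>z \<in> D\<close>] by simp
qed

section \<open>Subgradients described by inequalities\<close>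

lemma quotient_ge_iff:
  fixes F :: ereal
  assumes "n > 0"
  shows "ereal (- \<epsilon>) < (F - ereal a - ereal b) / ereal n \<longleftrightarrow> ereal (a + b - \<epsilon> * n) < F"
  using assms by (cases F) (auto simp: field_simps)

text \<open>Freed from the quotient, the condition makes sense at z itself, where it is an equality;
  hence \<open>nhds\<close>. Passing from the weak to the strict inequality costs half of
  \<epsilon>.\<close>

lemma regular_subdiff_iff:
  fixes f :: "'a::euclidean_space \<Rightarrow> ereal"
  assumes "f z = ereal a"
  shows "w \<in> regular_subdiff f z \<longleftrightarrow>
    (\<forall>\<epsilon>>0. \<forall>\<^sub>F z' in nhds z. ereal (a + w \<bullet> (z' - z) - \<epsilon> * norm (z' - z)) \<le> f z')"
proof -
  have "w \<in> regular_subdiff f z \<longleftrightarrow>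
     0 \<le> Liminf (at z) (\<lambda>z'. (f z' - ereal a - ereal (w \<bullet> (z' - z))) / ereal (norm (z' - z)))"
    using assms by (simp add: regular_subdiff_def)
  also have "\<dots> \<longleftrightarrow> (\<forall>y<0. \<forall>\<^sub>F z' in at z. y < (f z' - ereal a - ereal (w \<bullet> (z' - z))) / ereal (norm (z' - z)))"
    by (rule le_Liminf_iff)
  also have "\<dots> \<longleftrightarrow> (\<forall>\<epsilon>>0. \<forall>\<^sub>F z' in at z. ereal (- \<epsilon>) < (f z' - ereal a - ereal (w \<bullet> (z' - z))) / ereal (norm (z' - z)))"
  proof (safe)
    fix y :: ereal
    assume *: "\<forall>\<epsilon>>0. \<forall>\<^sub>F z' in at z. ereal (- \<epsilon>) < (f z' - ereal a - ereal (w \<bullet> (z' - z))) / ereal (norm (z' - z))"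
      and "y < 0"
    then obtain d where "y < ereal d" "ereal d < 0" using ereal_dense2 by blast
    then show "\<forall>\<^sub>F z' in at z. y < (f z' - ereal a - ereal (w \<bullet> (z' - z))) / ereal (norm (z' - z))"
      using *[rule_format, of "-d"] by (auto elim!: eventually_mono)
  qed auto
  also have "\<dots> \<longleftrightarrow> (\<forall>\<epsilon>>0. \<forall>\<^sub>F z' in at z. ereal (a + w \<bullet> (z' - z) - \<epsilon> * norm (z' - z)) < f z')"
    by (intro all_cong eventually_cong) (auto simp: eventually_at_filter quotient_ge_iff)
  also have "\<dots> \<longleftrightarrow> (\<forall>\<epsilon>>0. \<forall>\<^sub>F z' in nhds z. ereal (a + w \<bullet> (z' - z) - \<epsilon> * norm (z' - z)) \<le> f z')"
  proof (intro iffI allI impI)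
    fix \<epsilon> :: real
    assume "\<forall>\<epsilon>>0. \<forall>\<^sub>F z' in at z. ereal (a + w \<bullet> (z' - z) - \<epsilon> * norm (z' - z)) < f z'" "\<epsilon> > 0"
    then have "\<forall>\<^sub>F z' in at z. ereal (a + w \<bullet> (z' - z) - \<epsilon> * norm (z' - z)) < f z'" by blast
    then show "\<forall>\<^sub>F z' in nhds z. ereal (a + w \<bullet> (z' - z) - \<epsilon> * norm (z' - z)) \<le> f z'"
      unfolding eventually_at_filter
      by (rule eventually_mono) (use assms in \<open>auto intro: less_imp_le\<close>)
  next
    fix \<epsilon> :: real
    assume *: "\<forall>\<epsilon>>0. \<forall>\<^sub>F z' in nhds z. ereal (a + w \<bullet> (z' - z) - \<epsilon> * norm (z' - z)) \<le> f z'" "\<epsilon> > 0"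
    then have "\<forall>\<^sub>F z' in nhds z. ereal (a + w \<bullet> (z' - z) - \<epsilon>/2 * norm (z' - z)) \<le> f z'"
      using half_gt_zero by blast
    then show "\<forall>\<^sub>F z' in at z. ereal (a + w \<bullet> (z' - z) - \<epsilon> * norm (z' - z)) < f z'"
      unfolding eventually_at_filter
    proof (rule eventually_mono, intro impI)
      fix z' assume "ereal (a + w \<bullet> (z' - z) - \<epsilon>/2 * norm (z' - z)) \<le> f z'" "z' \<noteq> z"
      moreover have "\<epsilon>/2 * norm (z' - z) < \<epsilon> * norm (z' - z)" using \<open>z' \<noteq> z\<close> \<open>\<epsilon> > 0\<close> by simp
      ultimately show "ereal (a + w \<bullet> (z' - z) - \<epsilon> * norm (z' - z)) < f z'"
        by (metis add_diff_cancel_left' diff_strict_left_mono ereal_less(2) less_ereal.simps(1) order_less_le_trans)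
    qed
  qed
  finally show ?thesis .
qed

lemma regular_subdiff_finite: "w \<in> regular_subdiff f z \<Longrightarrow> \<exists>a. f z = ereal a"
  by (cases "f z") (auto simp: regular_subdiff_def)

lemma subdiff_finite: "w \<in> subdiff f z \<Longrightarrow> \<exists>a. f z = ereal a"
  by (cases "f z") (auto simp: subdiff_def)

text \<open>Near z a quadratic term is below any positive multiple of the norm. The auxiliary
  minimizers below yield their subgradients through such a minorant; \<open>c\<close> may be zero or
  negative.\<close>

lemma regular_subdiff_quadraticI:
  fixes f :: "'a::euclidean_space \<Rightarrow> ereal"
  assumes "f z = ereal a"
    and "\<forall>\<^sub>F z' in nhds z. ereal (a + w \<bullet> (z' - z) - c * (norm (z' - z))\<^sup>2) \<le> f z'"
  shows "w \<in> regular_subdiff f z"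
  unfolding regular_subdiff_iff[of f z a, OF assms(1)]
proof (intro allI impI)
  fix \<epsilon> :: real assume "\<epsilon> > 0"
  have "\<forall>\<^sub>F z' in nhds z. dist z' z < \<epsilon> / (\<bar>c\<bar> + 1)"
    using \<open>\<epsilon> > 0\<close> by (intro eventually_nhds_metric[THEN iffD2]) (auto intro!: exI[of _ "\<epsilon> / (\<bar>c\<bar> + 1)"])
  with assms(2) show "\<forall>\<^sub>F z' in nhds z. ereal (a + w \<bullet> (z' - z) - \<epsilon> * norm (z' - z)) \<le> f z'"
  proof eventually_elim
    case (elim z')
    have "c * norm (z' - z) \<le> (\<bar>c\<bar> + 1) * norm (z' - z)" by (intro mult_right_mono) auto
    also have "\<dots> \<le> \<epsilon>" using elim(2) by (simp add: dist_norm field_simps)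
    finally have "c * norm (z' - z) * norm (z' - z) \<le> \<epsilon> * norm (z' - z)" by (intro mult_right_mono) auto
    then have "a + w \<bullet> (z' - z) - \<epsilon> * norm (z' - z) \<le> a + w \<bullet> (z' - z) - c * (norm (z' - z))\<^sup>2"
      by (simp add: power2_eq_square)
    then show ?case using elim(1) by (meson ereal_less_eq(3) order_trans)
  qed
qed

lemma regular_subdiff_subset: "regular_subdiff f z \<subseteq> subdiff f z"
proof
  fix w assume w: "w \<in> regular_subdiff f z"
  then have "\<bar>f z\<bar> \<noteq> \<infinity>" by (simp add: regular_subdiff_def)
  then show "w \<in> subdiff f z" unfolding subdiff_def using w
    by (intro CollectI conjI exI[of _ "\<lambda>_. z"] exI[of _ "\<lambda>_. w"]) auto
qed

text \<open>The sequences are replaced by approximation at every scale e. Only an upper bound on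
  \<open>f z'\<close> is requested, because lower semicontinuity provides the lower one.\<close>

lemma subdiff_iff:
  fixes f :: "'a::euclidean_space \<Rightarrow> ereal"
  assumes "lsc f" "f z = ereal a"
  shows "w \<in> subdiff f z \<longleftrightarrow>
    (\<forall>e>0. \<exists>z' w'. w' \<in> regular_subdiff f z' \<and> dist z' z < e \<and> dist w' w < e \<and> f z' < ereal (a + e))"
    (is "_ \<longleftrightarrow> ?R")
proof
  assume "w \<in> subdiff f z"
  then obtain zs ws where *: "zs \<longlonglongrightarrow> z" "(\<lambda>k. f (zs k)) \<longlonglongrightarrow> f z"
        "\<And>k. ws k \<in> regular_subdiff f (zs k)" "ws \<longlonglongrightarrow> w"
    unfolding subdiff_def by blast
  show ?R
  proof (intro allI impI)
    fix e :: real assume "e > 0"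
    have "\<forall>\<^sub>F k in sequentially. dist (zs k) z < e" using *(1) \<open>e > 0\<close> by (rule tendstoD)
    moreover have "\<forall>\<^sub>F k in sequentially. dist (ws k) w < e" using *(4) \<open>e > 0\<close> by (rule tendstoD)
    moreover have "\<forall>\<^sub>F k in sequentially. f (zs k) < ereal (a + e)"
      using *(2) by (rule order_tendstoD) (use assms \<open>e > 0\<close> in auto)
    ultimately have "\<forall>\<^sub>F k in sequentially. dist (zs k) z < e \<and> dist (ws k) w < e \<and> f (zs k) < ereal (a + e)"
      by eventually_elim auto
    then obtain k where "dist (zs k) z < e \<and> dist (ws k) w < e \<and> f (zs k) < ereal (a + e)"
      using eventually_sequentially by auto
    then show "\<exists>z' w'. w' \<in> regular_subdiff f z' \<and> dist z' z < e \<and> dist w' w < e \<and> f z' < ereal (a + e)"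
      using *(3) by blast
  qed
next
  assume R: ?R
  have "\<forall>k::nat. \<exists>z' w'. w' \<in> regular_subdiff f z' \<and> dist z' z < inverse (Suc k)
      \<and> dist w' w < inverse (Suc k) \<and> f z' < ereal (a + inverse (Suc k))"
    using R by simp
  then obtain zs ws where *: "\<And>k. ws k \<in> regular_subdiff f (zs k)" "\<And>k. dist (zs k) z < inverse (Suc k)"
      "\<And>k. dist (ws k) w < inverse (Suc k)" "\<And>k. f (zs k) < ereal (a + inverse (Suc k))"
    by metis
  have 1: "zs \<longlonglongrightarrow> z"
    by (rule metric_tendsto_imp_tendsto[OF LIMSEQ_inverse_real_of_nat]) (use *(2) in \<open>auto intro!: always_eventually less_imp_le\<close>)
  have 2: "ws \<longlonglongrightarrow> w"
    by (rule metric_tendsto_imp_tendsto[OF LIMSEQ_inverse_real_of_nat]) (use *(3) in \<open>auto intro!: always_eventually less_imp_le\<close>)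
  have "(\<lambda>k. a + inverse (real (Suc k))) \<longlonglongrightarrow> a"
    using tendsto_add[OF tendsto_const LIMSEQ_inverse_real_of_nat, of a] by simp
  then have "(\<lambda>k. f (zs k)) \<longlonglongrightarrow> f z"
    by (rule lsc_attentive[OF assms(1) 1 assms(2)]) (use *(4) in \<open>auto intro: less_imp_le\<close>)
  then show "w \<in> subdiff f z" unfolding subdiff_def using *(1) 1 2 assms(2) by auto
qed

text \<open>A diagonal argument: a limiting subgradient within e/2, then a regular one within e/2 of
  that. The excesses of the values add up in the same way.\<close>

lemma subdiff_closed_attentive:
  fixes f :: "'a::euclidean_space \<Rightarrow> ereal"
  assumes "lsc f" "f z = ereal a"
    and "\<And>e. e > 0 \<Longrightarrow> \<exists>z' w'. w' \<in> subdiff f z' \<and> dist z' z < e \<and> dist w' w < e \<and> f z' < ereal (a + e)"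
  shows "w \<in> subdiff f z"
  unfolding subdiff_iff[OF assms(1,2)]
proof (intro allI impI)
  fix e :: real assume "e > 0"
  then obtain z1 w1 where 1: "w1 \<in> subdiff f z1" "dist z1 z < e/2" "dist w1 w < e/2" "f z1 < ereal (a + e/2)"
    using assms(3) half_gt_zero by blast
  obtain a1 where a1: "f z1 = ereal a1" using subdiff_finite[OF 1(1)] by blast
  obtain z2 w2 where 2: "w2 \<in> regular_subdiff f z2" "dist z2 z1 < e/2" "dist w2 w1 < e/2" "f z2 < ereal (a1 + e/2)"
    using 1(1) \<open>e > 0\<close> half_gt_zero unfolding subdiff_iff[OF assms(1) a1] by blast
  have "dist z2 z < e" "dist w2 w < e" using 1 2 dist_triangle_half_r dist_commute
    by (metis dist_triangle_half_l dist_commute)+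
  moreover have "ereal (a1 + e/2) < ereal (a + e)" using 1(4) a1 by simp
  then have "f z2 < ereal (a + e)" using 2(4) order_less_trans by blast
  ultimately show "\<exists>z' w'. w' \<in> regular_subdiff f z' \<and> dist z' z < e \<and> dist w' w < e \<and> f z' < ereal (a + e)"
    using 2(1) by blast
qed

section \<open>Adding a smooth function\<close>

lemma regular_subdiff_add_smooth:
  fixes f :: "'a::euclidean_space \<Rightarrow> ereal"
  assumes "w \<in> regular_subdiff f z" "(q has_derivative (\<lambda>h. g \<bullet> h)) (at z)"
  shows "w + g \<in> regular_subdiff (\<lambda>z. f z + ereal (q z)) z"
proof -
  obtain a where a: "f z = ereal a" using regular_subdiff_finite[OF assms(1)] by blast
  then have a': "f z + ereal (q z) = ereal (a + q z)" by simp
  show ?thesis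
    unfolding regular_subdiff_iff[of "\<lambda>z. f z + ereal (q z)" z "a + q z", OF a']
  proof (intro allI impI)
    fix \<epsilon> :: real assume "\<epsilon> > 0"
    then have "\<forall>\<^sub>F z' in nhds z. ereal (a + w \<bullet> (z' - z) - \<epsilon>/2 * norm (z' - z)) \<le> f z'"
      using assms(1) half_gt_zero unfolding regular_subdiff_iff[of f z a, OF a] by blast
    moreover obtain d where d: "d > 0" "\<And>y. norm (y - z) < d \<Longrightarrow> norm (q y - q z - g \<bullet> (y - z)) \<le> \<epsilon>/2 * norm (y - z)"
      using assms(2) half_gt_zero[OF \<open>\<epsilon> > 0\<close>] unfolding has_derivative_at_alt by blast
    have "\<forall>\<^sub>F z' in nhds z. dist z' z < d"
      using d(1) by (intro eventually_nhds_metric[THEN iffD2]) auto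
    ultimately show "\<forall>\<^sub>F z' in nhds z. ereal (a + q z + (w + g) \<bullet> (z' - z) - \<epsilon> * norm (z' - z)) \<le> f z' + ereal (q z')"
    proof eventually_elim
      case (elim z')
      have "norm (q z' - q z - g \<bullet> (z' - z)) \<le> \<epsilon>/2 * norm (z' - z)" using d(2) elim(2) by (simp add: dist_norm)
      then have "q z + g \<bullet> (z' - z) - \<epsilon>/2 * norm (z' - z) \<le> q z'" unfolding real_norm_def by argo
      then have "ereal (a + w \<bullet> (z' - z) - \<epsilon>/2 * norm (z' - z)) + ereal (q z + g \<bullet> (z' - z) - \<epsilon>/2 * norm (z' - z))
         \<le> f z' + ereal (q z')"
        by (intro add_mono elim(1)) simp
      then show ?case by (simp add: inner_add_left algebra_simps)
    qed
  qed
qed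

lemma subdiff_add_smooth:
  fixes f :: "'a::euclidean_space \<Rightarrow> ereal"
  assumes "w \<in> subdiff f z" "\<And>z. (q has_derivative (\<lambda>h. g z \<bullet> h)) (at z)" "continuous_on UNIV g"
  shows "w + g z \<in> subdiff (\<lambda>z. f z + ereal (q z)) z"
proof -
  obtain zs ws where *: "zs \<longlonglongrightarrow> z" "(\<lambda>k. f (zs k)) \<longlonglongrightarrow> f z"
        "\<And>k. ws k \<in> regular_subdiff f (zs k)" "ws \<longlonglongrightarrow> w"
    using assms(1) unfolding subdiff_def by blast
  obtain a where a: "f z = ereal a" using subdiff_finite[OF assms(1)] by blast
  have "isCont q z" using assms(2) has_derivative_continuous by blast
  then have q: "(\<lambda>k. q (zs k)) \<longlonglongrightarrow> q z" using *(1) isCont_tendsto_compose by blast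
  have "isCont g z" using assms(3) by (simp add: continuous_on_eq_continuous_at)
  then have g: "(\<lambda>k. g (zs k)) \<longlonglongrightarrow> g z" using *(1) isCont_tendsto_compose by blast
  have "(\<lambda>k. f (zs k) + ereal (q (zs k))) \<longlonglongrightarrow> f z + ereal (q z)"
    by (rule tendsto_add_ereal_general) (use * q a in auto)
  moreover have "\<And>k. ws k + g (zs k) \<in> regular_subdiff (\<lambda>z. f z + ereal (q z)) (zs k)"
    by (intro regular_subdiff_add_smooth * assms(2))
  moreover have "(\<lambda>k. ws k + g (zs k)) \<longlonglongrightarrow> w + g z" by (intro tendsto_add * g)
  ultimately show ?thesis
    unfolding subdiff_def using *(1) a
    by (intro CollectI conjI exI[of _ zs] exI[of _ "\<lambda>k. ws k + g (zs k)"]) auto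
qed

lemma ereal_add_diff_id: "(f z + ereal (q z)) + ereal (- q z) = f z"
  by (cases "f z") auto

text \<open>The sum rule reverses itself when applied to the sum with \<open>- q\<close>; adding and
  subtracting a real number restores \<open>f z\<close> even where it is infinite.\<close>

lemma regular_subdiff_add_smooth_iff:
  fixes f :: "'a::euclidean_space \<Rightarrow> ereal"
  assumes "(q has_derivative (\<lambda>h. g \<bullet> h)) (at z)"
  shows "w \<in> regular_subdiff (\<lambda>z. f z + ereal (q z)) z \<longleftrightarrow> w - g \<in> regular_subdiff f z"
proof
  assume "w \<in> regular_subdiff (\<lambda>z. f z + ereal (q z)) z"
  then have "w + (- g) \<in> regular_subdiff (\<lambda>z. (f z + ereal (q z)) + ereal (- q z)) z"
    by (rule regular_subdiff_add_smooth) (use has_derivative_minus[OF assms] in \<open>simp add: inner_minus_left\<close>)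
  then show "w - g \<in> regular_subdiff f z" by (simp only: ereal_add_diff_id) simp
next
  assume "w - g \<in> regular_subdiff f z"
  from regular_subdiff_add_smooth[OF this assms]
  show "w \<in> regular_subdiff (\<lambda>z. f z + ereal (q z)) z" by simp
qed

lemma subdiff_add_smooth_iff:
  fixes f :: "'a::euclidean_space \<Rightarrow> ereal"
  assumes "\<And>z. (q has_derivative (\<lambda>h. g z \<bullet> h)) (at z)" "continuous_on UNIV g"
  shows "w \<in> subdiff (\<lambda>z. f z + ereal (q z)) z \<longleftrightarrow> w - g z \<in> subdiff f z"
proof
  assume "w \<in> subdiff (\<lambda>z. f z + ereal (q z)) z"
  then have "w + (- g z) \<in> subdiff (\<lambda>z. (f z + ereal (q z)) + ereal (- q z)) z"
    by (rule subdiff_add_smooth)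
      (use has_derivative_minus[OF assms(1)] assms(2) in \<open>auto simp: inner_minus_left intro: continuous_on_minus\<close>)
  then show "w - g z \<in> subdiff f z" by (simp only: ereal_add_diff_id) simp
next
  assume "w - g z \<in> subdiff f z"
  from subdiff_add_smooth[OF this assms]
  show "w \<in> subdiff (\<lambda>z. f z + ereal (q z)) z" by simp
qed

section \<open>Variational convexity as quadratic growth\<close>

lemma norm_square_has_derivative:
  fixes z :: "'a::real_inner"
  shows "((\<lambda>z. c / 2 * (norm z)\<^sup>2) has_derivative (\<lambda>h. (c *\<^sub>R z) \<bullet> h)) (at z)"
  unfolding power2_norm_eq_inner
  by (auto intro!: derivative_eq_intros simp: inner_commute)

text \<open>On the segment to z', convexity bounds h above by an affine function of t, and the
  regular subgradient bounds it below up to \<epsilon> times t. Dividing by one small t and then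
  letting \<epsilon> vanish turns the local inequality into a global one.\<close>

lemma regular_subgradient_convex:
  fixes h :: "'a::euclidean_space \<Rightarrow> ereal"
  assumes conv: "convex_fun h" and w: "w \<in> regular_subdiff h z" and a: "h z = ereal a"
  shows "ereal (a + w \<bullet> (z' - z)) \<le> h z'"
proof -
  have ev: "\<exists>t. 0 < t \<and> t < 1 \<and>
      ereal (a + t * (w \<bullet> (z' - z)) - \<epsilon> * (t * norm (z' - z))) \<le> ereal (1 - t) * ereal a + ereal t * h z'"
    if "\<epsilon> > 0" for \<epsilon>
  proof -
    have "((\<lambda>t. z + t *\<^sub>R (z' - z)) \<longlongrightarrow> z + 0 *\<^sub>R (z' - z)) (at_right 0)"
      by (intro tendsto_intros)
    then have lim: "filterlim (\<lambda>t. z + t *\<^sub>R (z' - z)) (nhds z) (at_right 0)" by simp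
    have "\<forall>\<^sub>F y in nhds z. ereal (a + w \<bullet> (y - z) - \<epsilon> * norm (y - z)) \<le> h y"
      using w that unfolding regular_subdiff_iff[of h z a, OF a] by blast
    from eventually_compose_filterlim[OF this lim]
    have "\<forall>\<^sub>F t in at_right (0::real). ereal (a + w \<bullet> ((z + t *\<^sub>R (z' - z)) - z) - \<epsilon> * norm ((z + t *\<^sub>R (z' - z)) - z)) \<le> h (z + t *\<^sub>R (z' - z))" .
    moreover have "\<forall>\<^sub>F t in at_right (0::real). t \<in> {0<..<1}" by (rule eventually_at_right_real) simp
    ultimately have "\<forall>\<^sub>F t in at_right (0::real). 0 < t \<and> t < 1 \<and>
      ereal (a + t * (w \<bullet> (z' - z)) - \<epsilon> * (t * norm (z' - z))) \<le> ereal (1 - t) * ereal a + ereal t * h z'"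
    proof eventually_elim
      case (elim t)
      have "h ((1 - t) *\<^sub>R z + t *\<^sub>R z') \<le> ereal (1 - t) * h z + ereal t * h z'"
        using conv elim(2) unfolding convex_fun_def by simp
      also have "(1 - t) *\<^sub>R z + t *\<^sub>R z' = z + t *\<^sub>R (z' - z)" by (simp add: algebra_simps)
      finally show ?case using elim order_trans[OF elim(1)] by (simp add: a)
    qed
    then show ?thesis by (rule eventually_happens'[rotated]) simp
  qed
  show ?thesis
  proof (cases "h z'")
    case PInf then show ?thesis by simp
  next
    \<comment> \<open>The convex combination would be -\<infinity>, yet it dominates a real
      number.\<close>
    case MInf
    then show ?thesis using ev[of 1] by auto
  next
    case (real b)
    have "a + w \<bullet> (z' - z) \<le> b + \<epsilon>" if "\<epsilon> > 0" for \<epsilon> :: real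
    proof -
      define \<epsilon>' where "\<epsilon>' = \<epsilon> / (norm (z' - z) + 1)"
      have pos: "norm (z' - z) + 1 > 0" by (simp add: add_nonneg_pos)
      have "\<epsilon>' > 0" "\<epsilon>' * (norm (z' - z) + 1) = \<epsilon>" using that pos unfolding \<epsilon>'_def by auto
      then have e': "\<epsilon>' > 0" "\<epsilon>' * norm (z' - z) \<le> \<epsilon>" by (auto simp: algebra_simps)
      obtain t where t: "0 < t" "a + t * (w \<bullet> (z' - z)) - \<epsilon>' * (t * norm (z' - z)) \<le> (1 - t) * a + t * b"
        using ev[OF e'(1)] real by auto
      then have "t * (a + w \<bullet> (z' - z)) \<le> t * (b + \<epsilon>' * norm (z' - z))"
        by (simp add: algebra_simps)
      then have "a + w \<bullet> (z' - z) \<le> b + \<epsilon>' * norm (z' - z)" using t(1) by simp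
      then show ?thesis using e' by simp
    qed
    then have "a + w \<bullet> (z' - z) \<le> b" by (rule field_le_epsilon)
    then show ?thesis using real by simp
  qed
qed

text \<open>Subtracting the quadratic leaves a convex function with subgradient w - s z, and
  completing the square puts the term back. For limiting subgradients the left side converges along
  the defining sequences.\<close>

lemma subgradient_s_convex:
  fixes g :: "'a::euclidean_space \<Rightarrow> ereal"
  assumes "s_convex s g" "w \<in> subdiff g z"
  shows "g z + ereal (w \<bullet> (z' - z) + s / 2 * (norm (z' - z))\<^sup>2) \<le> g z'"
proof -
  obtain zs ws where *: "zs \<longlonglongrightarrow> z" "(\<lambda>k. g (zs k)) \<longlonglongrightarrow> g z"
        "\<And>k. ws k \<in> regular_subdiff g (zs k)" "ws \<longlonglongrightarrow> w"
    using assms(2) unfolding subdiff_def by blast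
  have reg: "g z1 + ereal (w1 \<bullet> (z' - z1) + s / 2 * (norm (z' - z1))\<^sup>2) \<le> g z'"
    if w1: "w1 \<in> regular_subdiff g z1" for z1 w1
  proof -
    obtain a where a: "g z1 = ereal a" using regular_subdiff_finite[OF w1] by blast
    let ?h = "\<lambda>z. g z - ereal (s / 2 * (norm z)\<^sup>2)"
    have h: "?h = (\<lambda>z. g z + ereal (- s / 2 * (norm z)\<^sup>2))"
      by (auto simp: minus_ereal_def)
    have "w1 + ((- s) *\<^sub>R z1) \<in> regular_subdiff ?h z1"
      unfolding h by (rule regular_subdiff_add_smooth[OF w1 norm_square_has_derivative])
    moreover have "?h z1 = ereal (a - s / 2 * (norm z1)\<^sup>2)" using a by simp
    ultimately have "ereal (a - s / 2 * (norm z1)\<^sup>2 + (w1 + ((- s) *\<^sub>R z1)) \<bullet> (z' - z1)) \<le> ?h z'"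
      using assms(1) unfolding s_convex_def by (intro regular_subgradient_convex)
    moreover have "a - s / 2 * (norm z1)\<^sup>2 + (w1 + ((- s) *\<^sub>R z1)) \<bullet> (z' - z1) + s / 2 * (norm z')\<^sup>2
        = a + (w1 \<bullet> (z' - z1) + s / 2 * (norm (z' - z1))\<^sup>2)"
      unfolding power2_norm_eq_inner
      by (simp add: inner_diff_left inner_diff_right inner_add_left inner_commute algebra_simps)
    ultimately show ?thesis unfolding a by (cases "g z'") auto
  qed
  obtain a where a: "g z = ereal a" using subdiff_finite[OF assms(2)] by blast
  have "(\<lambda>k. ereal (ws k \<bullet> (z' - zs k) + s / 2 * (norm (z' - zs k))\<^sup>2)) \<longlonglongrightarrow> ereal (w \<bullet> (z' - z) + s / 2 * (norm (z' - z))\<^sup>2)"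
    unfolding lim_ereal by (intro tendsto_intros *)
  then have "(\<lambda>k. g (zs k) + ereal (ws k \<bullet> (z' - zs k) + s / 2 * (norm (z' - zs k))\<^sup>2)) \<longlonglongrightarrow>
      g z + ereal (w \<bullet> (z' - z) + s / 2 * (norm (z' - z))\<^sup>2)"
    by (intro tendsto_add_ereal_general *) (use a in auto)
  then show ?thesis
    by (rule LIMSEQ_le_const2) (use reg *(3) in auto)
qed

text \<open>On the truncated graph \<open>fhat\<close> touches f, and on X it stays below f, so its
  global subgradient inequality passes to f. This removes the unknown function from the
  definition.\<close>

lemma variationally_s_convexD:
  fixes f :: "'a::euclidean_space \<Rightarrow> ereal"
  assumes "variationally_s_convex s f zbar wbar"
  shows "\<exists>X W \<alpha>. open X \<and> zbar \<in> X \<and> open W \<and> wbar \<in> W \<and> f zbar < ereal \<alpha> \<and>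
    (\<forall>z\<in>X. \<forall>w\<in>W. \<forall>z'\<in>X. f z < ereal \<alpha> \<longrightarrow> w \<in> subdiff f z \<longrightarrow>
       f z + ereal (w \<bullet> (z' - z) + s / 2 * (norm (z' - z))\<^sup>2) \<le> f z')"
proof -
  have "\<exists>X W \<alpha> fhat.
        open X \<and> convex X \<and> zbar \<in> X \<and> open W \<and> convex W \<and> wbar \<in> W \<and> f zbar < ereal \<alpha> \<and>
        closed_proper fhat \<and> s_convex s fhat \<and>
        (\<forall>z\<in>X. fhat z \<le> f z) \<and>
        (X \<times> W) \<inter> gph_subdiff fhat = (truncated X f \<alpha> \<times> W) \<inter> gph_subdiff f \<and>
        (\<forall>(z, w) \<in> (truncated X f \<alpha> \<times> W) \<inter> gph_subdiff f. fhat z = f z)"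
    using assms unfolding variationally_s_convex_def by (rule conjunct2)
  then obtain X W \<alpha> fhat where *:
        "open X" "zbar \<in> X" "open W" "wbar \<in> W" "f zbar < ereal \<alpha>"
        "s_convex s fhat"
        "\<forall>z\<in>X. fhat z \<le> f z"
        "(X \<times> W) \<inter> gph_subdiff fhat = (truncated X f \<alpha> \<times> W) \<inter> gph_subdiff f"
        "\<forall>(z, w) \<in> (truncated X f \<alpha> \<times> W) \<inter> gph_subdiff f. fhat z = f z"
    by (elim conjE exE)
  show ?thesis
  proof (intro exI conjI ballI impI)
    fix z w z' assume z: "z \<in> X" "w \<in> W" "z' \<in> X" "f z < ereal \<alpha>" "w \<in> subdiff f z"
    then have zw: "(z, w) \<in> (truncated X f \<alpha> \<times> W) \<inter> gph_subdiff f"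
      by (auto simp: truncated_def gph_subdiff_def)
    then have "(z, w) \<in> (X \<times> W) \<inter> gph_subdiff fhat" unfolding *(8) .
    then have "w \<in> subdiff fhat z" by (simp add: gph_subdiff_def)
    then have "fhat z + ereal (w \<bullet> (z' - z) + s / 2 * (norm (z' - z))\<^sup>2) \<le> fhat z'"
      by (rule subgradient_s_convex[OF *(6)])
    also have "fhat z' \<le> f z'" using *(7) z(3) by (rule bspec)
    also have "fhat z = f z" using bspec[OF *(9) zw] by simp
    finally show "f z + ereal (w \<bullet> (z' - z) + s / 2 * (norm (z' - z))\<^sup>2) \<le> f z'" .
  qed (rule *)+
qed

section \<open>A strongly convex minorant built from growth\<close>

lemma lsc_SUP_continuous:
  fixes g :: "'i \<Rightarrow> 'a::t2_space \<Rightarrow> real"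
  assumes "\<And>i. i \<in> I \<Longrightarrow> continuous_on UNIV (g i)"
  shows "lsc (\<lambda>z. SUP i\<in>I. ereal (g i z))"
  unfolding lsc_def
proof
  fix z
  show "(SUP i\<in>I. ereal (g i z)) \<le> Liminf (at z) (\<lambda>z. SUP i\<in>I. ereal (g i z))"
  proof (cases "at z = bot")
    case False
    show ?thesis
    proof (rule SUP_least)
      fix i assume i: "i \<in> I"
      have "((\<lambda>z. ereal (g i z)) \<longlongrightarrow> ereal (g i z)) (at z)"
        using assms[OF i] by (simp add: continuous_on_def)
      then have "ereal (g i z) = Liminf (at z) (\<lambda>z. ereal (g i z))"
        by (rule lim_imp_Liminf[OF False, symmetric])
      also have "\<dots> \<le> Liminf (at z) (\<lambda>z. SUP i\<in>I. ereal (g i z))"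
        by (rule Liminf_mono) (use i in \<open>auto intro!: always_eventually SUP_upper\<close>)
      finally show "ereal (g i z) \<le> Liminf (at z) (\<lambda>z. SUP i\<in>I. ereal (g i z))" .
    qed
  qed simp
qed

lemma convex_fun_SUP_affine:
  fixes c :: "'i \<Rightarrow> 'a::real_inner"
  assumes "I \<noteq> {}"
  shows "convex_fun (\<lambda>z. SUP i\<in>I. ereal (b i + c i \<bullet> z))"
  unfolding convex_fun_def
proof (intro allI impI SUP_least)
  fix x y t i assume t: "0 < t \<and> t < (1::real)" and i: "i \<in> I"
  have "b i + c i \<bullet> ((1 - t) *\<^sub>R x + t *\<^sub>R y) = (1 - t) * (b i + c i \<bullet> x) + t * (b i + c i \<bullet> y)"
    by (simp add: inner_add_right algebra_simps)
  then have "ereal (b i + c i \<bullet> ((1 - t) *\<^sub>R x + t *\<^sub>R y)) =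
      ereal (1 - t) * ereal (b i + c i \<bullet> x) + ereal t * ereal (b i + c i \<bullet> y)" by simp
  also have "\<dots> \<le> ereal (1 - t) * (SUP i\<in>I. ereal (b i + c i \<bullet> x)) + ereal t * (SUP i\<in>I. ereal (b i + c i \<bullet> y))"
    using t i by (intro add_mono ereal_mult_left_mono SUP_upper) auto
  finally show "ereal (b i + c i \<bullet> ((1 - t) *\<^sub>R x + t *\<^sub>R y)) \<le>
     ereal (1 - t) * (SUP i\<in>I. ereal (b i + c i \<bullet> x)) + ereal t * (SUP i\<in>I. ereal (b i + c i \<bullet> y))" .
qed

text \<open>Minimize f - w over the closed ball. Growth at \<open>zbar\<close> confines the
  minimizer to distance 2 |w - wbar| / s, which is less than \<epsilon>, so it is interior and w is
  a subgradient there. Thus every w near \<open>wbar\<close> is attained as a subgradient near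
  \<open>zbar\<close>.\<close>

lemma tilted_minimizer:
  fixes f :: "'a::euclidean_space \<Rightarrow> ereal"
  assumes lsc: "lsc f" and a: "f zbar = ereal a"
    and nm: "\<And>z. f z \<noteq> -\<infinity>"
    and s: "s > 0" and \<epsilon>: "\<epsilon> > 0" and close: "2 * norm (w - wbar) < s * \<epsilon>"
    and growth: "\<And>z'. z' \<in> cball zbar \<epsilon> \<Longrightarrow>
       ereal (a + wbar \<bullet> (z' - zbar) + s / 2 * (norm (z' - zbar))\<^sup>2) \<le> f z'"
  obtains z where "w \<in> regular_subdiff f z" "norm (z - zbar) < \<epsilon>" "f z \<le> ereal (a + w \<bullet> (z - zbar))"
proof -
  let ?F = "\<lambda>z. f z + ereal (- (w \<bullet> z))"
  have lscF: "lsc ?F" by (rule lsc_add_continuous[OF lsc]) (use nm in \<open>auto intro!: continuous_intros\<close>)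
  have "\<exists>z\<in>cball zbar \<epsilon>. \<forall>z'\<in>cball zbar \<epsilon>. ?F z \<le> ?F z'"
    by (rule lsc_attains_min[OF lscF compact_cball]) (use \<epsilon> in auto)
  then obtain z where z: "z \<in> cball zbar \<epsilon>" "\<And>z'. z'\<in>cball zbar \<epsilon> \<Longrightarrow> ?F z \<le> ?F z'" by blast
  have "?F z \<le> ?F zbar" using z \<epsilon> by simp
  then obtain b where b: "f z = ereal b" "b - w \<bullet> z \<le> a - w \<bullet> zbar"
    using a nm[of z] by (cases "f z") auto
  have "a + wbar \<bullet> (z - zbar) + s / 2 * (norm (z - zbar))\<^sup>2 \<le> b" using growth[OF z(1)] b by simp
  then have "s / 2 * (norm (z - zbar))\<^sup>2 \<le> (w - wbar) \<bullet> (z - zbar)"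
    using b(2) by (simp add: inner_diff_left inner_diff_right)
  also have "\<dots> \<le> norm (w - wbar) * norm (z - zbar)" by (rule norm_cauchy_schwarz)
  finally have "norm (z - zbar) * (s * norm (z - zbar)) \<le> norm (z - zbar) * (2 * norm (w - wbar))"
    by (simp add: power2_eq_square algebra_simps)
  then have "norm (z - zbar) = 0 \<or> s * norm (z - zbar) \<le> 2 * norm (w - wbar)"
    by (metis mult_le_cancel_left_pos norm_ge_zero order_le_less)
  then have "s * norm (z - zbar) < s * \<epsilon>" using close s \<epsilon> by (elim disjE) (simp, linarith)
  then have near: "norm (z - zbar) < \<epsilon>" using s by simp
  have "\<forall>\<^sub>F z' in nhds z. ereal (b + w \<bullet> (z' - z) - 0 * (norm (z' - z))\<^sup>2) \<le> f z'"
  proof -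
    have "\<forall>\<^sub>F z' in nhds z. z' \<in> ball zbar \<epsilon>"
      using near by (intro eventually_nhds_in_open) (auto simp: dist_norm norm_minus_commute)
    then show ?thesis
    proof eventually_elim
      case (elim z')
      then have "?F z \<le> ?F z'" by (intro z) auto
      then show ?case using b by (cases "f z'") (auto simp: inner_diff_right)
    qed
  qed
  then have "w \<in> regular_subdiff f z" by (rule regular_subdiff_quadraticI[of f z b, OF b(1)])
  then show ?thesis by (rule that[OF _ near]) (use b in \<open>auto simp: inner_diff_right\<close>)
qed

text \<open>\<open>fhat\<close> is the supremum of the quadratic minorants attached to the truncated
  graph G, so it agrees with f on G and keeps those subgradients. That it has no others nearby is
  the harder half: for w in \<open>subdiff fhat z\<close>, \<open>tilted_minimizer\<close> gives y
  with (y, w) in G, and strong convexity allows w at only one point, so z = y.\<close>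

lemma variationally_s_convexI:
  fixes f :: "'a::euclidean_space \<Rightarrow> ereal"
  assumes cp: "closed_proper f" and wbar: "wbar \<in> subdiff f zbar" and s: "s > 0"
    and X: "open X" "zbar \<in> X" and W: "open W" "wbar \<in> W" and \<alpha>: "f zbar < ereal \<alpha>"
    and growth: "\<And>z w z'. z \<in> X \<Longrightarrow> f z < ereal \<alpha> \<Longrightarrow> w \<in> W \<Longrightarrow> w \<in> subdiff f z \<Longrightarrow> z' \<in> X \<Longrightarrow>
       f z + ereal (w \<bullet> (z' - z) + s / 2 * (norm (z' - z))\<^sup>2) \<le> f z'"
  shows "variationally_s_convex s f zbar wbar"
proof -
  have lsc: "lsc f" and nm: "\<And>z. f z \<noteq> -\<infinity>" using cp by (auto simp: closed_proper_def proper_fun_def)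
  obtain a where a: "f zbar = ereal a" using subdiff_finite[OF wbar] by blast
  define G where "G = (truncated X f \<alpha> \<times> W) \<inter> gph_subdiff f"
  have Gbar: "(zbar, wbar) \<in> G" using wbar X W \<alpha> by (auto simp: G_def truncated_def gph_subdiff_def)
  have G_iff: "(z, w) \<in> G \<longleftrightarrow> z \<in> X \<and> f z < ereal \<alpha> \<and> w \<in> W \<and> w \<in> subdiff f z" for z w
    by (auto simp: G_def truncated_def gph_subdiff_def)
  define r where "r z = real_of_ereal (f z)" for z
  have r: "f z = ereal (r z)" if "(z, w) \<in> G" for z w
    using that subdiff_finite[of w f z] by (auto simp: G_iff r_def)
  \<comment> \<open>Removing the common term s/2 |z'|^2 from each quadratic minorant leaves the
    affine function with constant \<open>b\<close> and slope \<open>c\<close>. A supremum of these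
    is convex, so \<open>fhat\<close> is s-convex by construction.\<close>
  define b where "b = (\<lambda>(z, w). r z - w \<bullet> z + s / 2 * (norm z)\<^sup>2)"
  define c where "c = (\<lambda>(z :: 'a, w :: 'a). w - s *\<^sub>R z)"
  define h where "h z' = (SUP i\<in>G. ereal (b i + c i \<bullet> z'))" for z'
  define fhat where "fhat z' = h z' + ereal (s / 2 * (norm z')\<^sup>2)" for z'
  have bc: "b (z, w) + c (z, w) \<bullet> z' + s / 2 * (norm z')\<^sup>2 = r z + (w \<bullet> (z' - z) + s / 2 * (norm (z' - z))\<^sup>2)" for z w z'
    by (simp add: b_def c_def power2_norm_eq_inner inner_diff_left inner_diff_right inner_commute algebra_simps)
  have lower: "ereal (r z + (w \<bullet> (z' - z) + s / 2 * (norm (z' - z))\<^sup>2)) \<le> fhat z'" if "(z, w) \<in> G" for z w z'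
  proof -
    have "ereal (b (z, w) + c (z, w) \<bullet> z') \<le> h z'" unfolding h_def using that by (rule SUP_upper)
    then have "ereal (b (z, w) + c (z, w) \<bullet> z') + ereal (s / 2 * (norm z')\<^sup>2) \<le> fhat z'"
      unfolding fhat_def by (rule add_right_mono)
    then show ?thesis by (simp only: bc plus_ereal.simps)
  qed
  have upper: "fhat z' \<le> f z'" if "z' \<in> X" for z'
  proof -
    have "h z' \<le> f z' - ereal (s / 2 * (norm z')\<^sup>2)" unfolding h_def
    proof (rule SUP_least)
      fix i assume "i \<in> G"
      then obtain z w where i: "i = (z, w)" "(z, w) \<in> G" by (cases i) auto
      have "f z + ereal (w \<bullet> (z' - z) + s / 2 * (norm (z' - z))\<^sup>2) \<le> f z'"
        using growth i(2) that unfolding G_iff by blast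
      then have "ereal (b i + c i \<bullet> z' + s / 2 * (norm z')\<^sup>2) \<le> f z'" unfolding i(1) bc using r[OF i(2)] by simp
      then show "ereal (b i + c i \<bullet> z') \<le> f z' - ereal (s / 2 * (norm z')\<^sup>2)" by (cases "f z'") auto
    qed
    then show ?thesis unfolding fhat_def by (cases "h z'"; cases "f z'") auto
  qed
  have hnm: "h z \<noteq> -\<infinity>" for z
  proof -
    have "ereal (b (zbar, wbar) + c (zbar, wbar) \<bullet> z) \<le> h z" unfolding h_def using Gbar by (rule SUP_upper)
    then show ?thesis by auto
  qed
  have "lsc h" unfolding h_def by (rule lsc_SUP_continuous) (intro continuous_intros)
  then have "lsc fhat" unfolding fhat_def using hnm
    by (intro lsc_add_continuous) (auto intro!: continuous_intros)
  moreover have "proper_fun fhat" unfolding proper_fun_def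
  proof (intro conjI allI exI)
    show "fhat z \<noteq> -\<infinity>" for z unfolding fhat_def using hnm[of z] by (cases "h z") auto
    show "fhat zbar \<noteq> \<infinity>" using upper[OF X(2)] a by auto
  qed
  ultimately have cphat: "closed_proper fhat" by (simp add: closed_proper_def)
  have "fhat z - ereal (s / 2 * (norm z)\<^sup>2) = h z" for z
    unfolding fhat_def by (cases "h z") auto
  then have schat: "s_convex s fhat" unfolding s_convex_def
    using convex_fun_SUP_affine[of G b c] Gbar by (auto simp: h_def)
  have eqG: "fhat z = f z" if "(z, w) \<in> G" for z w
    using lower[OF that, of z] upper[of z] that r[OF that] by (auto simp: G_iff intro: antisym)
  have sub: "w \<in> subdiff fhat z" if "(z, w) \<in> G" for z w
  proof -
    have "fhat z = ereal (r z)" using eqG[OF that] r[OF that] by simp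
    moreover have "\<forall>\<^sub>F z' in nhds z. ereal (r z + w \<bullet> (z' - z) - (- s/2) * (norm (z' - z))\<^sup>2) \<le> fhat z'"
      using lower[OF that] by (auto intro!: always_eventually simp: algebra_simps)
    ultimately have "w \<in> regular_subdiff fhat z" by (rule regular_subdiff_quadraticI)
    then show ?thesis using regular_subdiff_subset by blast
  qed
  obtain \<epsilon> where \<epsilon>: "\<epsilon> > 0" "cball zbar \<epsilon> \<subseteq> X" using X open_contains_cball by blast
  obtain \<eta> where \<eta>: "\<eta> > 0" "ball wbar \<eta> \<subseteq> W" using W open_contains_ball by blast
  have a\<alpha>: "a < \<alpha>" using \<alpha> a by simp
  \<comment> \<open>The tilted minimizer y exceeds the value a by at most |w| |y - zbar|. With |w|
    at most |wbar| + \<eta>, the second bound on the radius keeps \<open>f y\<close> below \<alpha>,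
    hence y in the truncation.\<close>
  define \<epsilon>' where "\<epsilon>' = min \<epsilon> ((\<alpha> - a) / (norm wbar + \<eta>))"
  have pos: "norm wbar + \<eta> > 0" using \<eta> by (simp add: add_nonneg_pos)
  have \<epsilon>': "\<epsilon>' > 0" "\<epsilon>' \<le> \<epsilon>" "(norm wbar + \<eta>) * \<epsilon>' \<le> \<alpha> - a"
  proof -
    show "\<epsilon>' > 0" "\<epsilon>' \<le> \<epsilon>" unfolding \<epsilon>'_def using \<epsilon> a\<alpha> pos by auto
    have "(norm wbar + \<eta>) * \<epsilon>' \<le> (norm wbar + \<eta>) * ((\<alpha> - a) / (norm wbar + \<eta>))"
      using pos by (intro mult_left_mono) (auto simp: \<epsilon>'_def)
    then show "(norm wbar + \<eta>) * \<epsilon>' \<le> \<alpha> - a" using pos by simp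
  qed
  \<comment> \<open>The bound s \<epsilon>' / 2 is the closeness that
    \<open>tilted_minimizer\<close> requires.\<close>
  define \<eta>' where "\<eta>' = min \<eta> (s * \<epsilon>' / 2)"
  have \<eta>': "\<eta>' > 0" "\<eta>' \<le> \<eta>" "2 * \<eta>' \<le> s * \<epsilon>'" unfolding \<eta>'_def using \<eta> s \<epsilon>' by auto
  define X' where "X' = ball zbar \<epsilon>'"
  define W' where "W' = ball wbar \<eta>'"
  have X': "X' \<subseteq> X" unfolding X'_def using \<epsilon> \<epsilon>' by auto
  have W': "W' \<subseteq> W" unfolding W'_def using \<eta> \<eta>' by (meson order_trans subset_ball)
  have graph: "(X' \<times> W') \<inter> gph_subdiff fhat = (truncated X' f \<alpha> \<times> W') \<inter> gph_subdiff f"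
  proof (intro set_eqI iffI)
    fix p assume "p \<in> (truncated X' f \<alpha> \<times> W') \<inter> gph_subdiff f"
    then obtain z w where p: "p = (z, w)" "z \<in> X'" "w \<in> W'" "(z, w) \<in> G"
      using X' W' by (cases p) (auto simp: truncated_def gph_subdiff_def G_iff)
    then show "p \<in> (X' \<times> W') \<inter> gph_subdiff fhat" using sub by (auto simp: gph_subdiff_def)
  next
    fix p assume "p \<in> (X' \<times> W') \<inter> gph_subdiff fhat"
    then obtain z w where p: "p = (z, w)" "z \<in> X'" "w \<in> W'" "w \<in> subdiff fhat z"
      by (cases p) (auto simp: gph_subdiff_def)
    have "norm (w - wbar) < \<eta>'" using p(3) by (simp add: W'_def dist_norm norm_minus_commute)
    then have nw: "2 * norm (w - wbar) < s * \<epsilon>'" "norm (w - wbar) < \<eta>" using \<eta>' by auto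
    obtain y where y: "w \<in> regular_subdiff f y" "norm (y - zbar) < \<epsilon>'" "f y \<le> ereal (a + w \<bullet> (y - zbar))"
    proof (rule tilted_minimizer[OF lsc a nm s \<epsilon>'(1) nw(1)])
      fix z' assume "z' \<in> cball zbar \<epsilon>'"
      then have "z' \<in> X" using \<epsilon> \<epsilon>' by auto
      then have "f zbar + ereal (wbar \<bullet> (z' - zbar) + s / 2 * (norm (z' - zbar))\<^sup>2) \<le> f z'"
        by (intro growth X W \<alpha> wbar)
      then show "ereal (a + wbar \<bullet> (z' - zbar) + s / 2 * (norm (z' - zbar))\<^sup>2) \<le> f z'" using a by (simp add: add.assoc)
    qed (rule that)
    have "norm w \<le> norm wbar + \<eta>" using nw(2) norm_triangle_ineq[of wbar "w - wbar"] by simp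
    have "w \<bullet> (y - zbar) \<le> norm w * norm (y - zbar)" by (rule norm_cauchy_schwarz)
    also have "\<dots> \<le> (norm wbar + \<eta>) * norm (y - zbar)"
      using \<open>norm w \<le> norm wbar + \<eta>\<close> by (intro mult_right_mono) auto
    also have "\<dots> < (norm wbar + \<eta>) * \<epsilon>'" using y(2) pos by simp
    also have "\<dots> \<le> \<alpha> - a" by (rule \<epsilon>')
    finally have "f y < ereal \<alpha>" using y(3) by (simp add: order_le_less_trans)
    moreover have "y \<in> X" using X' y(2) by (auto simp: X'_def dist_norm norm_minus_commute)
    moreover have "w \<in> W" using p W' by auto
    ultimately have yG: "(y, w) \<in> G" using y(1) regular_subdiff_subset by (auto simp: G_iff)
    then have "w \<in> subdiff fhat y" by (rule sub)
    \<comment> \<open>Added, the two strong subgradient inequalities for the same w at y and z lose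
      their linear parts and leave s |z - y|^2 \<le> 0.\<close>
    note subgradient_s_convex[OF schat this, of z] subgradient_s_convex[OF schat p(4), of y]
    moreover obtain a1 a2 where "fhat y = ereal a1" "fhat z = ereal a2"
      using subdiff_finite \<open>w \<in> subdiff fhat y\<close> p(4) by metis
    ultimately have "s * (norm (z - y))\<^sup>2 \<le> 0"
      by (simp add: norm_minus_commute inner_diff_right)
    then have "z = y" using s by (simp add: mult_le_0_iff)
    then show "p \<in> (truncated X' f \<alpha> \<times> W') \<inter> gph_subdiff f"
      using p yG by (auto simp: G_iff truncated_def gph_subdiff_def)
  qed
  have eq: "\<forall>(z, w) \<in> (truncated X' f \<alpha> \<times> W') \<inter> gph_subdiff f. fhat z = f z"
  proof (rule ballI, clarify)
    fix z w assume "z \<in> truncated X' f \<alpha>" "w \<in> W'" "(z, w) \<in> gph_subdiff f"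
    then show "fhat z = f z"
      using X' W' by (intro eqG[of z w]) (auto simp: G_iff truncated_def gph_subdiff_def)
  qed
  have X'up: "\<forall>z\<in>X'. fhat z \<le> f z" using upper X' by blast
  have "open X'" "convex X'" "zbar \<in> X'" "open W'" "convex W'" "wbar \<in> W'"
    unfolding X'_def W'_def using \<epsilon>'(1) \<eta>'(1) by auto
  then show ?thesis
    unfolding variationally_s_convex_def
    by (intro conjI exI[of _ X'] exI[of _ W'] exI[of _ \<alpha>] exI[of _ fhat] wbar \<alpha> cphat schat X'up graph eq)
qed

section \<open>Exact penalization\<close>

lemma M_delta_iff:
  fixes \<phi> :: "'x::euclidean_space \<times> 'u::euclidean_space \<Rightarrow> ereal"
  assumes nm: "\<And>z. \<phi> z \<noteq> -\<infinity>"
  shows "x \<in> M_delta \<phi> xbar \<delta> v u \<longleftrightarrow> norm (x - xbar) < \<delta> \<and>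
    (\<exists>a. \<phi> (x, u) = ereal a \<and> (\<forall>x'. norm (x' - xbar) < \<delta> \<longrightarrow> ereal (a + v \<bullet> (x' - x)) \<le> \<phi> (x', u)))"
    (is "_ \<longleftrightarrow> ?R")
proof
  assume "x \<in> M_delta \<phi> xbar \<delta> v u"
  then have *: "norm (x - xbar) < \<delta>" "\<phi> (x, u) - ereal (v \<bullet> (x - xbar)) = m_delta \<phi> xbar \<delta> v u"
     "m_delta \<phi> xbar \<delta> v u < \<infinity>"
    by (auto simp: M_delta_def dist_norm norm_minus_commute)
  then obtain a where a: "\<phi> (x, u) = ereal a" using nm[of "(x, u)"] by (cases "\<phi> (x, u)") auto
  have "ereal (a + v \<bullet> (x' - x)) \<le> \<phi> (x', u)" if "norm (x' - xbar) < \<delta>" for x'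
  proof -
    have "m_delta \<phi> xbar \<delta> v u \<le> \<phi> (x', u) - ereal (v \<bullet> (x' - xbar))"
      unfolding m_delta_def by (rule INF_lower) (use that in \<open>auto simp: dist_norm norm_minus_commute\<close>)
    then have "ereal (a - v \<bullet> (x - xbar)) \<le> \<phi> (x', u) - ereal (v \<bullet> (x' - xbar))" using *(2) a by simp
    then show ?thesis by (cases "\<phi> (x', u)") (auto simp: inner_diff_right)
  qed
  then show ?R using * a by blast
next
  assume ?R
  then obtain a where a: "norm (x - xbar) < \<delta>" "\<phi> (x, u) = ereal a"
    "\<And>x'. norm (x' - xbar) < \<delta> \<Longrightarrow> ereal (a + v \<bullet> (x' - x)) \<le> \<phi> (x', u)" by blast
  have "m_delta \<phi> xbar \<delta> v u = ereal (a - v \<bullet> (x - xbar))"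
  proof (rule antisym)
    show "m_delta \<phi> xbar \<delta> v u \<le> ereal (a - v \<bullet> (x - xbar))"
      unfolding m_delta_def
      by (rule INF_lower2[of x]) (use a in \<open>auto simp: dist_norm norm_minus_commute\<close>)
    show "ereal (a - v \<bullet> (x - xbar)) \<le> m_delta \<phi> xbar \<delta> v u"
      unfolding m_delta_def
    proof (rule INF_greatest)
      fix x' assume "x' \<in> ball xbar \<delta>"
      then have "ereal (a + v \<bullet> (x' - x)) \<le> \<phi> (x', u)" by (intro a) (simp add: dist_norm norm_minus_commute)
      then show "ereal (a - v \<bullet> (x - xbar)) \<le> \<phi> (x', u) - ereal (v \<bullet> (x' - xbar))"
        by (cases "\<phi> (x', u)") (auto simp: inner_diff_right)
    qed
  qed
  then show "x \<in> M_delta \<phi> xbar \<delta> v u"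
    using a by (auto simp: M_delta_def dist_norm norm_minus_commute)
qed

lemma m_delta_eq:
  assumes "x \<in> M_delta \<phi> xbar \<delta> v u" "\<phi> (x, u) = ereal a"
  shows "m_delta \<phi> xbar \<delta> v u = ereal (a - v \<bullet> (x - xbar))"
  using assms by (auto simp: M_delta_def)

text \<open>The right side is a smooth majorant of the norm, with equality where the norm is a. It
  can therefore stand in for the norm at a minimizer.\<close>

lemma norm_le_square_tangent:
  fixes p :: "'a::real_normed_vector"
  assumes "a > 0"
  shows "norm p \<le> (a\<^sup>2 + (norm p)\<^sup>2) / (2 * a)"
  using sum_squares_bound[of a "norm p"] assms by (simp add: field_simps power2_eq_square)

text \<open>The function is left abstract because the locale is used twice: for the given problem,
  and for a regularized one whose reference point has been made a strict minimizer. Strictness on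
  the closed ball is what lets compactness arguments identify cluster points with
  \<open>xbar\<close>; \<open>bound\<close> is the constraint qualification in quantitative
  form.\<close>

locale calm =
  fixes \<phi> :: "'x::euclidean_space \<times> 'u::euclidean_space \<Rightarrow> ereal"
    and xbar :: 'x and \<phi>b \<delta> \<epsilon> K :: real
  assumes lsc: "lsc \<phi>" and nm: "\<And>z. \<phi> z \<noteq> -\<infinity>" and \<phi>b: "\<phi> (xbar, 0) = ereal \<phi>b"
    and \<delta>: "\<delta> > 0"
    and strict: "\<And>x. norm (x - xbar) \<le> \<delta> \<Longrightarrow> x \<noteq> xbar \<Longrightarrow> ereal \<phi>b < \<phi> (x, 0)"
    and \<epsilon>: "\<epsilon> > 0"
    and bound: "\<And>x u v y. norm (x - xbar) < \<epsilon> \<Longrightarrow> norm u < \<epsilon> \<Longrightarrow> norm v < \<epsilon> \<Longrightarrow>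
       \<phi> (x, u) < ereal (\<phi>b + \<epsilon>) \<Longrightarrow> (v, y) \<in> regular_subdiff \<phi> (x, u) \<Longrightarrow> norm y \<le> K"
begin

lemma lower_limit:
  assumes "\<And>k. norm (x k - xbar) \<le> \<delta>" "u \<longlonglongrightarrow> 0" "\<And>k. \<phi> (x k, u k) \<le> ereal (c k)" "c \<longlonglongrightarrow> c0"
  shows "\<exists>x0 r. strict_mono r \<and> (x \<circ> r) \<longlonglongrightarrow> x0 \<and> norm (x0 - xbar) \<le> \<delta> \<and> \<phi> (x0, 0) \<le> ereal c0"
proof -
  have "\<forall>k. x k \<in> cball xbar \<delta>" using assms(1) by (simp add: dist_norm norm_minus_commute)
  then obtain x0 r where r: "x0 \<in> cball xbar \<delta>" "strict_mono (r :: nat \<Rightarrow> nat)" "(x \<circ> r) \<longlonglongrightarrow> x0"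
    using compact_cball[unfolded compact_def, rule_format, of x xbar \<delta>] by blast
  have "(\<lambda>k. (x (r k), u (r k))) \<longlonglongrightarrow> (x0, 0)"
    using r(3) LIMSEQ_subseq_LIMSEQ[OF assms(2) r(2)] by (intro tendsto_Pair) (auto simp: o_def)
  then have "\<phi> (x0, 0) \<le> ereal c0"
    by (rule lsc_limit_le[OF lsc _ LIMSEQ_subseq_LIMSEQ[OF assms(4) r(2)]]) (use assms(3) in auto)
  then show ?thesis using r by (auto simp: dist_norm norm_minus_commute)
qed

text \<open>Otherwise points with u tending to 0 and values tending to at most
  \<open>\<phi>b\<close> would have a cluster point at u = 0 other than \<open>xbar\<close>, against
  strictness.\<close>

lemma localize:
  assumes "\<rho> > 0"
  shows "\<exists>\<theta>>0. \<forall>x u. norm (x - xbar) \<le> \<delta> \<longrightarrow> norm u \<le> \<theta> \<longrightarrow> \<phi> (x, u) \<le> ereal (\<phi>b + \<theta>) \<longrightarrow> norm (x - xbar) < \<rho>"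
proof (rule ccontr)
  assume neg: "\<not> ?thesis"
  have "\<exists>x u. norm (x - xbar) \<le> \<delta> \<and> norm u \<le> inverse (Suc k) \<and> \<phi> (x, u) \<le> ereal (\<phi>b + inverse (Suc k)) \<and> \<not> norm (x - xbar) < \<rho>" for k :: nat
  proof (rule ccontr)
    assume "\<not> ?thesis"
    then show False using neg
      by (auto dest!: spec[of _ "inverse (real (Suc k))"] simp del: of_nat_Suc)
  qed
  then obtain x u where *: "\<And>k::nat. norm (x k - xbar) \<le> \<delta>" "\<And>k. norm (u k) \<le> inverse (real (Suc k))"
    "\<And>k. \<phi> (x k, u k) \<le> ereal (\<phi>b + inverse (real (Suc k)))" "\<And>k. \<not> norm (x k - xbar) < \<rho>"
    by metis
  have u: "u \<longlonglongrightarrow> 0" by (rule Lim_null_comparison[OF _ LIMSEQ_inverse_real_of_nat]) (use *(2) in auto)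
  have c: "(\<lambda>k. \<phi>b + inverse (real (Suc k))) \<longlonglongrightarrow> \<phi>b"
    using tendsto_add[OF tendsto_const LIMSEQ_inverse_real_of_nat, of \<phi>b] by simp
  obtain x0 r where r: "(x \<circ> r) \<longlonglongrightarrow> x0" "norm (x0 - xbar) \<le> \<delta>" "\<phi> (x0, 0) \<le> ereal \<phi>b"
    using lower_limit[OF *(1) u *(3) c] by blast
  have "x0 = xbar" using strict[OF r(2)] r(3) by force
  moreover have "\<rho> \<le> norm (x0 - xbar)"
  proof (rule LIMSEQ_le_const)
    show "(\<lambda>k. norm ((x \<circ> r) k - xbar)) \<longlonglongrightarrow> norm (x0 - xbar)" by (intro tendsto_intros r)
  qed (use *(4) in \<open>auto simp: not_less\<close>)
  ultimately show False using assms by simp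
qed

lemma lower_bound: "\<exists>\<theta>>0. \<forall>x u. norm (x - xbar) \<le> \<delta> \<longrightarrow> norm u \<le> \<theta> \<longrightarrow> ereal (\<phi>b - 1) \<le> \<phi> (x, u)"
proof (rule ccontr)
  assume neg: "\<not> ?thesis"
  have "\<exists>x u. norm (x - xbar) \<le> \<delta> \<and> norm u \<le> inverse (Suc k) \<and> \<phi> (x, u) \<le> ereal (\<phi>b - 1)" for k :: nat
  proof (rule ccontr)
    assume "\<not> ?thesis"
    then show False using neg
      by (auto dest!: spec[of _ "inverse (real (Suc k))"] simp del: of_nat_Suc) (meson linear)
  qed
  then obtain x u where *: "\<And>k::nat. norm (x k - xbar) \<le> \<delta>" "\<And>k. norm (u k) \<le> inverse (real (Suc k))"
    "\<And>k. \<phi> (x k, u k) \<le> ereal (\<phi>b - 1)"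
    by metis
  have u: "u \<longlonglongrightarrow> 0" by (rule Lim_null_comparison[OF _ LIMSEQ_inverse_real_of_nat]) (use *(2) in auto)
  obtain x0 where r: "norm (x0 - xbar) \<le> \<delta>" "\<phi> (x0, 0) \<le> ereal (\<phi>b - 1)"
    using lower_limit[OF *(1) u *(3) tendsto_const] by blast
  then show False
    using order_less_le_trans[OF strict[OF r(1)] r(2)] \<phi>b by (cases "x0 = xbar") auto
qed

text \<open>Minimize \<open>\<phi>\<close> minus the tilt plus K' |u - u0| over a box. If the
  minimizer (p, q) had q different from u0, the penalty would be smooth there and would produce a
  subgradient whose u-component has norm exactly K', more than \<open>bound\<close> permits. Hence q
  = u0, and minimality is the asserted inequality.\<close>

lemma penalty:
  "\<exists>\<theta>>0. \<exists>K'\<ge>0. \<forall>v u0. norm v \<le> \<theta> \<longrightarrow> norm u0 \<le> \<theta> \<longrightarrow>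
    (\<exists>x0 a0. norm (x0 - xbar) < \<delta> \<and> \<phi> (x0, u0) = ereal a0 \<and>
      (\<forall>x1 u1. norm (x1 - xbar) \<le> \<delta> \<longrightarrow> norm u1 \<le> \<theta> \<longrightarrow>
         ereal (a0 + v \<bullet> (x1 - x0) - K' * norm (u1 - u0)) \<le> \<phi> (x1, u1)))"
proof -
  obtain \<theta>1 where \<theta>1: "\<theta>1 > 0" "\<And>x u. norm (x - xbar) \<le> \<delta> \<Longrightarrow> norm u \<le> \<theta>1 \<Longrightarrow> \<phi> (x, u) \<le> ereal (\<phi>b + \<theta>1) \<Longrightarrow> norm (x - xbar) < min \<epsilon> \<delta>"
    using localize[of "min \<epsilon> \<delta>"] \<epsilon> \<delta> by fastforce
  obtain \<theta>2 where \<theta>2: "\<theta>2 > 0" "\<And>x u. norm (x - xbar) \<le> \<delta> \<Longrightarrow> norm u \<le> \<theta>2 \<Longrightarrow> ereal (\<phi>b - 1) \<le> \<phi> (x, u)"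
    using lower_bound by blast
  define \<eta> where "\<eta> = min (min \<theta>1 \<theta>2) (\<epsilon> / 2)"
  have \<eta>: "\<eta> > 0" "\<eta> \<le> \<theta>1" "\<eta> \<le> \<theta>2" "\<eta> \<le> \<epsilon> / 2" unfolding \<eta>_def using \<theta>1 \<theta>2 \<epsilon> by auto
  \<comment> \<open>Exceeding K gives the contradiction with \<open>bound\<close>; 8/\<eta> makes
    leaving u0 so expensive that q stays inside the box.\<close>
  define K' where "K' = max (K + 1) (8 / \<eta>)"
  have K': "K' > K" "8 / \<eta> \<le> K'" unfolding K'_def by auto
  have "8 / \<eta> > 0" using \<eta> by simp
  then have K'0: "K' > 0" using K' by linarith
  \<comment> \<open>These bounds make the tilt at most 1 and the value at (p, q) at most
    \<open>\<phi>b\<close> + \<eta>/2, so that \<open>localize\<close> and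
    \<open>lower_bound\<close> apply.\<close>
  define \<theta> where "\<theta> = min (\<eta> / 8) (min (1 / \<delta>) ((\<eta> / 2) / (K' + \<delta>)))"
  have "\<theta> > 0" unfolding \<theta>_def using \<eta> K'0 \<delta> by simp
  moreover have "\<theta> \<le> \<eta> / 8" unfolding \<theta>_def by (rule min.cobounded1)
  ultimately have \<theta>: "\<theta> > 0" "\<theta> \<le> \<eta> / 8" .
  have "\<theta> \<le> 1 / \<delta>" "\<theta> \<le> (\<eta> / 2) / (K' + \<delta>)" unfolding \<theta>_def by auto
  then have \<theta>': "\<theta> * \<delta> \<le> 1" "K' * \<theta> + \<theta> * \<delta> \<le> \<eta> / 2"
    using \<delta> K'0 by (auto simp: field_simps)
  have main: "\<exists>x0 a0. norm (x0 - xbar) < \<delta> \<and> \<phi> (x0, u0) = ereal a0 \<and>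
      (\<forall>x1 u1. norm (x1 - xbar) \<le> \<delta> \<longrightarrow> norm u1 \<le> \<theta> \<longrightarrow>
         ereal (a0 + v \<bullet> (x1 - x0) - K' * norm (u1 - u0)) \<le> \<phi> (x1, u1))"
    if v: "norm v \<le> \<theta>" and u0: "norm u0 \<le> \<theta>" for v u0
  proof -
    let ?F = "\<lambda>z. \<phi> z + ereal (K' * norm (snd z - u0) - v \<bullet> (fst z - xbar))"
    let ?B = "cball xbar \<delta> \<times> cball (0::'u) \<eta>"
    have lscF: "lsc ?F" by (intro lsc_add_continuous lsc nm continuous_intros)
    have "compact ?B" by (intro compact_Times compact_cball)
    then have "\<exists>z\<in>?B. \<forall>z'\<in>?B. ?F z \<le> ?F z'"
      by (rule lsc_attains_min[OF lscF]) (use \<delta> \<eta> in auto)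
    then obtain p q where pqB: "(p, q) \<in> ?B" and minB: "\<forall>z'\<in>?B. ?F (p, q) \<le> ?F z'"
      by (metis prod.exhaust)
    have pq: "norm (p - xbar) \<le> \<delta>" "norm q \<le> \<eta>" using pqB by (auto simp: dist_norm norm_minus_commute)
    have min: "?F (p, q) \<le> ?F (x1, u1)" if "norm (x1 - xbar) \<le> \<delta>" "norm u1 \<le> \<eta>" for x1 u1
      using bspec[OF minB, of "(x1, u1)"] that by (simp add: dist_norm norm_minus_commute)
    have "?F (p, q) \<le> ?F (xbar, 0)" using min[of xbar 0] \<delta> \<eta> by simp
    then obtain b where b: "\<phi> (p, q) = ereal b" "b + K' * norm (q - u0) - v \<bullet> (p - xbar) \<le> \<phi>b + K' * norm u0"
      using \<phi>b nm[of "(p, q)"] by (cases "\<phi> (p, q)") auto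
    have vp: "v \<bullet> (p - xbar) \<le> \<theta> * \<delta>"
      using norm_cauchy_schwarz[of v "p - xbar"] mult_mono[OF v pq(1)] \<theta> by simp
    have ku: "K' * norm u0 \<le> K' * \<theta>" using K'0 u0 by simp
    have kq: "K' * norm (q - u0) \<ge> 0" using K'0 by simp
    have b1: "b \<le> \<phi>b + \<eta> / 2" using b(2) vp ku kq \<theta>' by linarith
    have b2: "\<phi>b - 1 \<le> b" using \<theta>2(2)[OF pq(1), of q] pq(2) \<eta> b by simp
    have "K' * norm (q - u0) \<le> 2 + K' * \<theta>" using b(2) vp ku b2 \<theta>' by linarith
    then have "norm (q - u0) \<le> 2 / K' + \<theta>" using K'0 by (simp add: field_simps)
    moreover have "2 / K' \<le> \<eta> / 4" using K'(2) K'0 \<eta> by (simp add: field_simps)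
    ultimately have "norm (q - u0) \<le> 3 * \<eta> / 8" using \<theta> by linarith
    moreover have "norm q \<le> norm (q - u0) + norm u0" using norm_triangle_ineq[of "q - u0" u0] by simp
    ultimately have q: "norm q < \<eta>" using u0 \<theta> \<eta> by linarith
    have p: "norm (p - xbar) < min \<epsilon> \<delta>"
      using \<theta>1(2)[OF pq(1), of q] q \<eta> b b1 by simp
    have pe: "norm (p - xbar) < \<epsilon>" and pd: "norm (p - xbar) < \<delta>" using p by auto
    have "q = u0"
    proof (rule ccontr)
      assume "q \<noteq> u0"
      define \<tau> where "\<tau> = norm (q - u0)"
      have \<tau>: "\<tau> > 0" using \<open>q \<noteq> u0\<close> by (simp add: \<tau>_def)
      have "\<forall>\<^sub>F z' in nhds (p, q). z' \<in> ball xbar \<delta> \<times> ball 0 \<eta>"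
        using pd q by (intro eventually_nhds_in_open open_Times) (auto simp: dist_norm norm_minus_commute)
      then have "\<forall>\<^sub>F z' in nhds (p, q). ereal (b + (v, - (K' / \<tau>) *\<^sub>R (q - u0)) \<bullet> (z' - (p, q))
            - K' / (2 * \<tau>) * (norm (z' - (p, q)))\<^sup>2) \<le> \<phi> z'"
      proof eventually_elim
        case (elim z')
        obtain x1 u1 where z': "z' = (x1, u1)" by (cases z')
        have "?F (p, q) \<le> ?F (x1, u1)"
          using elim by (intro min) (auto simp: z' dist_norm norm_minus_commute)
        then have 1: "ereal (b + v \<bullet> (x1 - p) - K' * (norm (u1 - u0) - \<tau>)) \<le> \<phi> (x1, u1)"
          using b by (cases "\<phi> (x1, u1)") (auto simp: inner_diff_right \<tau>_def algebra_simps)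
        \<comment> \<open>The quadratic majorant touching the norm at q turns minimality into a
          quadratic minorant of \<open>\<phi>\<close>.\<close>
        have "norm (u1 - u0) \<le> (\<tau>\<^sup>2 + (norm (u1 - u0))\<^sup>2) / (2 * \<tau>)"
          by (rule norm_le_square_tangent[OF \<tau>])
        also have "(norm (u1 - u0))\<^sup>2 = \<tau>\<^sup>2 + 2 * ((q - u0) \<bullet> (u1 - q)) + (norm (u1 - q))\<^sup>2"
          unfolding \<tau>_def power2_norm_eq_inner by (simp add: inner_diff_left inner_diff_right inner_commute)
        also have "(\<tau>\<^sup>2 + (\<tau>\<^sup>2 + 2 * ((q - u0) \<bullet> (u1 - q)) + (norm (u1 - q))\<^sup>2)) / (2 * \<tau>)
           = \<tau> + ((q - u0) \<bullet> (u1 - q)) / \<tau> + (norm (u1 - q))\<^sup>2 / (2 * \<tau>)"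
          using \<tau> by (simp add: field_simps power2_eq_square)
        finally have "K' * (norm (u1 - u0) - \<tau>) \<le> K' * (((q - u0) \<bullet> (u1 - q)) / \<tau> + (norm (u1 - q))\<^sup>2 / (2 * \<tau>))"
          using K'0 by (intro mult_left_mono) auto
        also have "\<dots> = K' / \<tau> * ((q - u0) \<bullet> (u1 - q)) + K' / (2 * \<tau>) * (norm (u1 - q))\<^sup>2"
          by (simp add: distrib_left)
        also have "K' / (2 * \<tau>) * (norm (u1 - q))\<^sup>2 \<le> K' / (2 * \<tau>) * (norm (z' - (p, q)))\<^sup>2"
          using K'0 \<tau> by (intro mult_left_mono power_mono) (auto simp: z' intro: norm_snd_le)
        finally have 2: "K' * (norm (u1 - u0) - \<tau>) \<le> K' / \<tau> * ((q - u0) \<bullet> (u1 - q))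
            + K' / (2 * \<tau>) * (norm (z' - (p, q)))\<^sup>2" by simp
        have "(v, - (K' / \<tau>) *\<^sub>R (q - u0)) \<bullet> (z' - (p, q)) = v \<bullet> (x1 - p) - K' / \<tau> * ((q - u0) \<bullet> (u1 - q))"
          unfolding z' by (simp only: diff_Pair inner_Pair inner_scaleR_left minus_mult_left[symmetric] add_uminus_conv_diff)
        with 2 have "b + (v, - (K' / \<tau>) *\<^sub>R (q - u0)) \<bullet> (z' - (p, q)) - K' / (2 * \<tau>) * (norm (z' - (p, q)))\<^sup>2
          \<le> b + v \<bullet> (x1 - p) - K' * (norm (u1 - u0) - \<tau>)" by linarith
        then show ?case using 1 unfolding z' by (meson ereal_less_eq(3) order_trans)
      qed
      then have "(v, - (K' / \<tau>) *\<^sub>R (q - u0)) \<in> regular_subdiff \<phi> (p, q)"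
        by (rule regular_subdiff_quadraticI[of \<phi> "(p, q)" b, OF b(1)])
      then have "norm (- (K' / \<tau>) *\<^sub>R (q - u0)) \<le> K"
        by (rule bound[rotated -1]) (use pe q v \<theta> \<eta> \<epsilon> b b1 in auto)
      then show False using K'(1) K'0 \<tau> by (simp add: \<tau>_def)
    qed
    have "ereal (b + v \<bullet> (x1 - p) - K' * norm (u1 - u0)) \<le> \<phi> (x1, u1)"
      if "norm (x1 - xbar) \<le> \<delta>" "norm u1 \<le> \<theta>" for x1 u1
    proof -
      have "?F (p, q) \<le> ?F (x1, u1)" using that \<theta> \<eta> by (intro min) auto
      then show ?thesis using b \<open>q = u0\<close> by (cases "\<phi> (x1, u1)") (auto simp: inner_diff_right)
    qed
    then show ?thesis using b pd \<open>q = u0\<close> by blast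
  qed
  then show ?thesis using \<theta>(1) K'0 less_imp_le by (intro exI[of _ \<theta>] conjI exI[of _ K']) auto
qed

text \<open>\<open>penalty\<close> produces one minimizer x0. Any other minimizer x satisfies a + v
  (x0 - x) \<le> a0 by its own optimality, so its penalized minorant lies below the one for
  x0.\<close>

lemma exact_penalty:
  obtains \<theta> K' where "\<theta> > 0" "K' \<ge> 0"
    "\<And>v u. norm v \<le> \<theta> \<Longrightarrow> norm u \<le> \<theta> \<Longrightarrow> M_delta \<phi> xbar \<delta> v u \<noteq> {}"
    "\<And>v u x. norm v \<le> \<theta> \<Longrightarrow> norm u \<le> \<theta> \<Longrightarrow> x \<in> M_delta \<phi> xbar \<delta> v u \<Longrightarrow>
       \<exists>a. \<phi> (x, u) = ereal a \<and> (\<forall>x1 u1. norm (x1 - xbar) \<le> \<delta> \<longrightarrow> norm u1 \<le> \<theta> \<longrightarrow>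
         ereal (a + v \<bullet> (x1 - x) - K' * norm (u1 - u)) \<le> \<phi> (x1, u1))"
proof -
  obtain \<theta> K' where *: "\<theta> > 0" "K' \<ge> 0" and pen: "\<And>v u0. norm v \<le> \<theta> \<Longrightarrow> norm u0 \<le> \<theta> \<Longrightarrow>
    (\<exists>x0 a0. norm (x0 - xbar) < \<delta> \<and> \<phi> (x0, u0) = ereal a0 \<and>
      (\<forall>x1 u1. norm (x1 - xbar) \<le> \<delta> \<longrightarrow> norm u1 \<le> \<theta> \<longrightarrow>
         ereal (a0 + v \<bullet> (x1 - x0) - K' * norm (u1 - u0)) \<le> \<phi> (x1, u1)))"
    using penalty by blast
  show ?thesis
  proof (rule that[OF *])
    fix v u assume vu: "norm (v::'x) \<le> \<theta>" "norm (u::'u) \<le> \<theta>"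
    obtain x0 a0 where x0: "norm (x0 - xbar) < \<delta>" "\<phi> (x0, u) = ereal a0"
      "\<And>x1 u1. norm (x1 - xbar) \<le> \<delta> \<Longrightarrow> norm u1 \<le> \<theta> \<Longrightarrow>
         ereal (a0 + v \<bullet> (x1 - x0) - K' * norm (u1 - u)) \<le> \<phi> (x1, u1)"
      using pen[OF vu] by blast
    have "x0 \<in> M_delta \<phi> xbar \<delta> v u"
      unfolding M_delta_iff[OF nm] using x0(1,2) x0(3)[of _ u] vu by auto
    then show "M_delta \<phi> xbar \<delta> v u \<noteq> {}" by auto
    fix x assume x: "x \<in> M_delta \<phi> xbar \<delta> v u"
    then obtain a where a: "\<phi> (x, u) = ereal a"
      "\<And>x'. norm (x' - xbar) < \<delta> \<Longrightarrow> ereal (a + v \<bullet> (x' - x)) \<le> \<phi> (x', u)"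
      unfolding M_delta_iff[OF nm] by blast
    have "a + v \<bullet> (x0 - x) \<le> a0" using a(2)[OF x0(1)] x0(2) by simp
    then have "a + v \<bullet> (x1 - x) - K' * norm (u1 - u) \<le> a0 + v \<bullet> (x1 - x0) - K' * norm (u1 - u)" for x1 u1
      by (simp add: inner_diff_right)
    then have "ereal (a + v \<bullet> (x1 - x) - K' * norm (u1 - u)) \<le> \<phi> (x1, u1)"
      if "norm (x1 - xbar) \<le> \<delta>" "norm u1 \<le> \<theta>" for x1 u1
      using x0(3)[OF that] by (meson ereal_less_eq(3) order_trans)
    then show "\<exists>a. \<phi> (x, u) = ereal a \<and> (\<forall>x1 u1. norm (x1 - xbar) \<le> \<delta> \<longrightarrow> norm u1 \<le> \<theta> \<longrightarrow>
         ereal (a + v \<bullet> (x1 - x) - K' * norm (u1 - u)) \<le> \<phi> (x1, u1))" using a(1) by blast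
  qed
qed

text \<open>Testing the penalized inequality at (xbar, 0) bounds the value at a minimizer by
  \<open>\<phi>b\<close> plus a multiple of \<theta>; \<open>localize\<close> then bounds its
  distance to \<open>xbar\<close>.\<close>

lemma minimizers_near:
  assumes "\<rho> > 0"
  shows "\<exists>\<theta>>0. \<forall>v u x. norm v \<le> \<theta> \<longrightarrow> norm u \<le> \<theta> \<longrightarrow> x \<in> M_delta \<phi> xbar \<delta> v u \<longrightarrow>
    norm (x - xbar) < \<rho> \<and> \<phi> (x, u) < ereal (\<phi>b + \<rho>)"
proof -
  obtain \<theta>0 K' where pen: "\<theta>0 > 0" "K' \<ge> 0"
    "\<And>v u x. norm v \<le> \<theta>0 \<Longrightarrow> norm u \<le> \<theta>0 \<Longrightarrow> x \<in> M_delta \<phi> xbar \<delta> v u \<Longrightarrow>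
       \<exists>a. \<phi> (x, u) = ereal a \<and> (\<forall>x1 u1. norm (x1 - xbar) \<le> \<delta> \<longrightarrow> norm u1 \<le> \<theta>0 \<longrightarrow>
         ereal (a + v \<bullet> (x1 - x) - K' * norm (u1 - u)) \<le> \<phi> (x1, u1))"
    using exact_penalty by metis
  obtain \<theta>1 where \<theta>1: "\<theta>1 > 0" "\<And>x u. norm (x - xbar) \<le> \<delta> \<Longrightarrow> norm u \<le> \<theta>1 \<Longrightarrow> \<phi> (x, u) \<le> ereal (\<phi>b + \<theta>1) \<Longrightarrow> norm (x - xbar) < \<rho>"
    using localize[OF assms] by blast
  define m where "m = min \<theta>1 (\<rho> / 2)"
  have m: "m > 0" "m \<le> \<theta>1" "m \<le> \<rho> / 2" unfolding m_def using \<theta>1 assms by auto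
  have pos: "\<delta> + K' > 0" using \<delta> pen(2) by simp
  define \<theta> where "\<theta> = min (min \<theta>0 \<theta>1) (m / (\<delta> + K'))"
  have \<theta>: "\<theta> > 0" "\<theta> \<le> \<theta>0" "\<theta> \<le> \<theta>1" "\<theta> \<le> m / (\<delta> + K')" unfolding \<theta>_def using pen \<theta>1 m pos by auto
  then have \<theta>': "\<theta> * \<delta> + K' * \<theta> \<le> m" using pos by (simp add: field_simps)
  show ?thesis
  proof (intro exI[of _ \<theta>] conjI[OF \<theta>(1)] allI impI)
    fix v u x assume v: "norm v \<le> \<theta>" and u: "norm u \<le> \<theta>" and x: "x \<in> M_delta \<phi> xbar \<delta> v u"
    obtain a where a: "\<phi> (x, u) = ereal a" "\<And>x1 u1. norm (x1 - xbar) \<le> \<delta> \<Longrightarrow> norm u1 \<le> \<theta>0 \<Longrightarrow>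
         ereal (a + v \<bullet> (x1 - x) - K' * norm (u1 - u)) \<le> \<phi> (x1, u1)"
      using pen(3)[OF _ _ x] v u \<theta> by auto
    have xd: "norm (x - xbar) \<le> \<delta>" using x unfolding M_delta_iff[OF nm] by simp
    have "a + v \<bullet> (xbar - x) - K' * norm u \<le> \<phi>b" using a(2)[of xbar 0] \<phi>b \<delta> pen(1) by simp
    moreover have "v \<bullet> (x - xbar) \<le> \<theta> * \<delta>"
      using norm_cauchy_schwarz[of v "x - xbar"] mult_mono[OF v xd] \<theta> by simp
    moreover have "K' * norm u \<le> K' * \<theta>" using pen(2) u by (simp add: mult_left_mono)
    ultimately have "a \<le> \<phi>b + m" using \<theta>' by (simp add: inner_diff_right)
    then have "\<phi> (x, u) \<le> ereal (\<phi>b + \<theta>1)" "\<phi> (x, u) < ereal (\<phi>b + \<rho>)" using a(1) m assms by auto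
    then show "norm (x - xbar) < \<rho> \<and> \<phi> (x, u) < ereal (\<phi>b + \<rho>)"
      using \<theta>1(2)[OF xd order_trans[OF u \<theta>(3)]] by blast
  qed
qed

text \<open>The penalty K' |u1 - u| is not smooth at u, so it yields no multiplier directly. It is
  traded for k |u1 - u|^2 with large k: the new minimizers tend to (x, u), their u-subgradients stay
  within 2 K', and a cluster point is a multiplier.\<close>

lemma multiplier_exists:
  assumes "K' \<ge> 0" and x: "norm (x - xbar) < \<delta>" and u: "norm u < \<theta>" and a: "\<phi> (x, u) = ereal a"
    and pen: "\<And>x1 u1. norm (x1 - xbar) \<le> \<delta> \<Longrightarrow> norm u1 \<le> \<theta> \<Longrightarrow>
         ereal (a + v \<bullet> (x1 - x) - K' * norm (u1 - u)) \<le> \<phi> (x1, u1)"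
  shows "\<exists>y. (v, y) \<in> subdiff \<phi> (x, u)"
proof -
  have approx: "\<exists>z v' y. (v', y) \<in> regular_subdiff \<phi> z \<and> dist z (x, u) < e \<and> dist v' v < e \<and>
      norm y \<le> 2 * K' \<and> \<phi> z < ereal (a + e)" if "e > 0" for e
  proof -
    define e' where "e' = Min {e / 4, \<delta> - norm (x - xbar), \<theta> - norm u, e / (norm v + 1)}"
    have nv: "norm v + 1 > 0" by (simp add: add_nonneg_pos)
    have e': "e' > 0" "e' \<le> e / 4" "e' \<le> \<delta> - norm (x - xbar)" "e' \<le> \<theta> - norm u" "e' \<le> e / (norm v + 1)"
    proof -
      show "e' > 0" unfolding e'_def using \<open>e > 0\<close> x u nv by auto
      show "e' \<le> e / 4" "e' \<le> \<delta> - norm (x - xbar)" "e' \<le> \<theta> - norm u" "e' \<le> e / (norm v + 1)"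
        unfolding e'_def by (rule Min_le; simp)+
    qed
    \<comment> \<open>The linear term forces |q - u| \<le> K'/k < e'; the squared one then forces |p
      - x|^2 \<le> K'^2/k < e'^2. The added 1 keeps the quotient positive when K' = 0.\<close>
    define k where "k = 1 + (K' + 1) / e' + ((K' + 1) / e')\<^sup>2"
    have q0: "(K' + 1) / e' > 0" using assms(1) e' by simp
    have k: "k \<ge> 1" "(K' + 1) / e' < k" "((K' + 1) / e')\<^sup>2 < k"
      unfolding k_def using q0 zero_le_power2[of "(K' + 1) / e'"] by linarith+
    let ?F = "\<lambda>z. \<phi> z + ereal ((norm (fst z - x))\<^sup>2 + k * (norm (snd z - u))\<^sup>2 - v \<bullet> (fst z - x))"
    let ?B = "cball xbar \<delta> \<times> cball (0::'u) \<theta>"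
    have lscF: "lsc ?F" by (intro lsc_add_continuous lsc nm continuous_intros)
    have "compact ?B" by (intro compact_Times compact_cball)
    then have "\<exists>z\<in>?B. \<forall>z'\<in>?B. ?F z \<le> ?F z'"
      by (rule lsc_attains_min[OF lscF])
       (use \<delta> u norm_ge_zero[of u] in \<open>auto simp del: norm_ge_zero\<close>)
    then obtain p q where pqB: "(p, q) \<in> ?B" and minB: "\<forall>z'\<in>?B. ?F (p, q) \<le> ?F z'"
      by (metis prod.exhaust)
    have pq: "norm (p - xbar) \<le> \<delta>" "norm q \<le> \<theta>" using pqB by (auto simp: dist_norm norm_minus_commute)
    have min: "?F (p, q) \<le> ?F (x1, u1)" if "norm (x1 - xbar) \<le> \<delta>" "norm u1 \<le> \<theta>" for x1 u1
      using bspec[OF minB, of "(x1, u1)"] that by (simp add: dist_norm norm_minus_commute)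
    have "?F (p, q) \<le> ?F (x, u)" using min[of x u] x u by simp
    then obtain b where b: "\<phi> (p, q) = ereal b" "b + (norm (p - x))\<^sup>2 + k * (norm (q - u))\<^sup>2 - v \<bullet> (p - x) \<le> a"
      using a nm[of "(p, q)"] by (cases "\<phi> (p, q)") auto
    have "a + v \<bullet> (p - x) - K' * norm (q - u) \<le> b" using pen[OF pq] b by simp
    \<comment> \<open>\<open>pen\<close> bounds the drop of the tilted \<open>\<phi>\<close> by K'
      |q - u|, while minimality of (p, q) says that this drop pays for the quadratic terms.\<close>
    then have main: "(norm (p - x))\<^sup>2 + k * (norm (q - u))\<^sup>2 \<le> K' * norm (q - u)" using b(2) by linarith
    then have "k * (norm (q - u))\<^sup>2 \<le> K' * norm (q - u)"
      using zero_le_power2[of "norm (p - x)"] by linarith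
    then have "norm (q - u) * (k * norm (q - u)) \<le> norm (q - u) * K'"
      by (simp add: power2_eq_square algebra_simps)
    then have kq: "k * norm (q - u) \<le> K'"
      using assms(1) by (cases "q = u") (auto simp: mult_le_cancel_left)
    have qu: "norm (q - u) < e'"
    proof -
      have "k * norm (q - u) < k * e'" using kq k(2) e'(1) by (simp add: field_simps)
      then show ?thesis using k(1) by simp
    qed
    have px: "norm (p - x) < e'"
    proof (rule power2_less_imp_less)
      have "k * (norm (q - u))\<^sup>2 \<ge> 0" using k(1) by simp
      then have "(norm (p - x))\<^sup>2 \<le> K' * norm (q - u)" using main by linarith
      then have "k * (norm (p - x))\<^sup>2 \<le> k * (K' * norm (q - u))"
        using k(1) by (intro mult_left_mono) auto
      also have "\<dots> = K' * (k * norm (q - u))" by simp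
      also have "\<dots> \<le> (K' + 1) * (K' + 1)" using kq assms(1) k(1) by (intro mult_mono) auto
      also have "\<dots> < k * e'\<^sup>2" using k(3) e'(1) by (simp add: field_simps power2_eq_square)
      finally show "(norm (p - x))\<^sup>2 < e'\<^sup>2" using k(1) by simp
    qed (use e' in simp)
    have pd: "norm (p - xbar) < \<delta>" using norm_triangle_ineq[of "p - x" "x - xbar"] px e'(3) by simp
    have qd: "norm q < \<theta>" using norm_triangle_ineq[of "q - u" "u"] qu e'(4) by simp
    have "\<forall>\<^sub>F z' in nhds (p, q). z' \<in> ball xbar \<delta> \<times> ball 0 \<theta>"
      using pd qd by (intro eventually_nhds_in_open open_Times) (auto simp: dist_norm norm_minus_commute)
    then have "\<forall>\<^sub>F z' in nhds (p, q). ereal (b + (v - 2 *\<^sub>R (p - x), - (2 * k) *\<^sub>R (q - u)) \<bullet> (z' - (p, q))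
            - k * (norm (z' - (p, q)))\<^sup>2) \<le> \<phi> z'"
    proof eventually_elim
      case (elim z')
      obtain x1 u1 where z': "z' = (x1, u1)" by (cases z')
      have "?F (p, q) \<le> ?F (x1, u1)"
        using elim by (intro min) (auto simp: z' dist_norm norm_minus_commute)
      then have 1: "ereal (b + v \<bullet> (x1 - p) - ((norm (x1 - x))\<^sup>2 - (norm (p - x))\<^sup>2)
           - k * ((norm (u1 - u))\<^sup>2 - (norm (q - u))\<^sup>2)) \<le> \<phi> (x1, u1)"
        using b by (cases "\<phi> (x1, u1)") (auto simp: inner_diff_right algebra_simps)
      have 2: "(norm (x1 - x))\<^sup>2 - (norm (p - x))\<^sup>2 = 2 * ((p - x) \<bullet> (x1 - p)) + (norm (x1 - p))\<^sup>2"
        unfolding power2_norm_eq_inner by (simp add: inner_diff_left inner_diff_right inner_commute)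
      have 3: "(norm (u1 - u))\<^sup>2 - (norm (q - u))\<^sup>2 = 2 * ((q - u) \<bullet> (u1 - q)) + (norm (u1 - q))\<^sup>2"
        unfolding power2_norm_eq_inner by (simp add: inner_diff_left inner_diff_right inner_commute)
      have "(norm (z' - (p, q)))\<^sup>2 = (norm (x1 - p))\<^sup>2 + (norm (u1 - q))\<^sup>2"
        by (simp add: z' norm_Pair)
      then have "(norm (x1 - p))\<^sup>2 + k * (norm (u1 - q))\<^sup>2 \<le> k * (norm (z' - (p, q)))\<^sup>2"
        using k(1) mult_right_mono[OF k(1), of "(norm (x1 - p))\<^sup>2"] by (simp add: algebra_simps)
      then have "b + (v - 2 *\<^sub>R (p - x), - (2 * k) *\<^sub>R (q - u)) \<bullet> (z' - (p, q)) - k * (norm (z' - (p, q)))\<^sup>2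
         \<le> b + v \<bullet> (x1 - p) - ((norm (x1 - x))\<^sup>2 - (norm (p - x))\<^sup>2)
           - k * ((norm (u1 - u))\<^sup>2 - (norm (q - u))\<^sup>2)"
        unfolding 2 3 by (simp add: z' inner_diff_left algebra_simps)
      then show ?case using 1 unfolding z' by (meson ereal_less_eq(3) order_trans)
    qed
    then have "(v - 2 *\<^sub>R (p - x), - (2 * k) *\<^sub>R (q - u)) \<in> regular_subdiff \<phi> (p, q)"
      by (rule regular_subdiff_quadraticI[of \<phi> "(p, q)" b, OF b(1)])
    moreover have "dist (p, q) (x, u) < e"
      using px qu e'(1,2) norm_Pair_le[of "p - x" "q - u"] by (simp add: dist_norm)
    moreover have "dist (v - 2 *\<^sub>R (p - x)) v < e" using px e'(1,2) by (simp add: dist_norm)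
    moreover have "norm (- (2 * k) *\<^sub>R (q - u)) \<le> 2 * K'" using kq k(1) by simp
    moreover have "\<phi> (p, q) < ereal (a + e)"
    proof -
      have "v \<bullet> (p - x) \<le> norm v * norm (p - x)" by (rule norm_cauchy_schwarz)
      also have "\<dots> \<le> norm v * e'" using px by (intro mult_left_mono) auto
      also have "\<dots> < (norm v + 1) * e'" using e'(1) by simp
      also have "\<dots> \<le> e" using e'(5) nv by (simp add: field_simps)
      finally have "v \<bullet> (p - x) < e" .
      moreover have "k * (norm (q - u))\<^sup>2 \<ge> 0" using k(1) by simp
      ultimately have "b < a + e" using b(2) zero_le_power2[of "norm (p - x)"] by linarith
      then show ?thesis using b(1) by simp
    qed
    ultimately show ?thesis by blast
  qed
  have "\<exists>z v' y. (v', y) \<in> regular_subdiff \<phi> z \<and> dist z (x, u) < inverse (Suc k) \<and> dist v' v < inverse (Suc k) \<and>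
      norm y \<le> 2 * K' \<and> \<phi> z < ereal (a + inverse (Suc k))" for k :: nat
    by (rule approx) simp
  then obtain zs vs ys where seq: "\<And>k. (vs k, ys k) \<in> regular_subdiff \<phi> (zs k)"
    "\<And>k::nat. dist (zs k) (x, u) < inverse (Suc k)" "\<And>k. dist (vs k) v < inverse (Suc k)"
    "\<And>k. norm (ys k) \<le> 2 * K'" "\<And>k. \<phi> (zs k) < ereal (a + inverse (Suc k))" by metis
  have "\<forall>k. ys k \<in> cball 0 (2 * K')" using seq(4) by simp
  then obtain y r where r: "strict_mono (r :: nat \<Rightarrow> nat)" "(ys \<circ> r) \<longlonglongrightarrow> y"
    using compact_cball[unfolded compact_def, rule_format, of ys 0 "2 * K'"] by blast
  have "(v, y) \<in> subdiff \<phi> (x, u)"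
    unfolding subdiff_iff[OF lsc, of "(x, u)" a, OF a]
  proof (intro allI impI)
    fix e :: real assume "e > 0"
    then have "\<forall>\<^sub>F k in sequentially. dist ((ys \<circ> r) k) y < e / 2" using r(2) half_gt_zero tendstoD by blast
    moreover have "\<forall>\<^sub>F k in sequentially. inverse (real (Suc k)) < e / 2"
      using LIMSEQ_inverse_real_of_nat by (rule order_tendstoD) (use \<open>e > 0\<close> in simp)
    ultimately have "\<forall>\<^sub>F k in sequentially. dist ((ys \<circ> r) k) y < e / 2 \<and> inverse (real (Suc k)) < e / 2"
      by (rule eventually_conj)
    then obtain k where k: "dist (ys (r k)) y < e / 2" "inverse (real (Suc k)) < e / 2"
      using eventually_sequentially by auto
    have "inverse (real (Suc (r k))) \<le> inverse (real (Suc k))"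
      using seq_suble[OF r(1), of k] by (intro le_imp_inverse_le) auto
    then have i: "inverse (real (Suc (r k))) < e / 2" using k(2) by linarith
    have "dist (vs (r k), ys (r k)) (v, y) \<le> dist (vs (r k)) v + dist (ys (r k)) y"
      using norm_Pair_le[of "vs (r k) - v" "ys (r k) - y"] by (simp add: dist_norm)
    then have "dist (vs (r k), ys (r k)) (v, y) < e" using seq(3)[of "r k"] i k(1) by linarith
    moreover have "dist (zs (r k)) (x, u) < e" using seq(2)[of "r k"] i \<open>e > 0\<close> by linarith
    moreover have "\<phi> (zs (r k)) < ereal (a + e)"
    proof -
      have "ereal (a + inverse (Suc (r k))) \<le> ereal (a + e)" using i \<open>e > 0\<close> by simp
      then show ?thesis using seq(5)[of "r k"] by (rule order_less_le_trans[rotated])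
    qed
    ultimately show "\<exists>z' w'. w' \<in> regular_subdiff \<phi> z' \<and> dist z' (x, u) < e \<and> dist w' (v, y) < e \<and> \<phi> z' < ereal (a + e)"
      using seq(1) by blast
  qed
  then show ?thesis by blast
qed

text \<open>Open boxes with common constants, so that all the properties survive shrinking
  together.\<close>

definition stable_box :: "real \<Rightarrow> real \<Rightarrow> bool" where
  "stable_box \<theta> K' \<longleftrightarrow> \<theta> > 0 \<and> K' \<ge> 0 \<and>
    (\<forall>v u. norm v < \<theta> \<longrightarrow> norm u < \<theta> \<longrightarrow> M_delta \<phi> xbar \<delta> v u \<noteq> {}) \<and>
    (\<forall>v u x. norm v < \<theta> \<longrightarrow> norm u < \<theta> \<longrightarrow> x \<in> M_delta \<phi> xbar \<delta> v u \<longrightarrow>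
       (\<exists>y. (v, y) \<in> subdiff \<phi> (x, u)) \<and>
       (\<exists>a. \<phi> (x, u) = ereal a \<and> (\<forall>x1 u1. norm (x1 - xbar) \<le> \<delta> \<longrightarrow> norm u1 < \<theta> \<longrightarrow>
         ereal (a + v \<bullet> (x1 - x) - K' * norm (u1 - u)) \<le> \<phi> (x1, u1)))) \<and>
    (\<forall>v u v' u'. norm v < \<theta> \<longrightarrow> norm u < \<theta> \<longrightarrow> norm v' < \<theta> \<longrightarrow> norm u' < \<theta> \<longrightarrow>
       \<bar>real_of_ereal (m_delta \<phi> xbar \<delta> v u) - real_of_ereal (m_delta \<phi> xbar \<delta> v' u')\<bar>
         \<le> \<delta> * norm (v - v') + K' * norm (u - u'))"

lemma stable_box_mono:
  assumes "stable_box \<theta> K'" "0 < \<theta>'" "\<theta>' \<le> \<theta>"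
  shows "stable_box \<theta>' K'"
  using assms unfolding stable_box_def by (meson order_less_le_trans)

text \<open>For the Lipschitz bound on \<open>m_delta\<close>, the penalized inequality at a
  minimizer for (v, u) is tested at a minimizer for (v', u'). The slope in v is the distance of the
  latter to \<open>xbar\<close>, hence at most \<delta>; exchanging the roles gives the absolute
  value.\<close>

lemma ex_stable_box: "\<exists>\<theta> K'. stable_box \<theta> K'"
proof -
  obtain \<theta> K' where pen: "\<theta> > 0" "K' \<ge> 0"
    "\<And>v u. norm v \<le> \<theta> \<Longrightarrow> norm u \<le> \<theta> \<Longrightarrow> M_delta \<phi> xbar \<delta> v u \<noteq> {}"
    "\<And>v u x. norm v \<le> \<theta> \<Longrightarrow> norm u \<le> \<theta> \<Longrightarrow> x \<in> M_delta \<phi> xbar \<delta> v u \<Longrightarrow>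
       \<exists>a. \<phi> (x, u) = ereal a \<and> (\<forall>x1 u1. norm (x1 - xbar) \<le> \<delta> \<longrightarrow> norm u1 \<le> \<theta> \<longrightarrow>
         ereal (a + v \<bullet> (x1 - x) - K' * norm (u1 - u)) \<le> \<phi> (x1, u1))"
    using exact_penalty by metis
  have near: "norm (x - xbar) < \<delta>" if "x \<in> M_delta \<phi> xbar \<delta> v u" for x v u
    using that unfolding M_delta_iff[OF nm] by simp
  have half: "real_of_ereal (m_delta \<phi> xbar \<delta> v u) - real_of_ereal (m_delta \<phi> xbar \<delta> v' u')
         \<le> \<delta> * norm (v - v') + K' * norm (u - u')"
    if vu: "norm v < \<theta>" "norm u < \<theta>" "norm v' < \<theta>" "norm u' < \<theta>" for v u v' u'
  proof -
    obtain x x' where x: "x \<in> M_delta \<phi> xbar \<delta> v u" and x': "x' \<in> M_delta \<phi> xbar \<delta> v' u'"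
      using pen(3) vu by (meson ex_in_conv less_imp_le)
    obtain a where a: "\<phi> (x, u) = ereal a" "\<And>x1 u1. norm (x1 - xbar) \<le> \<delta> \<Longrightarrow> norm u1 \<le> \<theta> \<Longrightarrow>
         ereal (a + v \<bullet> (x1 - x) - K' * norm (u1 - u)) \<le> \<phi> (x1, u1)"
      using pen(4)[OF _ _ x] vu by auto
    obtain a' where a': "\<phi> (x', u') = ereal a'" using pen(4)[OF _ _ x'] vu by auto
    have "a + v \<bullet> (x' - x) - K' * norm (u' - u) \<le> a'"
      using a(2)[of x' u'] near[OF x'] vu a' by simp
    then have "(a - v \<bullet> (x - xbar)) - (a' - v' \<bullet> (x' - xbar)) \<le> (v' - v) \<bullet> (x' - xbar) + K' * norm (u - u')"
      by (simp add: inner_diff_left inner_diff_right norm_minus_commute)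
    also have "(v' - v) \<bullet> (x' - xbar) \<le> norm (v' - v) * norm (x' - xbar)" by (rule norm_cauchy_schwarz)
    also have "\<dots> \<le> norm (v' - v) * \<delta>" using near[OF x'] by (intro mult_left_mono) auto
    finally show ?thesis
      unfolding m_delta_eq[OF x a(1)] m_delta_eq[OF x' a'] by (simp add: norm_minus_commute mult.commute)
  qed
  show ?thesis
    unfolding stable_box_def
  proof (rule exI[of _ \<theta>], rule exI[of _ K'], intro conjI allI impI)
    show "\<theta> > 0" "K' \<ge> 0" by (fact pen)+
  next
    fix v u assume "norm (v::'x) < \<theta>" "norm (u::'u) < \<theta>"
    then show "M_delta \<phi> xbar \<delta> v u \<noteq> {}" using pen(3) by simp
  next
    fix v u x assume vu: "norm v < \<theta>" "norm u < \<theta>" and x: "x \<in> M_delta \<phi> xbar \<delta> v u"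
    then obtain a where a: "\<phi> (x, u) = ereal a" "\<And>x1 u1. norm (x1 - xbar) \<le> \<delta> \<Longrightarrow> norm u1 \<le> \<theta> \<Longrightarrow>
         ereal (a + v \<bullet> (x1 - x) - K' * norm (u1 - u)) \<le> \<phi> (x1, u1)"
      using pen(4)[OF _ _ x] by auto
    show "\<exists>y. (v, y) \<in> subdiff \<phi> (x, u)"
      by (rule multiplier_exists[OF pen(2) near[OF x] vu(2) a])
    show "\<exists>a. \<phi> (x, u) = ereal a \<and> (\<forall>x1 u1. norm (x1 - xbar) \<le> \<delta> \<longrightarrow> norm u1 < \<theta> \<longrightarrow>
         ereal (a + v \<bullet> (x1 - x) - K' * norm (u1 - u)) \<le> \<phi> (x1, u1))" using a by auto
  next
    fix v u v' u'
    assume "norm (v::'x) < \<theta>" "norm (u::'u) < \<theta>" "norm (v'::'x) < \<theta>" "norm (u'::'u) < \<theta>"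
    then show "\<bar>real_of_ereal (m_delta \<phi> xbar \<delta> v u) - real_of_ereal (m_delta \<phi> xbar \<delta> v' u')\<bar>
         \<le> \<delta> * norm (v - v') + K' * norm (u - u')"
      using half[of v u v' u'] half[of v' u' v u] by (simp add: abs_le_iff norm_minus_commute)
  qed
qed

lemma minimizer_multiplier:
  assumes "stable_box \<theta> K'" "norm v < \<theta>" "norm u < \<theta>" "x \<in> M_delta \<phi> xbar \<delta> v u"
  shows "\<exists>y. (v, y) \<in> subdiff \<phi> (x, u)"
  using assms unfolding stable_box_def by metis

lemma minimizer_penalty:
  assumes "stable_box \<theta> K'" "norm v < \<theta>" "norm u < \<theta>" "x \<in> M_delta \<phi> xbar \<delta> v u" "\<phi> (x, u) = ereal a"
    "norm (x1 - xbar) \<le> \<delta>" "norm u1 < \<theta>"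
  shows "ereal (a + v \<bullet> (x1 - x) - K' * norm (u1 - u)) \<le> \<phi> (x1, u1)"
proof -
  have "\<exists>a. \<phi> (x, u) = ereal a \<and> (\<forall>x1 u1. norm (x1 - xbar) \<le> \<delta> \<longrightarrow> norm u1 < \<theta> \<longrightarrow>
         ereal (a + v \<bullet> (x1 - x) - K' * norm (u1 - u)) \<le> \<phi> (x1, u1))"
    using assms(1-4) unfolding stable_box_def by metis
  then show ?thesis using assms(5-7) by auto
qed

lemma m_delta_lipschitz:
  assumes "stable_box \<theta> K'"
  shows "(\<delta> + K')-lipschitz_on (ball 0 \<theta> \<times> ball 0 \<theta>) (\<lambda>(v, u). real_of_ereal (m_delta \<phi> xbar \<delta> v u))"
proof (rule lipschitz_onI)
  fix p p' :: "'x \<times> 'u" assume p: "p \<in> ball 0 \<theta> \<times> ball 0 \<theta>" "p' \<in> ball 0 \<theta> \<times> ball 0 \<theta>"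
  obtain v u v' u' where e: "p = (v, u)" "p' = (v', u')" by (metis prod.exhaust)
  have "\<bar>real_of_ereal (m_delta \<phi> xbar \<delta> v u) - real_of_ereal (m_delta \<phi> xbar \<delta> v' u')\<bar>
         \<le> \<delta> * norm (v - v') + K' * norm (u - u')"
    using assms p unfolding stable_box_def e by auto
  also have "\<dots> \<le> \<delta> * norm (v - v', u - u') + K' * norm (v - v', u - u')"
    using assms \<delta> unfolding stable_box_def by (intro add_mono mult_left_mono norm_fst_le norm_snd_le) auto
  finally show "dist (case p of (v, u) \<Rightarrow> real_of_ereal (m_delta \<phi> xbar \<delta> v u))
      (case p' of (v, u) \<Rightarrow> real_of_ereal (m_delta \<phi> xbar \<delta> v u)) \<le> (\<delta> + K') * dist p p'"
    unfolding e by (simp add: dist_norm distrib_right)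
qed (use assms \<delta> in \<open>auto simp: stable_box_def\<close>)

lemma M_delta_reference: "M_delta \<phi> xbar \<delta> 0 0 = {xbar}"
proof -
  have "ereal \<phi>b \<le> \<phi> (x, 0)" if "norm (x - xbar) < \<delta>" for x
    using strict[of x] that \<phi>b by (cases "x = xbar") auto
  then have "xbar \<in> M_delta \<phi> xbar \<delta> 0 0"
    unfolding M_delta_iff[OF nm] using \<phi>b \<delta> by auto
  moreover have "x = xbar" if x: "x \<in> M_delta \<phi> xbar \<delta> 0 0" for x
  proof (rule ccontr)
    assume "x \<noteq> xbar"
    obtain a where "norm (x - xbar) < \<delta>" "\<phi> (x, 0) = ereal a" "ereal (a + 0 \<bullet> (xbar - x)) \<le> \<phi> (xbar, 0)"
      using x \<delta> unfolding M_delta_iff[OF nm] by force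
    then show False using strict[of x] \<open>x \<noteq> xbar\<close> \<phi>b by simp
  qed
  ultimately show ?thesis by blast
qed

end

section \<open>Uniformity over the multipliers\<close>

text \<open>One natural number thus encodes both a small radius and a large constant, which suits
  the single index in \<open>uniformize\<close>.\<close>

lemma ex_nat_large:
  fixes c R :: real
  assumes "c > 0"
  obtains n :: nat where "inverse (real (Suc n)) < c" "R \<le> real n"
proof -
  obtain n :: nat where n: "max R (inverse c) < real n" using reals_Archimedean2 by blast
  have "inverse (real (Suc n)) < inverse (inverse c)"
    using n assms by (intro less_imp_inverse_less) auto
  then show ?thesis using n assms by (intro that[of n]) auto
qed

text \<open>Were the multipliers unbounded, dividing by their norms would give, in the limit, a
  horizon subgradient (0, y0) with |y0| = 1. Its first component vanishes because both v and the
  scaling factor tend to 0.\<close>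

lemma multiplier_bound:
  fixes \<phi> :: "'x::euclidean_space \<times> 'u::euclidean_space \<Rightarrow> ereal"
  assumes lsc: "lsc \<phi>" and \<phi>b: "\<phi> (xbar, 0) = ereal \<phi>b"
    and bcq: "\<And>y. (0, y) \<in> horizon_subdiff \<phi> (xbar, 0) \<Longrightarrow> y = 0"
  obtains \<epsilon> K where "\<epsilon> > 0" "\<And>x u v y. norm (x - xbar) < \<epsilon> \<Longrightarrow> norm u < \<epsilon> \<Longrightarrow> norm v < \<epsilon> \<Longrightarrow>
       \<phi> (x, u) < ereal (\<phi>b + \<epsilon>) \<Longrightarrow> (v, y) \<in> regular_subdiff \<phi> (x, u) \<Longrightarrow> norm y \<le> K"
proof (rule ccontr)
  assume "\<not> thesis"
  then have neg: "\<And>\<epsilon> K. \<epsilon> > 0 \<Longrightarrow> \<exists>x u v y. norm (x - xbar) < \<epsilon> \<and> norm u < \<epsilon> \<and> norm v < \<epsilon> \<and>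
       \<phi> (x, u) < ereal (\<phi>b + \<epsilon>) \<and> (v, y) \<in> regular_subdiff \<phi> (x, u) \<and> norm y > K"
    using that by (meson not_le)
  have "\<exists>x u v y. norm (x - xbar) < inverse (Suc k) \<and> norm u < inverse (Suc k) \<and> norm v < inverse (Suc k) \<and>
       \<phi> (x, u) < ereal (\<phi>b + inverse (Suc k)) \<and> (v, y) \<in> regular_subdiff \<phi> (x, u) \<and> norm y > real k" for k :: nat
    by (rule neg) simp
  then obtain x u v y where seq: "\<And>k::nat. norm (x k - xbar) < inverse (Suc k)" "\<And>k. norm (u k) < inverse (Suc k)"
    "\<And>k. norm (v k) < inverse (Suc k)" "\<And>k. \<phi> (x k, u k) < ereal (\<phi>b + inverse (Suc k))"
    "\<And>k. (v k, y k) \<in> regular_subdiff \<phi> (x k, u k)" "\<And>k. norm (y k) > real k"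
    by metis
  have x: "x \<longlonglongrightarrow> xbar"
    unfolding LIM_zero_iff[symmetric, of x]
    by (rule Lim_null_comparison[OF _ LIMSEQ_inverse_real_of_nat]) (use seq(1) in \<open>auto intro!: always_eventually less_imp_le\<close>)
  have u: "u \<longlonglongrightarrow> 0"
    by (rule Lim_null_comparison[OF _ LIMSEQ_inverse_real_of_nat]) (use seq(2) in \<open>auto intro!: always_eventually less_imp_le\<close>)
  have v: "v \<longlonglongrightarrow> 0"
    by (rule Lim_null_comparison[OF _ LIMSEQ_inverse_real_of_nat]) (use seq(3) in \<open>auto intro!: always_eventually less_imp_le\<close>)
  have z: "(\<lambda>k. (x k, u k)) \<longlonglongrightarrow> (xbar, 0)" by (intro tendsto_Pair x u)
  have "(\<lambda>k. \<phi>b + inverse (real (Suc k))) \<longlonglongrightarrow> \<phi>b"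
    using tendsto_add[OF tendsto_const LIMSEQ_inverse_real_of_nat, of \<phi>b] by simp
  then have \<phi>: "(\<lambda>k. \<phi> (x k, u k)) \<longlonglongrightarrow> \<phi> (xbar, 0)"
    by (rule lsc_attentive[OF lsc z \<phi>b]) (use seq(4) in \<open>auto intro: less_imp_le\<close>)
  have ypos: "norm (y k) > 0" for k using seq(6)[of k] by (metis of_nat_0_le_iff order_le_less_trans)
  define t where "t k = inverse (norm (y k))" for k
  have tpos: "t k > 0" for k using ypos by (simp add: t_def)
  have "filterlim (\<lambda>k. norm (y k)) at_top sequentially"
    by (rule filterlim_at_top_mono[OF filterlim_real_sequentially]) (use seq(6) in \<open>auto intro!: always_eventually less_imp_le\<close>)
  then have t: "t \<longlonglongrightarrow> 0" unfolding t_def by (rule tendsto_inverse_0_at_top)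
  have ny: "norm (t k *\<^sub>R y k) = 1" for k using ypos[of k] by (simp add: t_def)
  then have "\<forall>k. t k *\<^sub>R y k \<in> cball 0 1" by simp
  then obtain y0 r where r: "strict_mono (r :: nat \<Rightarrow> nat)" "((\<lambda>k. t k *\<^sub>R y k) \<circ> r) \<longlonglongrightarrow> y0"
    using compact_cball[unfolded compact_def, rule_format, of "\<lambda>k. t k *\<^sub>R y k" 0 1] by blast
  have "(\<lambda>k. norm (((\<lambda>k. t k *\<^sub>R y k) \<circ> r) k)) \<longlonglongrightarrow> norm y0" by (intro tendsto_intros r)
  then have "norm y0 = 1" using ny by (simp add: o_def LIMSEQ_const_iff)
  moreover have "(0, y0) \<in> horizon_subdiff \<phi> (xbar, 0)"
  proof -
    define zs where "zs k = (x (r k), u (r k))" for k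
    define ws where "ws k = (v (r k), y (r k))" for k
    define ts where "ts k = t (r k)" for k
    have "zs \<longlonglongrightarrow> (xbar, 0)" "(\<lambda>k. \<phi> (zs k)) \<longlonglongrightarrow> \<phi> (xbar, 0)" and ts: "ts \<longlonglongrightarrow> 0"
      using LIMSEQ_subseq_LIMSEQ[OF z r(1)] LIMSEQ_subseq_LIMSEQ[OF \<phi> r(1)] LIMSEQ_subseq_LIMSEQ[OF t r(1)]
      by (simp_all add: o_def zs_def[abs_def] ts_def[abs_def])
    moreover have "\<forall>k. ws k \<in> regular_subdiff \<phi> (zs k)" "\<forall>k. 0 < ts k"
      using seq(5) tpos by (auto simp: zs_def ws_def ts_def)
    moreover have "(\<lambda>k. ts k *\<^sub>R (v \<circ> r) k) \<longlonglongrightarrow> 0 *\<^sub>R 0"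
      by (intro tendsto_scaleR LIMSEQ_subseq_LIMSEQ ts v r)
    then have "(\<lambda>k. (ts k *\<^sub>R v (r k), ts k *\<^sub>R y (r k))) \<longlonglongrightarrow> (0, y0)"
      using r(2) by (intro tendsto_Pair) (simp_all add: o_def ts_def)
    then have "(\<lambda>k. ts k *\<^sub>R ws k) \<longlonglongrightarrow> (0, y0)" by (simp add: ws_def)
    moreover have "\<bar>\<phi> (xbar, 0)\<bar> \<noteq> \<infinity>" using \<phi>b by simp
    ultimately show ?thesis unfolding horizon_subdiff_def by blast
  qed
  then have "y0 = 0" by (rule bcq)
  ultimately show False by simp
qed

text \<open>A regular subgradient within \<epsilon>/2 inherits the bound K; hence the halved radii
  and the extra \<epsilon>/2.\<close>

lemma subdiff_multiplier_bound:
  fixes \<phi> :: "'x::euclidean_space \<times> 'u::euclidean_space \<Rightarrow> ereal"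
  assumes lsc: "lsc \<phi>" and \<epsilon>: "\<epsilon> > 0"
    and bound: "\<And>x u v y. norm (x - xbar) < \<epsilon> \<Longrightarrow> norm u < \<epsilon> \<Longrightarrow> norm v < \<epsilon> \<Longrightarrow>
       \<phi> (x, u) < ereal (\<phi>b + \<epsilon>) \<Longrightarrow> (v, y) \<in> regular_subdiff \<phi> (x, u) \<Longrightarrow> norm y \<le> K"
    and near: "norm (x - xbar) < \<epsilon> / 2" "norm u < \<epsilon> / 2" "norm v < \<epsilon> / 2" "\<phi> (x, u) < ereal (\<phi>b + \<epsilon> / 2)"
    and sub: "(v, y) \<in> subdiff \<phi> (x, u)"
  shows "norm y \<le> K + \<epsilon> / 2"
proof -
  obtain a where a: "\<phi> (x, u) = ereal a" using subdiff_finite[OF sub] by blast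
  have "\<epsilon> / 2 > 0" using \<epsilon> by simp
  then obtain z' w' where 1: "w' \<in> regular_subdiff \<phi> z'" "dist z' (x, u) < \<epsilon> / 2" "dist w' (v, y) < \<epsilon> / 2"
      "\<phi> z' < ereal (a + \<epsilon> / 2)"
    using sub unfolding subdiff_iff[OF lsc, of "(x, u)" a, OF a] by blast
  obtain x' u' v' y' where z': "z' = (x', u')" "w' = (v', y')" by (metis prod.exhaust)
  have d: "norm (x' - x) < \<epsilon> / 2" "norm (u' - u) < \<epsilon> / 2" "norm (v' - v) < \<epsilon> / 2" "norm (y' - y) < \<epsilon> / 2"
    using 1(2,3) norm_fst_le[of "x' - x" "u' - u"] norm_snd_le[of "u' - u" "x' - x"]
      norm_fst_le[of "v' - v" "y' - y"] norm_snd_le[of "y' - y" "v' - v"]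
    by (auto simp: z' dist_norm)
  have "norm y' \<le> K"
  proof (rule bound)
    show "norm (x' - xbar) < \<epsilon>" using d(1) near(1) norm_triangle_ineq[of "x' - x" "x - xbar"] by simp
    show "norm u' < \<epsilon>" using d(2) near(2) norm_triangle_ineq[of "u' - u" "u"] by simp
    show "norm v' < \<epsilon>" using d(3) near(3) norm_triangle_ineq[of "v' - v" "v"] by simp
    have "ereal (a + \<epsilon> / 2) < ereal (\<phi>b + \<epsilon>)" using near(4) a by simp
    then show "\<phi> (x', u') < ereal (\<phi>b + \<epsilon>)" using 1(4) unfolding z' by (rule order_less_trans[rotated])
    show "(v', y') \<in> regular_subdiff \<phi> (x', u')" using 1(1) by (simp add: z')
  qed
  then show ?thesis using d(4) norm_triangle_ineq2[of y y'] by (simp add: norm_minus_commute)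
qed

text \<open>The multiplier y is left free: statements quantified over \<open>near_ref\<close> are
  thereby uniform in the multiplier.\<close>

definition near_ref ::
    "('x::euclidean_space \<times> 'u::euclidean_space \<Rightarrow> ereal) \<Rightarrow> 'x \<Rightarrow> real \<Rightarrow> 'x \<Rightarrow> 'u \<Rightarrow> 'x \<Rightarrow> 'u \<Rightarrow> bool" where
  "near_ref \<phi> xbar \<rho> x u v y \<longleftrightarrow> (v, y) \<in> subdiff \<phi> (x, u) \<and> norm (x - xbar) < \<rho> \<and> norm u < \<rho> \<and>
     norm v < \<rho> \<and> \<phi> (x, u) < \<phi> (xbar, 0) + ereal \<rho>"

lemma near_ref_mono: "near_ref \<phi> xbar \<rho> x u v y \<Longrightarrow> \<rho> \<le> \<rho>' \<Longrightarrow> near_ref \<phi> xbar \<rho>' x u v y"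
  unfolding near_ref_def by (meson add_left_mono ereal_less_eq(3) order_less_le_trans)

text \<open>The multipliers near the reference point are bounded, so a property holding locally around
  each \<open>y \<in> Y_bar\<close> holds uniformly by compactness. A single index \<open>n\<close> measures the size of the
  neighborhood and the constants in \<open>G\<close> at once.\<close>

lemma uniformize:
  fixes \<phi> :: "'x::euclidean_space \<times> 'u::euclidean_space \<Rightarrow> ereal"
    and G :: "nat \<Rightarrow> 'x \<Rightarrow> 'u \<Rightarrow> 'x \<Rightarrow> 'u \<Rightarrow> bool"
  assumes lsc: "lsc \<phi>" and \<phi>b: "\<phi> (xbar, 0) = ereal \<phi>b"
    and bcq: "\<And>y. (0, y) \<in> horizon_subdiff \<phi> (xbar, 0) \<Longrightarrow> y = 0"
    and mono: "\<And>n n' x u v y. n \<le> n' \<Longrightarrow> G n x u v y \<Longrightarrow> G n' x u v y"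
    and pt: "\<And>y. y \<in> Y_bar \<phi> xbar \<Longrightarrow> \<exists>n. \<forall>x u v y'. near_ref \<phi> xbar (inverse (Suc n)) x u v y' \<longrightarrow>
        norm (y' - y) < inverse (Suc n) \<longrightarrow> G n x u v y'"
  shows "\<exists>n. \<forall>x u v y. near_ref \<phi> xbar (inverse (Suc n)) x u v y \<longrightarrow> G n x u v y"
proof (rule ccontr)
  assume neg: "\<not> ?thesis"
  obtain \<epsilon> K where \<epsilon>: "\<epsilon> > 0" and bound: "\<And>x u v y. norm (x - xbar) < \<epsilon> \<Longrightarrow> norm u < \<epsilon> \<Longrightarrow> norm v < \<epsilon> \<Longrightarrow>
       \<phi> (x, u) < ereal (\<phi>b + \<epsilon>) \<Longrightarrow> (v, y) \<in> regular_subdiff \<phi> (x, u) \<Longrightarrow> norm y \<le> K"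
    using multiplier_bound[OF lsc \<phi>b bcq] by blast
  have "\<epsilon> / 2 > 0" using \<epsilon> by simp
  \<comment> \<open>Starting the counterexamples at index k0 puts all of them within the radius
    where multipliers are bounded.\<close>
  then obtain k0 :: nat where k0: "inverse (real (Suc k0)) < \<epsilon> / 2" using ex_nat_large by blast
  have "\<exists>x u v y. near_ref \<phi> xbar (inverse (Suc (k + k0))) x u v y \<and> \<not> G (k + k0) x u v y" for k
    using neg by blast
  then obtain x u v y where seq: "\<And>k. near_ref \<phi> xbar (inverse (Suc (k + k0))) (x k) (u k) (v k) (y k)"
    "\<And>k. \<not> G (k + k0) (x k) (u k) (v k) (y k)" by metis
  have i: "inverse (real (Suc (k + k0))) \<le> inverse (real (Suc k0))" for k by (intro le_imp_inverse_le) auto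
  have "norm (y k) \<le> K + \<epsilon> / 2" for k
  proof -
    have "inverse (real (Suc (k + k0))) < \<epsilon> / 2" using i[of k] k0 by linarith
    then have "near_ref \<phi> xbar (\<epsilon> / 2) (x k) (u k) (v k) (y k)"
      using near_ref_mono[OF seq(1)] less_imp_le by blast
    then show ?thesis unfolding near_ref_def \<phi>b
      by (intro subdiff_multiplier_bound[OF lsc \<epsilon> bound, where x="x k" and u="u k" and v="v k"]) auto
  qed
  then have "\<forall>k. y k \<in> cball 0 (K + \<epsilon> / 2)" by simp
  then obtain y0 r where r: "strict_mono (r :: nat \<Rightarrow> nat)" "(y \<circ> r) \<longlonglongrightarrow> y0"
    using compact_cball[unfolded compact_def, rule_format, of y 0 "K + \<epsilon> / 2"] by blast
  have ev: "\<exists>k. near_ref \<phi> xbar e (x (r k)) (u (r k)) (v (r k)) (y (r k)) \<and> norm (y (r k) - y0) < e \<and> N \<le> r k"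
    if "e > 0" for e N
  proof -
    have "\<forall>\<^sub>F k in sequentially. dist ((y \<circ> r) k) y0 < e" using r(2) that by (rule tendstoD)
    moreover have "\<forall>\<^sub>F k in sequentially. inverse (real (Suc k)) < e"
      using LIMSEQ_inverse_real_of_nat by (rule order_tendstoD) (use that in simp)
    moreover have "\<forall>\<^sub>F k in sequentially. N \<le> k" by (rule eventually_ge_at_top)
    ultimately have "\<forall>\<^sub>F k in sequentially. dist ((y \<circ> r) k) y0 < e \<and> inverse (real (Suc k)) < e \<and> N \<le> k"
      by (intro eventually_conj)
    then obtain k where k: "dist (y (r k)) y0 < e" "inverse (real (Suc k)) < e" "N \<le> k"
      using eventually_sequentially by auto
    have "inverse (real (Suc (r k + k0))) \<le> inverse (real (Suc k))"
      using seq_suble[OF r(1), of k] by (intro le_imp_inverse_le) auto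
    then have "inverse (real (Suc (r k + k0))) \<le> e" using k(2) by linarith
    then have "near_ref \<phi> xbar e (x (r k)) (u (r k)) (v (r k)) (y (r k))" by (rule near_ref_mono[OF seq(1)])
    then show ?thesis using k seq_suble[OF r(1), of k] by (auto simp: dist_norm intro!: exI[of _ k])
  qed
  \<comment> \<open>The cluster point of the multipliers lies in \<open>Y_bar\<close>, so the local
    hypothesis \<open>pt\<close> applies around it.\<close>
  have "(0, y0) \<in> subdiff \<phi> (xbar, 0)"
  proof (rule subdiff_closed_attentive[OF lsc, of "(xbar, 0)" \<phi>b, OF \<phi>b])
    fix e :: real assume "e > 0"
    then have "e / 2 > 0" by simp
    from ev[OF this] obtain k where k: "near_ref \<phi> xbar (e / 2) (x (r k)) (u (r k)) (v (r k)) (y (r k))" "norm (y (r k) - y0) < e / 2"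
      by blast
    have "dist (x (r k), u (r k)) (xbar, 0) < e" "dist (v (r k), y (r k)) (0, y0) < e"
      using k norm_Pair_le[of "x (r k) - xbar" "u (r k)"] norm_Pair_le[of "v (r k)" "y (r k) - y0"]
      unfolding near_ref_def by (auto simp: dist_norm)
    moreover have "\<phi> (x (r k), u (r k)) < ereal (\<phi>b + e)"
    proof -
      have "ereal (\<phi>b + e / 2) < ereal (\<phi>b + e)" using \<open>e > 0\<close> by simp
      moreover have "\<phi> (x (r k), u (r k)) < ereal (\<phi>b + e / 2)" using k(1) unfolding near_ref_def \<phi>b by simp
      ultimately show ?thesis by (rule order_less_trans[rotated])
    qed
    ultimately show "\<exists>z' w'. w' \<in> subdiff \<phi> z' \<and> dist z' (xbar, 0) < e \<and> dist w' (0, y0) < e \<and> \<phi> z' < ereal (\<phi>b + e)"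
      using k(1) unfolding near_ref_def by blast
  qed
  then have "y0 \<in> Y_bar \<phi> xbar" by (simp add: Y_bar_def Y_set_def)
  from pt[OF this] obtain n where n: "\<And>x u v y'. near_ref \<phi> xbar (inverse (Suc n)) x u v y' \<Longrightarrow>
        norm (y' - y0) < inverse (Suc n) \<Longrightarrow> G n x u v y'" by blast
  have "inverse (real (Suc n)) > 0" by simp
  from ev[OF this, of n] obtain k where "near_ref \<phi> xbar (inverse (Suc n)) (x (r k)) (u (r k)) (v (r k)) (y (r k))"
    "norm (y (r k) - y0) < inverse (Suc n)" "n \<le> r k" by blast
  then have "G n (x (r k)) (u (r k)) (v (r k)) (y (r k))" by (intro n)
  \<comment> \<open>Far along the subsequence the index exceeds n, and monotonicity of G contradicts
    the choice of the counterexample.\<close>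
  then have "G (r k + k0) (x (r k)) (u (r k)) (v (r k)) (y (r k))" by (rule mono[rotated]) (use \<open>n \<le> r k\<close> in simp)
  then show False using seq(2) by blast
qed

definition prox_at ::
    "('x::euclidean_space \<times> 'u::euclidean_space \<Rightarrow> ereal) \<Rightarrow> 'x \<Rightarrow> nat \<Rightarrow> 'x \<Rightarrow> 'u \<Rightarrow> 'x \<Rightarrow> 'u \<Rightarrow> bool" where
  "prox_at \<phi> xbar n x u v y \<longleftrightarrow> (\<forall>x' u'. norm (x' - xbar) < inverse (Suc n) \<longrightarrow> norm u' < inverse (Suc n) \<longrightarrow>
     \<phi> (x, u) + ereal (v \<bullet> (x' - x) + y \<bullet> (u' - u) - real n * ((norm (x' - x))\<^sup>2 + (norm (u' - u))\<^sup>2)) \<le> \<phi> (x', u'))"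

text \<open>The modulus in x is positive, the one in u negative. The index n fixes the radius and
  the modulus 1/(n+1) and the loss n, all of which weaken as n grows; this is the monotonicity that
  \<open>uniformize\<close> demands.\<close>

definition growth_at ::
    "('x::euclidean_space \<times> 'u::euclidean_space \<Rightarrow> ereal) \<Rightarrow> 'x \<Rightarrow> nat \<Rightarrow> 'x \<Rightarrow> 'u \<Rightarrow> 'x \<Rightarrow> 'u \<Rightarrow> bool" where
  "growth_at \<phi> xbar n x u v y \<longleftrightarrow> (\<forall>x' u'. norm (x' - xbar) < inverse (Suc n) \<longrightarrow> norm u' < inverse (Suc n) \<longrightarrow>
     \<phi> (x, u) + ereal (v \<bullet> (x' - x) + y \<bullet> (u' - u) + inverse (Suc n) * (norm (x' - x))\<^sup>2 - real n * (norm (u' - u))\<^sup>2) \<le> \<phi> (x', u'))"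

lemma inverse_Suc_mono: "n \<le> n' \<Longrightarrow> inverse (real (Suc n')) \<le> inverse (real (Suc n))"
  by (intro le_imp_inverse_le) auto

lemma prox_at_mono:
  fixes \<phi> :: "'x::euclidean_space \<times> 'u::euclidean_space \<Rightarrow> ereal"
  assumes "n \<le> n'" "prox_at \<phi> xbar n x u v y" shows "prox_at \<phi> xbar n' x u v y"
  unfolding prox_at_def
proof (intro allI impI)
  fix x' :: 'x and u' :: 'u assume "norm (x' - xbar) < inverse (Suc n')" "norm u' < inverse (Suc n')"
  then have "\<phi> (x, u) + ereal (v \<bullet> (x' - x) + y \<bullet> (u' - u) - real n * ((norm (x' - x))\<^sup>2 + (norm (u' - u))\<^sup>2)) \<le> \<phi> (x', u')"
    using assms(2) inverse_Suc_mono[OF assms(1)] unfolding prox_at_def by (meson order_less_le_trans)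
  moreover have "real n * ((norm (x' - x))\<^sup>2 + (norm (u' - u))\<^sup>2) \<le> real n' * ((norm (x' - x))\<^sup>2 + (norm (u' - u))\<^sup>2)"
    using assms(1) by (intro mult_right_mono) auto
  ultimately show "\<phi> (x, u) + ereal (v \<bullet> (x' - x) + y \<bullet> (u' - u) - real n' * ((norm (x' - x))\<^sup>2 + (norm (u' - u))\<^sup>2)) \<le> \<phi> (x', u')"
    by (elim order_trans[rotated]) (intro add_left_mono, simp)
qed

lemma growth_at_mono:
  fixes \<phi> :: "'x::euclidean_space \<times> 'u::euclidean_space \<Rightarrow> ereal"
  assumes "n \<le> n'" "growth_at \<phi> xbar n x u v y" shows "growth_at \<phi> xbar n' x u v y"
  unfolding growth_at_def
proof (intro allI impI)
  fix x' :: 'x and u' :: 'u assume "norm (x' - xbar) < inverse (Suc n')" "norm u' < inverse (Suc n')"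
  then have 1: "\<phi> (x, u) + ereal (v \<bullet> (x' - x) + y \<bullet> (u' - u) + inverse (Suc n) * (norm (x' - x))\<^sup>2 - real n * (norm (u' - u))\<^sup>2) \<le> \<phi> (x', u')"
    using assms(2) inverse_Suc_mono[OF assms(1)] unfolding growth_at_def by (meson order_less_le_trans)
  have "real n * (norm (u' - u))\<^sup>2 \<le> real n' * (norm (u' - u))\<^sup>2"
    using assms(1) by (intro mult_right_mono) auto
  moreover have "inverse (real (Suc n')) * (norm (x' - x))\<^sup>2 \<le> inverse (real (Suc n)) * (norm (x' - x))\<^sup>2"
    by (intro mult_right_mono inverse_Suc_mono assms) auto
  ultimately have "v \<bullet> (x' - x) + y \<bullet> (u' - u) + inverse (real (Suc n')) * (norm (x' - x))\<^sup>2 - real n' * (norm (u' - u))\<^sup>2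
    \<le> v \<bullet> (x' - x) + y \<bullet> (u' - u) + inverse (real (Suc n)) * (norm (x' - x))\<^sup>2 - real n * (norm (u' - u))\<^sup>2"
    by linarith
  then show "\<phi> (x, u) + ereal (v \<bullet> (x' - x) + y \<bullet> (u' - u) + inverse (Suc n') * (norm (x' - x))\<^sup>2 - real n' * (norm (u' - u))\<^sup>2) \<le> \<phi> (x', u')"
    using 1 by (elim order_trans[rotated]) (intro add_left_mono, simp)
qed

lemma growth_at_imp_prox_at:
  fixes \<phi> :: "'x::euclidean_space \<times> 'u::euclidean_space \<Rightarrow> ereal"
  assumes "growth_at \<phi> xbar n x u v y" shows "prox_at \<phi> xbar n x u v y"
  unfolding prox_at_def
proof (intro allI impI)
  fix x' :: 'x and u' :: 'u assume "norm (x' - xbar) < inverse (Suc n)" "norm u' < inverse (Suc n)"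
  then have 1: "\<phi> (x, u) + ereal (v \<bullet> (x' - x) + y \<bullet> (u' - u) + inverse (Suc n) * (norm (x' - x))\<^sup>2 - real n * (norm (u' - u))\<^sup>2) \<le> \<phi> (x', u')"
    using assms unfolding growth_at_def by blast
  have "inverse (real (Suc n)) * (norm (x' - x))\<^sup>2 \<ge> 0" "real n * (norm (x' - x))\<^sup>2 \<ge> 0" by auto
  then have "v \<bullet> (x' - x) + y \<bullet> (u' - u) - real n * ((norm (x' - x))\<^sup>2 + (norm (u' - u))\<^sup>2)
    \<le> v \<bullet> (x' - x) + y \<bullet> (u' - u) + inverse (real (Suc n)) * (norm (x' - x))\<^sup>2 - real n * (norm (u' - u))\<^sup>2"
    unfolding distrib_left by linarith
  then show "\<phi> (x, u) + ereal (v \<bullet> (x' - x) + y \<bullet> (u' - u) - real n * ((norm (x' - x))\<^sup>2 + (norm (u' - u))\<^sup>2)) \<le> \<phi> (x', u')"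
    using 1 by (elim order_trans[rotated]) (intro add_left_mono, simp)
qed

section \<open>Graphical derivatives and Lipschitz continuity\<close>

lemma eventually_nhds_box:
  fixes P :: "'x::real_normed_vector \<Rightarrow> 'u::real_normed_vector \<Rightarrow> bool"
  shows "(\<forall>\<^sub>F (v, u) in nhds (0, 0). P v u) \<longleftrightarrow> (\<exists>\<theta>>0. \<forall>v u. norm v < \<theta> \<longrightarrow> norm u < \<theta> \<longrightarrow> P v u)"
proof
  assume "\<forall>\<^sub>F (v, u) in nhds (0, 0). P v u"
  then obtain e where e: "e > 0" "\<And>v u. dist (v, u) (0, 0) < e \<Longrightarrow> P v u"
    unfolding eventually_nhds_metric by force
  have "P v u" if "norm v < e / 2" "norm u < e / 2" for v u
    using that norm_Pair_le[of v u] by (intro e(2)) (simp add: dist_norm)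
  then show "\<exists>\<theta>>0. \<forall>v u. norm v < \<theta> \<longrightarrow> norm u < \<theta> \<longrightarrow> P v u"
    using e(1) by (intro exI[of _ "e / 2"]) auto
next
  assume "\<exists>\<theta>>0. \<forall>v u. norm v < \<theta> \<longrightarrow> norm u < \<theta> \<longrightarrow> P v u"
  then obtain \<theta> where \<theta>: "\<theta> > 0" "\<And>v u. norm v < \<theta> \<Longrightarrow> norm u < \<theta> \<Longrightarrow> P v u" by blast
  have "\<forall>\<^sub>F p in nhds (0, 0). p \<in> ball (0::'x) \<theta> \<times> ball (0::'u) \<theta>"
    using \<theta>(1) by (intro eventually_nhds_in_open open_Times) auto
  then show "\<forall>\<^sub>F (v, u) in nhds (0, 0). P v u"
    by (rule eventually_mono) (use \<theta>(2) in auto)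
qed

text \<open>In each direction \<omega> the difference quotients of F have norm at most L, so they
  have a cluster point; it is a value of the graphical derivative at \<omega> with the same
  bound.\<close>

lemma inner_norm_lipschitz_le:
  fixes S :: "'u::real_normed_vector \<Rightarrow> 'x::euclidean_space set"
  assumes S: "\<And>u. norm u < \<theta> \<Longrightarrow> S u = {F u}"
    and lip: "\<And>u u'. norm u < \<theta> \<Longrightarrow> norm u' < \<theta> \<Longrightarrow> norm (F u' - F u) \<le> L * norm (u' - u)"
    and u: "norm u < \<theta>" and L: "L \<ge> 0"
  shows "inner_norm (graphical_derivative S u (F u)) \<le> ereal L"
  unfolding inner_norm_def
proof (rule SUP_least)
  fix \<omega> :: 'u assume "\<omega> \<in> cball 0 1"
  then have \<omega>: "norm \<omega> \<le> 1" by simp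
  \<comment> \<open>Scaled so that u + t \<omega> stays in the ball where S is
    single-valued.\<close>
  define t where "t k = (\<theta> - norm u) / 2 * inverse (real (Suc k))" for k
  have tpos: "t k > 0" for k using u by (simp add: t_def)
  have half: "t k \<le> (\<theta> - norm u) / 2 * 1" for k
    unfolding t_def using u by (intro mult_left_mono) (auto simp: inverse_le_1_iff)
  have tle: "t k < \<theta> - norm u" for k
  proof -
    have "(\<theta> - norm u) / 2 * 1 < \<theta> - norm u" using u by simp
    then show ?thesis using half by (rule order_le_less_trans[rotated])
  qed
  have "(\<lambda>k. (\<theta> - norm u) / 2 * inverse (real (Suc k))) \<longlonglongrightarrow> (\<theta> - norm u) / 2 * 0"
    by (intro tendsto_mult tendsto_const LIMSEQ_inverse_real_of_nat)
  then have t0: "t \<longlonglongrightarrow> 0" by (simp add: t_def[abs_def])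
  define us where "us k = u + t k *\<^sub>R \<omega>" for k
  have us: "norm (us k) < \<theta>" for k
  proof -
    have "norm (t k *\<^sub>R \<omega>) \<le> t k" using \<omega> tpos[of k] by (simp add: mult_left_le)
    then show ?thesis using norm_triangle_ineq[of u "t k *\<^sub>R \<omega>"] tle[of k] by (simp add: us_def)
  qed
  define q where "q k = (F (us k) - F u) /\<^sub>R t k" for k
  have Fus: "norm (F (us k) - F u) \<le> L * t k" for k
  proof -
    have "norm (F (us k) - F u) \<le> L * norm (us k - u)" by (rule lip[OF u us])
    also have "norm (us k - u) \<le> t k" using \<omega> tpos[of k] by (simp add: us_def mult_left_le)
    finally show ?thesis using L by (simp add: mult_left_mono)
  qed
  have "norm (q k) \<le> L" for k
  proof -
    have "norm (q k) = norm (F (us k) - F u) / t k"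
      using tpos[of k] by (simp add: q_def divide_inverse mult.commute)
    then show ?thesis using Fus[of k] tpos[of k] by (simp add: pos_divide_le_eq)
  qed
  then have "\<forall>k. q k \<in> cball 0 L" by simp
  then obtain \<xi> r where r: "\<xi> \<in> cball 0 L" "strict_mono (r :: nat \<Rightarrow> nat)" "(q \<circ> r) \<longlonglongrightarrow> \<xi>"
    using compact_cball[unfolded compact_def, rule_format, of q 0 L] by blast
  have "(\<omega>, \<xi>) \<in> tangent_cone (gph S) (u, F u)"
  proof -
    define zs where "zs k = (us (r k), F (us (r k)))" for k
    define ts where "ts k = t (r k)" for k
    have "\<forall>k. zs k \<in> gph S" using S us by (auto simp: gph_def zs_def)
    moreover have ts0: "ts \<longlonglongrightarrow> 0" using LIMSEQ_subseq_LIMSEQ[OF t0 r(2)] by (simp add: o_def ts_def[abs_def])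
    moreover have "\<forall>k. 0 < ts k" using tpos by (simp add: ts_def)
    moreover have "zs \<longlonglongrightarrow> (u, F u)"
    proof -
      have "(\<lambda>k. u + ts k *\<^sub>R \<omega>) \<longlonglongrightarrow> u + 0 *\<^sub>R \<omega>" by (intro tendsto_intros ts0)
      then have 1: "(\<lambda>k. us (r k)) \<longlonglongrightarrow> u" by (simp add: us_def ts_def)
      have "(\<lambda>k. L * ts k) \<longlonglongrightarrow> L * 0" by (intro tendsto_intros ts0)
      then have "(\<lambda>k. L * ts k) \<longlonglongrightarrow> 0" by simp
      then have "(\<lambda>k. F (us (r k)) - F u) \<longlonglongrightarrow> 0"
        by (rule Lim_null_comparison[rotated]) (use Fus in \<open>auto simp: ts_def\<close>)
      then have "(\<lambda>k. F (us (r k))) \<longlonglongrightarrow> F u" by (rule LIM_zero_cancel)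
      with 1 show ?thesis unfolding zs_def by (intro tendsto_Pair)
    qed
    moreover have "(\<lambda>k. (zs k - (u, F u)) /\<^sub>R ts k) \<longlonglongrightarrow> (\<omega>, \<xi>)"
    proof -
      have "(zs k - (u, F u)) /\<^sub>R ts k = (\<omega>, (q \<circ> r) k)" for k
        using tpos[of "r k"] by (simp add: zs_def ts_def us_def q_def)
      then show ?thesis using tendsto_Pair[OF tendsto_const r(3), of \<omega>] by simp
    qed
    ultimately show ?thesis unfolding tangent_cone_def by blast
  qed
  then show "(INF \<xi>\<in>graphical_derivative S u (F u) \<omega>. ereal (norm \<xi>)) \<le> ereal L"
    by (intro INF_lower2[of \<xi>]) (use r(1) in \<open>auto simp: graphical_derivative_def\<close>)
qed

text \<open>Minimizing \<open>(\<kappa> + 1) * norm (z - u') + norm (F z - F u)\<close> over a ball around \<open>u'\<close> yields \<open>z = u'\<close>: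
  otherwise a tangent direction towards \<open>u'\<close> of length less than \<open>\<kappa>\<close> would decrease the value.\<close>

lemma lipschitz_of_inner_norm_less:
  fixes S :: "'u::euclidean_space \<Rightarrow> 'x::real_normed_vector set"
  assumes S: "\<And>u. norm u < \<theta> \<Longrightarrow> S u = {F u}"
    and cont: "continuous_on (ball 0 \<theta>) F"
    and D: "\<And>u. norm u < \<theta> \<Longrightarrow> inner_norm (graphical_derivative S u (F u)) < ereal \<kappa>"
    and u: "norm u < \<theta> / 3" "norm u' < \<theta> / 3"
  shows "norm (F u' - F u) \<le> (\<kappa> + 1) * norm (u' - u)"
proof -
  define r where "r = norm (u - u')"
  \<comment> \<open>This is where \<theta>/3 comes from: the ball around u' has radius below
    2\<theta>/3, so it stays in the ball of radius \<theta>.\<close>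
  have "r \<le> norm u + norm u'" unfolding r_def by (rule norm_triangle_ineq4)
  then have ball: "norm z < \<theta>" if "norm (z - u') \<le> r" for z
    using that u norm_triangle_ineq[of "z - u'" u'] by simp
  let ?h = "\<lambda>z. (\<kappa> + 1) * norm (z - u') + norm (F z - F u)"
  have "continuous_on (cball u' r) F"
    by (rule continuous_on_subset[OF cont]) (use ball in \<open>auto simp: dist_norm norm_minus_commute\<close>)
  then have "continuous_on (cball u' r) ?h" by (intro continuous_intros)
  then have "\<exists>z\<in>cball u' r. \<forall>z'\<in>cball u' r. ?h z \<le> ?h z'"
    by (intro continuous_attains_inf compact_cball) (auto simp: r_def)
  then obtain z where zB: "z \<in> cball u' r" and minB: "\<forall>z'\<in>cball u' r. ?h z \<le> ?h z'" by blast
  have z: "norm (z - u') \<le> r" using zB by (simp add: dist_norm norm_minus_commute)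
  have min: "?h z \<le> ?h z'" if "norm (z' - u') \<le> r" for z'
    using bspec[OF minB, of z'] that by (simp add: dist_norm norm_minus_commute)
  have "z = u'"
  proof (rule ccontr)
    assume "z \<noteq> u'"
    define d where "d = norm (u' - z)"
    have d: "d > 0" "d \<le> r" using \<open>z \<noteq> u'\<close> z by (auto simp: d_def norm_minus_commute)
    define \<omega> where "\<omega> = (u' - z) /\<^sub>R d"
    have \<omega>: "norm \<omega> = 1" "d *\<^sub>R \<omega> = u' - z" using d by (auto simp: \<omega>_def d_def)
    have "(INF \<xi>\<in>graphical_derivative S z (F z) \<omega>. ereal (norm \<xi>)) \<le> inner_norm (graphical_derivative S z (F z))"
      unfolding inner_norm_def by (rule SUP_upper) (use \<omega> in simp)
    also have "\<dots> < ereal \<kappa>" using D ball[OF z] by blast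
    finally obtain \<xi> where \<xi>: "\<xi> \<in> graphical_derivative S z (F z) \<omega>" "norm \<xi> < \<kappa>"
      unfolding INF_less_iff by auto
    then obtain zs t where zt: "\<And>k. zs k \<in> gph S" "zs \<longlonglongrightarrow> (z, F z)" "\<And>k. (0::real) < t k" "t \<longlonglongrightarrow> 0"
       "(\<lambda>k. (zs k - (z, F z)) /\<^sub>R t k) \<longlonglongrightarrow> (\<omega>, \<xi>)"
      unfolding graphical_derivative_def tangent_cone_def by blast
    define us where "us k = fst (zs k)" for k
    define \<eta> where "\<eta> k = norm ((us k - z) /\<^sub>R t k - \<omega>)" for k
    define q where "q k = norm ((snd (zs k) - F z) /\<^sub>R t k)" for k
    have "(\<lambda>k. fst ((zs k - (z, F z)) /\<^sub>R t k)) \<longlonglongrightarrow> fst (\<omega>, \<xi>)" by (rule tendsto_fst[OF zt(5)])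
    then have "(\<lambda>k. (us k - z) /\<^sub>R t k) \<longlonglongrightarrow> \<omega>" by (simp add: us_def)
    then have "(\<lambda>k. norm ((us k - z) /\<^sub>R t k - \<omega>)) \<longlonglongrightarrow> norm (\<omega> - \<omega>)" by (intro tendsto_intros)
    then have \<eta>: "\<eta> \<longlonglongrightarrow> 0" by (simp add: \<eta>_def[abs_def])
    have "(\<lambda>k. snd ((zs k - (z, F z)) /\<^sub>R t k)) \<longlonglongrightarrow> snd (\<omega>, \<xi>)" by (rule tendsto_snd[OF zt(5)])
    then have "(\<lambda>k. (snd (zs k) - F z) /\<^sub>R t k) \<longlonglongrightarrow> \<xi>" by simp
    then have q: "q \<longlonglongrightarrow> norm \<xi>" unfolding q_def by (rule tendsto_norm)
    have us: "us \<longlonglongrightarrow> z" using tendsto_fst[OF zt(2)] by (simp add: us_def[abs_def])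
    have \<kappa>: "\<kappa> + 1 > 0" using \<xi>(2) norm_ge_zero[of \<xi>] by linarith
    have "\<forall>\<^sub>F k in sequentially. norm (us k) < \<theta>"
      using tendsto_norm[OF us] ball[OF z] by (rule order_tendstoD)
    moreover have "\<forall>\<^sub>F k in sequentially. \<eta> k < 1 / (\<kappa> + 1)"
      using \<eta> by (rule order_tendstoD) (use \<kappa> in simp)
    moreover have "\<forall>\<^sub>F k in sequentially. \<eta> k < 1" using \<eta> by (rule order_tendstoD) simp
    moreover have "\<forall>\<^sub>F k in sequentially. q k < \<kappa>" using q \<xi>(2) by (rule order_tendstoD)
    moreover have "\<forall>\<^sub>F k in sequentially. t k < d" using zt(4) d(1) by (rule order_tendstoD)
    ultimately have "\<forall>\<^sub>F k in sequentially. norm (us k) < \<theta> \<and> \<eta> k < 1 / (\<kappa> + 1) \<and> \<eta> k < 1 \<and> q k < \<kappa> \<and> t k < d"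
      by eventually_elim simp
    then obtain k where k: "norm (us k) < \<theta>" "\<eta> k < 1 / (\<kappa> + 1)" "\<eta> k < 1" "q k < \<kappa>" "t k < d"
      using eventually_sequentially by auto
    have t: "t k > 0" by (rule zt)
    have "snd (zs k) \<in> S (us k)" using zt(1)[of k] by (simp add: gph_def us_def split_def)
    then have "snd (zs k) = F (us k)" unfolding S[OF k(1)] by (rule singletonD)
    then have Fk: "norm (F (us k) - F z) = t k * q k" using t by (simp add: q_def)
    \<comment> \<open>The first part is the deviation from the tangent direction, of size t \<eta>;
      the second is what remains of the way to u' after an exact step t, of length d - t.\<close>
    have "us k - u' = t k *\<^sub>R ((us k - z) /\<^sub>R t k - \<omega>) - (1 - t k / d) *\<^sub>R (d *\<^sub>R \<omega>)"
    proof -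
      have "t k *\<^sub>R ((us k - z) /\<^sub>R t k - \<omega>) = us k - z - t k *\<^sub>R \<omega>"
        using t by (simp add: scaleR_diff_right)
      moreover have "(1 - t k / d) *\<^sub>R (d *\<^sub>R \<omega>) = (u' - z) - t k *\<^sub>R \<omega>"
        using d unfolding scaleR_diff_left scaleR_one \<omega>(2)[symmetric] by simp
      ultimately show ?thesis by simp
    qed
    also have "norm \<dots> \<le> norm (t k *\<^sub>R ((us k - z) /\<^sub>R t k - \<omega>)) + norm ((1 - t k / d) *\<^sub>R (d *\<^sub>R \<omega>))"
      by (rule norm_triangle_ineq4)
    also have "\<dots> = t k * \<eta> k + \<bar>1 - t k / d\<bar> * d"
      using t d \<omega>(1) by (simp add: \<eta>_def abs_mult)
    also have "\<dots> = t k * \<eta> k + (d - t k)" using d(1) k(5) t by (simp add: field_simps)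
    finally have dist: "norm (us k - u') \<le> d - t k * (1 - \<eta> k)" by (simp add: algebra_simps)
    have "t k * (1 - \<eta> k) \<ge> 0" using t k(3) by simp
    then have "?h z \<le> ?h (us k)" using dist d(2) by (intro min) linarith
    also have "\<dots> \<le> (\<kappa> + 1) * (d - t k * (1 - \<eta> k)) + (norm (F z - F u) + t k * q k)"
    proof (intro add_mono mult_left_mono dist)
      show "norm (F (us k) - F u) \<le> norm (F z - F u) + t k * q k"
        using norm_triangle_ineq[of "F z - F u" "F (us k) - F z"] Fk by simp
    qed (use \<kappa> in simp)
    \<comment> \<open>The gain in distance, weighted by \<kappa> + 1, would be at most the change of
      F, which is below \<kappa> t. The spare 1 in \<kappa> + 1 absorbs the deviation, as (\<kappa>
      + 1) \<eta> < 1.\<close>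
    finally have "(\<kappa> + 1) * (t k * (1 - \<eta> k)) \<le> t k * q k"
      by (simp add: d_def norm_minus_commute algebra_simps)
    then have "(\<kappa> + 1) * (1 - \<eta> k) \<le> q k" using t by (simp add: mult.left_commute)
    moreover have "(\<kappa> + 1) * \<eta> k < 1" using k(2) \<kappa> by (simp add: field_simps)
    ultimately show False using k(4) by (simp add: algebra_simps)
  qed
  \<comment> \<open>Comparison with u, where the second term of the minimized function
    vanishes.\<close>
  then show ?thesis using min[of u] by (simp add: r_def norm_minus_commute)
qed

section \<open>Stability, substability and sufficiency\<close>

lemma norm_snd_square_has_derivative:
  fixes z :: "'x::real_inner \<times> 'u::real_inner"
  shows "((\<lambda>z. e / 2 * (norm (snd z))\<^sup>2) has_derivative (\<lambda>h. (0, e *\<^sub>R snd z) \<bullet> h)) (at z)"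
  unfolding power2_norm_eq_inner
  by (auto intro!: derivative_eq_intros simp: inner_commute inner_prod_def)

lemma norm_fst_square_has_derivative:
  fixes z :: "'x::real_inner \<times> 'u::real_inner"
  shows "((\<lambda>z. (norm (fst z - c))\<^sup>2) has_derivative (\<lambda>h. (2 *\<^sub>R (fst z - c), 0) \<bullet> h)) (at z)"
  unfolding power2_norm_eq_inner
  by (auto intro!: derivative_eq_intros simp: inner_commute inner_prod_def)

abbreviation penalized ::
    "real \<Rightarrow> ('x::real_normed_vector \<times> 'u::real_normed_vector \<Rightarrow> ereal) \<Rightarrow> 'x \<times> 'u \<Rightarrow> ereal" where
  "penalized e \<phi> \<equiv> (\<lambda>(x, u). \<phi> (x, u) + ereal (e / 2 * (norm u)\<^sup>2))"

lemma penalized_eq: "penalized e \<phi> = (\<lambda>z. \<phi> z + ereal (e / 2 * (norm (snd z))\<^sup>2))"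
  by (auto simp: fun_eq_iff)

lemma subdiff_penalized:
  fixes \<phi> :: "'x::euclidean_space \<times> 'u::euclidean_space \<Rightarrow> ereal"
  shows "(v, y) \<in> subdiff (penalized e \<phi>) (x, u) \<longleftrightarrow> (v, y - e *\<^sub>R u) \<in> subdiff \<phi> (x, u)"
  unfolding penalized_eq
  by (subst subdiff_add_smooth_iff[OF norm_snd_square_has_derivative]) (auto intro!: continuous_intros)

lemma norm_Pair_square: "(norm (x, y))\<^sup>2 = (norm x)\<^sup>2 + (norm y)\<^sup>2"
  by (simp add: norm_Pair)

lemma ereal_add_real_mono:
  assumes "f + ereal p \<le> g" "q \<le> p" shows "f + ereal q \<le> g"
  using assms(1) by (rule order_trans[rotated]) (use assms(2) in \<open>auto intro: add_left_mono\<close>)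

locale perturbed_problem =
  fixes \<phi> :: "'x::euclidean_space \<times> 'u::euclidean_space \<Rightarrow> ereal"
    and xbar :: 'x and \<phi>b :: real
  assumes cp: "closed_proper \<phi>" and \<phi>b: "\<phi> (xbar, 0) = ereal \<phi>b"
    and local_opt: "\<forall>\<^sub>F x in nhds xbar. \<phi> (xbar, 0) \<le> \<phi> (x, 0)"
    and bcq: "\<And>y. (0, y) \<in> horizon_subdiff \<phi> (xbar, 0) \<Longrightarrow> y = 0"
begin

lemma lsc: "lsc \<phi>" and nm: "\<phi> z \<noteq> -\<infinity>"
  using cp unfolding closed_proper_def proper_fun_def by blast+

lemma near_ref_bar:
  assumes "y \<in> Y_bar \<phi> xbar" "\<rho> > 0"
  shows "near_ref \<phi> xbar \<rho> xbar 0 0 y"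
  using assms \<phi>b by (auto simp: near_ref_def Y_bar_def Y_set_def)

text \<open>The point \<open>xbar\<close> need not be a strict local minimizer. Adding |x - xbar|^2
  makes it one and has zero gradient there, so the reference multipliers do not change, and the
  minimizer at v = 0, u = 0 has one.\<close>

lemma Y_bar_nonempty: "Y_bar \<phi> xbar \<noteq> {}"
proof -
  obtain \<epsilon> K where \<epsilon>: "\<epsilon> > 0" and bound: "\<And>x u v y. norm (x - xbar) < \<epsilon> \<Longrightarrow> norm u < \<epsilon> \<Longrightarrow> norm v < \<epsilon> \<Longrightarrow>
       \<phi> (x, u) < ereal (\<phi>b + \<epsilon>) \<Longrightarrow> (v, y) \<in> regular_subdiff \<phi> (x, u) \<Longrightarrow> norm y \<le> K"
    using multiplier_bound[OF lsc \<phi>b bcq] by blast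
  obtain \<delta>1 where \<delta>1: "\<delta>1 > 0" "\<And>x. dist x xbar < \<delta>1 \<Longrightarrow> \<phi> (xbar, 0) \<le> \<phi> (x, 0)"
    using local_opt unfolding eventually_nhds_metric by blast
  let ?\<psi> = "\<lambda>z. \<phi> z + ereal ((norm (fst z - xbar))\<^sup>2)"
  \<comment> \<open>The subgradient of the regularized function shifts v by 2 (x - xbar); three
    thirds of \<epsilon> keep the shifted v within the reach of \<open>bound\<close>.\<close>
  interpret c: calm ?\<psi> xbar \<phi>b "\<delta>1 / 2" "\<epsilon> / 3" K
  proof
    show "lsc ?\<psi>" by (intro lsc_add_continuous lsc nm continuous_intros)
    show "?\<psi> z \<noteq> -\<infinity>" for z using nm[of z] by (cases "\<phi> z") auto
    show "?\<psi> (xbar, 0) = ereal \<phi>b" using \<phi>b by simp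
    show "\<delta>1 / 2 > 0" "\<epsilon> / 3 > 0" using \<delta>1 \<epsilon> by auto
    fix x assume x: "norm (x - xbar) \<le> \<delta>1 / 2" "x \<noteq> xbar"
    then have "\<phi> (xbar, 0) \<le> \<phi> (x, 0)" using \<delta>1 by (intro \<delta>1(2)) (simp add: dist_norm)
    moreover have "(norm (x - xbar))\<^sup>2 > 0" using x by simp
    ultimately have "\<phi>b < r + (norm (x - xbar))\<^sup>2" if "\<phi> (x, 0) = ereal r" for r
      using \<phi>b that by (intro add_le_less_mono[of \<phi>b r 0, simplified]) auto
    then show "ereal \<phi>b < ?\<psi> (x, 0)" using nm[of "(x, 0)"] by (cases "\<phi> (x, 0)") auto
  next
    fix x u v y
    assume *: "norm (x - xbar) < \<epsilon> / 3" "norm (u::'u) < \<epsilon> / 3" "norm v < \<epsilon> / 3" "?\<psi> (x, u) < ereal (\<phi>b + \<epsilon> / 3)"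
      "(v, y) \<in> regular_subdiff ?\<psi> (x, u)"
    show "norm y \<le> K"
    proof (rule bound)
      show "(v - 2 *\<^sub>R (x - xbar), y) \<in> regular_subdiff \<phi> (x, u)"
        using *(5) regular_subdiff_add_smooth_iff[OF norm_fst_square_has_derivative[of xbar "(x, u)"], of "(v, y)" \<phi>]
        by simp
      show "norm (v - 2 *\<^sub>R (x - xbar)) < \<epsilon>" using *(1,3) norm_triangle_ineq4[of v "2 *\<^sub>R (x - xbar)"] by simp
      have "r < \<phi>b + \<epsilon>" if "r + (norm (x - xbar))\<^sup>2 < \<phi>b + \<epsilon> / 3" for r
        using that \<epsilon> zero_le_power2[of "norm (x - xbar)"] by linarith
      then show "\<phi> (x, u) < ereal (\<phi>b + \<epsilon>)" using *(4) nm[of "(x, u)"] by (cases "\<phi> (x, u)") auto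
    qed (use * \<epsilon> in auto)
  qed
  obtain \<theta> K' where box: "c.stable_box \<theta> K'" using c.ex_stable_box by blast
  then have "\<theta> > 0" by (simp add: c.stable_box_def)
  then obtain y where "(0, y) \<in> subdiff ?\<psi> (xbar, 0)"
    using c.minimizer_multiplier[OF box, of 0 0 xbar] c.M_delta_reference by auto
  then have "(0, y) \<in> subdiff \<phi> (xbar, 0)"
    by (subst (asm) subdiff_add_smooth_iff[OF norm_fst_square_has_derivative]) (auto intro!: continuous_intros)
  then show ?thesis by (auto simp: Y_bar_def Y_set_def)
qed

lemma reference_box:
  assumes "open X" "(xbar, 0 :: 'u) \<in> X" "open W" "(0 :: 'x, y :: 'u) \<in> W" "\<phi>b < \<alpha>"
  obtains \<rho> where "\<rho> > 0" "\<And>x u. norm (x - xbar) < \<rho> \<Longrightarrow> norm u < \<rho> \<Longrightarrow> (x, u) \<in> X"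
    "\<And>v y'. norm v < \<rho> \<Longrightarrow> norm (y' - y) < \<rho> \<Longrightarrow> (v, y') \<in> W" "\<phi>b + \<rho> \<le> \<alpha>"
proof -
  obtain e1 where e1: "e1 > 0" "ball (xbar, 0) e1 \<subseteq> X" using assms(1,2) open_contains_ball by blast
  obtain e2 where e2: "e2 > 0" "ball (0, y) e2 \<subseteq> W" using assms(3,4) open_contains_ball by blast
  define \<rho> where "\<rho> = min (min (e1 / 2) (e2 / 2)) (\<alpha> - \<phi>b)"
  have \<rho>: "\<rho> > 0" "2 * \<rho> \<le> e1" "2 * \<rho> \<le> e2" "\<rho> \<le> \<alpha> - \<phi>b"
    unfolding \<rho>_def using e1 e2 assms(5) by (auto simp: min_def)
  show ?thesis
  proof (rule that[OF \<rho>(1)])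
    fix x and u :: 'u assume *: "norm (x - xbar) < \<rho>" "norm u < \<rho>"
    have "dist (x, u) (xbar, 0) < e1"
      using norm_Pair_le[of "x - xbar" u] * \<rho>(2) by (simp add: dist_norm)
    then show "(x, u) \<in> X" using e1 by (auto simp: dist_commute)
  next
    fix v :: 'x and y' assume *: "norm v < \<rho>" "norm (y' - y) < \<rho>"
    have "dist (v, y') (0, y) < e2"
      using norm_Pair_le[of v "y' - y"] * \<rho>(3) by (simp add: dist_norm)
    then show "(v, y') \<in> W" using e2 by (auto simp: dist_commute)
  qed (use \<rho> in simp)
qed

definition uniform_prox :: "nat \<Rightarrow> bool" where
  "uniform_prox n \<longleftrightarrow> (\<forall>x u v y. near_ref \<phi> xbar (inverse (Suc n)) x u v y \<longrightarrow> prox_at \<phi> xbar n x u v y)"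

definition uniform_growth :: "nat \<Rightarrow> bool" where
  "uniform_growth n \<longleftrightarrow> (\<forall>x u v y. near_ref \<phi> xbar (inverse (Suc n)) x u v y \<longrightarrow> growth_at \<phi> xbar n x u v y)"

lemma uniform_prox_iff: "full_multiplier_prox_regularity \<phi> xbar \<longleftrightarrow> (\<exists>n. uniform_prox n)"
proof
  assume reg: "full_multiplier_prox_regularity \<phi> xbar"
  show "\<exists>n. uniform_prox n"
    unfolding uniform_prox_def
  proof (rule uniformize[OF lsc \<phi>b bcq prox_at_mono])
    fix y assume "y \<in> Y_bar \<phi> xbar"
    then have "prox_regular \<phi> (xbar, 0) (0, y)" using reg by (simp add: full_multiplier_prox_regularity_def)
    then obtain X W \<alpha> r where *: "open X" "(xbar, 0) \<in> X" "open W" "(0, y) \<in> W" "\<phi> (xbar, 0) < ereal \<alpha>"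
      and prox: "\<forall>z'\<in>X. \<forall>(z, w) \<in> (truncated X \<phi> \<alpha> \<times> W) \<inter> gph_subdiff \<phi>.
           \<phi> z' \<ge> \<phi> z + ereal (w \<bullet> (z' - z) - r / 2 * (norm (z' - z))\<^sup>2)"
      unfolding prox_regular_def by blast
    have "\<phi>b < \<alpha>" using * \<phi>b by simp
    from reference_box[OF *(1-4) this]
    obtain \<rho> where \<rho>: "\<rho> > 0" "\<And>x u. norm (x - xbar) < \<rho> \<Longrightarrow> norm u < \<rho> \<Longrightarrow> (x, u) \<in> X"
      "\<And>v y'. norm v < \<rho> \<Longrightarrow> norm (y' - y) < \<rho> \<Longrightarrow> (v, y') \<in> W" "\<phi>b + \<rho> \<le> \<alpha>" by blast
    obtain n :: nat where n: "inverse (real (Suc n)) < \<rho>" "r / 2 \<le> real n" using ex_nat_large[OF \<rho>(1)] by blast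
    show "\<exists>n. \<forall>x u v y'. near_ref \<phi> xbar (inverse (Suc n)) x u v y' \<longrightarrow>
        norm (y' - y) < inverse (Suc n) \<longrightarrow> prox_at \<phi> xbar n x u v y'"
      unfolding prox_at_def
    proof (intro exI[of _ n] allI impI)
      fix x u v y' x' and u' :: 'u
      assume nr: "near_ref \<phi> xbar (inverse (Suc n)) x u v y'" and y': "norm (y' - y) < inverse (Suc n)"
        and x': "norm (x' - xbar) < inverse (Suc n)" "norm u' < inverse (Suc n)"
      have nr': "near_ref \<phi> xbar \<rho> x u v y'" using near_ref_mono[OF nr] n(1) by simp
      have "\<phi> (x, u) < ereal \<alpha>"
        using nr' \<rho>(4) unfolding near_ref_def \<phi>b by (auto elim: order_less_le_trans)
      then have "((x, u), (v, y')) \<in> (truncated X \<phi> \<alpha> \<times> W) \<inter> gph_subdiff \<phi>"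
        using nr' \<rho>(2,3) y' n(1) unfolding near_ref_def truncated_def gph_subdiff_def by auto
      moreover have "(x', u') \<in> X" using x' n(1) by (intro \<rho>) auto
      ultimately have "\<phi> (x, u) + ereal ((v, y') \<bullet> ((x', u') - (x, u)) - r / 2 * (norm ((x', u') - (x, u)))\<^sup>2) \<le> \<phi> (x', u')"
        using prox by blast
      then show "\<phi> (x, u) + ereal (v \<bullet> (x' - x) + y' \<bullet> (u' - u) - real n * ((norm (x' - x))\<^sup>2 + (norm (u' - u))\<^sup>2)) \<le> \<phi> (x', u')"
      proof (rule ereal_add_real_mono)
        have "r / 2 * (norm ((x', u') - (x, u)))\<^sup>2 \<le> real n * (norm ((x', u') - (x, u)))\<^sup>2"
          using n(2) by (intro mult_right_mono) auto
        then show "v \<bullet> (x' - x) + y' \<bullet> (u' - u) - real n * ((norm (x' - x))\<^sup>2 + (norm (u' - u))\<^sup>2)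
          \<le> (v, y') \<bullet> ((x', u') - (x, u)) - r / 2 * (norm ((x', u') - (x, u)))\<^sup>2"
          by (simp add: norm_Pair_square)
      qed
    qed
  qed
next
  assume "\<exists>n. uniform_prox n"
  then obtain n where n: "uniform_prox n" by blast
  define \<rho> where "\<rho> = inverse (real (Suc n))"
  have \<rho>: "\<rho> > 0" by (simp add: \<rho>_def)
  show "full_multiplier_prox_regularity \<phi> xbar"
    unfolding full_multiplier_prox_regularity_def prox_regular_def
  proof (intro ballI conjI)
    fix y assume y: "y \<in> Y_bar \<phi> xbar"
    then show "(0, y) \<in> subdiff \<phi> (xbar, 0)" by (simp add: Y_bar_def Y_set_def)
    show "\<exists>X W \<alpha> r. open X \<and> (xbar, 0) \<in> X \<and> open W \<and> (0, y) \<in> W \<and> \<phi> (xbar, 0) < ereal \<alpha> \<and>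
        (\<forall>z'\<in>X. \<forall>(z, w)\<in>truncated X \<phi> \<alpha> \<times> W \<inter> gph_subdiff \<phi>.
            \<phi> z + ereal (w \<bullet> (z' - z) - r / 2 * (norm (z' - z))\<^sup>2) \<le> \<phi> z')"
    \<comment> \<open>The neighborhood W restricts only v, since \<open>uniform_prox\<close> covers
      all multipliers; r = 2n matches the factor 1/2 in prox-regularity.\<close>
    proof (rule exI[of _ "ball xbar \<rho> \<times> ball (0::'u) \<rho>"], rule exI[of _ "ball (0::'x) \<rho> \<times> (UNIV :: 'u set)"],
        rule exI[of _ "\<phi>b + \<rho>"], rule exI[of _ "2 * real n"], intro conjI ballI)
      fix z' p assume z': "z' \<in> ball xbar \<rho> \<times> ball (0::'u) \<rho>"
        and p: "p \<in> truncated (ball xbar \<rho> \<times> ball (0::'u) \<rho>) \<phi> (\<phi>b + \<rho>) \<times> (ball (0::'x) \<rho> \<times> (UNIV :: 'u set)) \<inter> gph_subdiff \<phi>"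
      obtain x u v y' x' u' where p': "p = ((x, u), (v, y'))" "z' = (x', u')" by (metis prod.exhaust)
      have "near_ref \<phi> xbar \<rho> x u v y'"
        using p unfolding p' near_ref_def truncated_def gph_subdiff_def by (auto simp: \<phi>b dist_norm norm_minus_commute)
      then have "prox_at \<phi> xbar n x u v y'" using n unfolding uniform_prox_def \<rho>_def by blast
      then have "\<phi> (x, u) + ereal (v \<bullet> (x' - x) + y' \<bullet> (u' - u) - real n * ((norm (x' - x))\<^sup>2 + (norm (u' - u))\<^sup>2)) \<le> \<phi> (x', u')"
        using z' unfolding prox_at_def p' \<rho>_def by (auto simp: dist_norm norm_minus_commute)
      then show "case p of (z, w) \<Rightarrow> \<phi> z + ereal (w \<bullet> (z' - z) - 2 * real n / 2 * (norm (z' - z))\<^sup>2) \<le> \<phi> z'"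
        by (simp add: p' norm_Pair_square)
    qed (use \<rho> \<phi>b in \<open>auto intro!: open_Times\<close>)
  qed
qed

lemma completed_square:
  "e / 2 * (norm u)\<^sup>2 - e / 2 * (norm u')\<^sup>2 + (e *\<^sub>R u) \<bullet> (u' - u) = - (e / 2) * (norm (u' - u))\<^sup>2"
  for u u' :: "'a::real_inner"
  unfolding power2_norm_eq_inner by (simp add: inner_diff_left inner_diff_right inner_commute algebra_simps)

text \<open>Penalizing shifts the multiplier y to y + e u, and completing the square turns penalty
  and shift into -(e/2) |u' - u|^2. Strong convexity of the penalized function thus reads as growth
  in x with a quadratic loss in u, and conversely a large e pays for that loss.\<close>

lemma uniform_growth_iff: "strong_variational_sufficiency \<phi> xbar \<longleftrightarrow> (\<exists>n. uniform_growth n)"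
proof
  assume suff: "strong_variational_sufficiency \<phi> xbar"
  show "\<exists>n. uniform_growth n"
    unfolding uniform_growth_def
  proof (rule uniformize[OF lsc \<phi>b bcq growth_at_mono])
    fix y assume "y \<in> Y_bar \<phi> xbar"
    then obtain e where e: "e \<ge> 0" "variationally_strongly_convex (penalized e \<phi>) (xbar, 0) (0, y)"
      using suff unfolding strong_variational_sufficiency_def by blast
    then obtain s where s: "s > 0" "variationally_s_convex s (penalized e \<phi>) (xbar, 0) (0, y)"
      unfolding variationally_strongly_convex_def by blast
    obtain X W \<alpha> where *: "open X" "(xbar, 0) \<in> X" "open W" "(0, y) \<in> W"
      "penalized e \<phi> (xbar, 0) < ereal \<alpha>"
      and grow: "\<forall>z\<in>X. \<forall>w\<in>W. \<forall>z'\<in>X. penalized e \<phi> z < ereal \<alpha> \<longrightarrow> w \<in> subdiff (penalized e \<phi>) z \<longrightarrow>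
       penalized e \<phi> z + ereal (w \<bullet> (z' - z) + s / 2 * (norm (z' - z))\<^sup>2) \<le> penalized e \<phi> z'"
      using variationally_s_convexD[OF s(2)] by (elim exE conjE)
    have "\<phi>b < \<alpha>" using *(5) \<phi>b by simp
    from reference_box[OF *(1-4) this]
    obtain \<rho> where \<rho>: "\<rho> > 0" "\<And>x u. norm (x - xbar) < \<rho> \<Longrightarrow> norm u < \<rho> \<Longrightarrow> (x, u) \<in> X"
      "\<And>v y'. norm v < \<rho> \<Longrightarrow> norm (y' - y) < \<rho> \<Longrightarrow> (v, y') \<in> W" "\<phi>b + \<rho> \<le> \<alpha>" by blast
    \<comment> \<open>The first bound, with |u|^2 \<le> |u| from the third, keeps the shifted
      multiplier in W and the penalized value below \<alpha>; s/2 bounds the modulus in x.\<close>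
    define \<rho>' where "\<rho>' = Min {\<rho> / (2 * (e + 1)), \<rho> / 2, 1, s / 2}"
    have \<rho>': "\<rho>' > 0" "\<rho>' \<le> \<rho> / (2 * (e + 1))" "\<rho>' \<le> \<rho> / 2" "\<rho>' \<le> 1" "\<rho>' \<le> s / 2"
    proof -
      show "\<rho>' > 0" unfolding \<rho>'_def using \<rho> s e by auto
      show "\<rho>' \<le> \<rho> / (2 * (e + 1))" "\<rho>' \<le> \<rho> / 2" "\<rho>' \<le> 1" "\<rho>' \<le> s / 2"
        unfolding \<rho>'_def by (rule Min_le; simp)+
    qed
    have e\<rho>: "e * \<rho>' \<le> \<rho> / 2 - \<rho>'" using \<rho>'(2) e by (simp add: field_simps)
    obtain n :: nat where n: "inverse (real (Suc n)) < \<rho>'" "e / 2 \<le> real n" using ex_nat_large[OF \<rho>'(1)] by blast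
    show "\<exists>n. \<forall>x u v y'. near_ref \<phi> xbar (inverse (Suc n)) x u v y' \<longrightarrow>
        norm (y' - y) < inverse (Suc n) \<longrightarrow> growth_at \<phi> xbar n x u v y'"
      unfolding growth_at_def
    proof (intro exI[of _ n] allI impI)
      fix x u v y' x' and u' :: 'u
      assume nr: "near_ref \<phi> xbar (inverse (Suc n)) x u v y'" and y': "norm (y' - y) < inverse (Suc n)"
        and x': "norm (x' - xbar) < inverse (Suc n)" "norm u' < inverse (Suc n)"
      have nr': "near_ref \<phi> xbar \<rho>' x u v y'" using near_ref_mono[OF nr] n(1) by simp
      then obtain a where a: "\<phi> (x, u) = ereal a" using subdiff_finite unfolding near_ref_def by blast
      have u: "norm u < \<rho>'" using nr' unfolding near_ref_def by blast
      have eu: "norm (e *\<^sub>R u) \<le> e * \<rho>'" using u e by (simp add: mult_left_mono)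
      have "norm u * norm u \<le> \<rho>' * 1" using u \<rho>' by (intro mult_mono) auto
      then have "e / 2 * (norm u)\<^sup>2 \<le> e / 2 * \<rho>'" using e by (intro mult_left_mono) (auto simp: power2_eq_square)
      moreover have "e / 2 * \<rho>' \<le> e * \<rho>'" using e \<rho>' by simp
      moreover have "a < \<phi>b + \<rho>'" using nr' unfolding near_ref_def \<phi>b a by simp
      ultimately have "a + e / 2 * (norm u)\<^sup>2 < \<alpha>" using e\<rho> \<rho>(1,4) by linarith
      then have g1: "penalized e \<phi> (x, u) < ereal \<alpha>" using a by simp
      have g2: "(v, y' + e *\<^sub>R u) \<in> W"
      proof (rule \<rho>(3))
        show "norm v < \<rho>" using nr' \<rho>'(3) \<rho>(1) unfolding near_ref_def by linarith
        show "norm (y' + e *\<^sub>R u - y) < \<rho>"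
          using norm_triangle_ineq[of "y' - y" "e *\<^sub>R u"] eu e\<rho> y' n(1) \<rho>(1) by (simp add: algebra_simps)
      qed
      have g3: "(x, u) \<in> X" using nr' \<rho>'(3) \<rho>(1) unfolding near_ref_def by (intro \<rho>) auto
      have g4: "(x', u') \<in> X" using x' n(1) \<rho>'(3) \<rho>(1) by (intro \<rho>) auto
      have g5: "(v, y' + e *\<^sub>R u) \<in> subdiff (penalized e \<phi>) (x, u)"
        using nr' unfolding subdiff_penalized near_ref_def by simp
      have "penalized e \<phi> (x, u) + ereal ((v, y' + e *\<^sub>R u) \<bullet> ((x', u') - (x, u)) + s / 2 * (norm ((x', u') - (x, u)))\<^sup>2) \<le> penalized e \<phi> (x', u')"
        by (rule grow[rule_format, OF g3 g2 g4 g1 g5])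
      then have 1: "ereal (a + (v \<bullet> (x' - x) + y' \<bullet> (u' - u) + s / 2 * ((norm (x' - x))\<^sup>2 + (norm (u' - u))\<^sup>2)
          + (e / 2 * (norm u)\<^sup>2 - e / 2 * (norm u')\<^sup>2 + (e *\<^sub>R u) \<bullet> (u' - u)))) \<le> \<phi> (x', u')"
        using a by (cases "\<phi> (x', u')") (auto simp: norm_Pair_square inner_add_left)
      have "inverse (real (Suc n)) * (norm (x' - x))\<^sup>2 \<le> s / 2 * (norm (x' - x))\<^sup>2"
        using n(1) \<rho>'(5) by (intro mult_right_mono) auto
      moreover have "e / 2 * (norm (u' - u))\<^sup>2 \<le> real n * (norm (u' - u))\<^sup>2"
        using n(2) by (intro mult_right_mono) auto
      moreover have "s / 2 * (norm (u' - u))\<^sup>2 \<ge> 0" using s by simp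
      ultimately have "v \<bullet> (x' - x) + y' \<bullet> (u' - u) + inverse (real (Suc n)) * (norm (x' - x))\<^sup>2 - real n * (norm (u' - u))\<^sup>2
         \<le> v \<bullet> (x' - x) + y' \<bullet> (u' - u) + s / 2 * ((norm (x' - x))\<^sup>2 + (norm (u' - u))\<^sup>2)
          + (e / 2 * (norm u)\<^sup>2 - e / 2 * (norm u')\<^sup>2 + (e *\<^sub>R u) \<bullet> (u' - u))"
        unfolding completed_square distrib_left by linarith
      then show "\<phi> (x, u) + ereal (v \<bullet> (x' - x) + y' \<bullet> (u' - u) + inverse (Suc n) * (norm (x' - x))\<^sup>2 - real n * (norm (u' - u))\<^sup>2) \<le> \<phi> (x', u')"
        using 1 unfolding a plus_ereal.simps by (elim order_trans[rotated]) simp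
    qed
  qed
next
  assume "\<exists>n. uniform_growth n"
  then obtain n where n: "uniform_growth n" by blast
  define \<rho> where "\<rho> = inverse (real (Suc n))"
  \<comment> \<open>In e/2 = n + \<rho> the part n cancels the loss in u and \<rho> remains as
    growth, equal to the growth in x; hence s = 2\<rho>.\<close>
  define e where "e = 2 * real n + 2 * \<rho>"
  have \<rho>: "\<rho> > 0" by (simp add: \<rho>_def)
  have e: "e \<ge> 0" using \<rho> by (simp add: e_def)
  show "strong_variational_sufficiency \<phi> xbar"
    unfolding strong_variational_sufficiency_def variationally_strongly_convex_def
  proof (rule ballI, rule exI[of _ e], rule conjI[OF e], rule exI[of _ "2 * \<rho>"], rule conjI)
    fix y assume y: "y \<in> Y_bar \<phi> xbar"
    show "variationally_s_convex (2 * \<rho>) (penalized e \<phi>) (xbar, 0) (0, y)"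
    proof (rule variationally_s_convexI)
      have pnm: "penalized e \<phi> z \<noteq> -\<infinity>" for z
        unfolding penalized_eq using nm[of z] by (cases "\<phi> z") auto
      have "lsc (penalized e \<phi>)"
        unfolding penalized_eq by (intro lsc_add_continuous lsc nm continuous_intros)
      moreover have "proper_fun (penalized e \<phi>)" unfolding proper_fun_def
        using pnm \<phi>b by (intro conjI allI exI[of _ "(xbar, 0)"]) auto
      ultimately show "closed_proper (penalized e \<phi>)" by (simp add: closed_proper_def)
      show "(0, y) \<in> subdiff (penalized e \<phi>) (xbar, 0)"
        unfolding subdiff_penalized using y by (simp add: Y_bar_def Y_set_def)
      show "open (ball xbar \<rho> \<times> ball (0::'u) \<rho>)" "open (ball (0::'x) \<rho> \<times> (UNIV :: 'u set))"
        by (intro open_Times open_ball open_UNIV)+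
      show "penalized e \<phi> (xbar, 0) < ereal (\<phi>b + \<rho>)" using \<phi>b \<rho> by simp
    next
      fix z w z'
      assume z: "z \<in> ball xbar \<rho> \<times> ball (0::'u) \<rho>" "penalized e \<phi> z < ereal (\<phi>b + \<rho>)"
        and w: "w \<in> ball (0::'x) \<rho> \<times> (UNIV :: 'u set)" "w \<in> subdiff (penalized e \<phi>) z"
        and z': "z' \<in> ball xbar \<rho> \<times> ball (0::'u) \<rho>"
      obtain x u v y' x' u' where p: "z = (x, u)" "w = (v, y')" "z' = (x', u')" by (metis prod.exhaust)
      have sub: "(v, y' - e *\<^sub>R u) \<in> subdiff \<phi> (x, u)" using w(2) unfolding p subdiff_penalized .
      then obtain a where a: "\<phi> (x, u) = ereal a" using subdiff_finite by blast
      have "e / 2 * (norm u)\<^sup>2 \<ge> 0" using e by simp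
      then have "a < \<phi>b + \<rho>" using z(2) unfolding p by (simp add: a)
      then have "near_ref \<phi> xbar \<rho> x u v (y' - e *\<^sub>R u)"
        using z(1) w(1) sub unfolding p near_ref_def by (auto simp: \<phi>b a dist_norm norm_minus_commute)
      then have "growth_at \<phi> xbar n x u v (y' - e *\<^sub>R u)" using n unfolding uniform_growth_def \<rho>_def by blast
      then have 1: "\<phi> (x, u) + ereal (v \<bullet> (x' - x) + (y' - e *\<^sub>R u) \<bullet> (u' - u) + \<rho> * (norm (x' - x))\<^sup>2 - real n * (norm (u' - u))\<^sup>2) \<le> \<phi> (x', u')"
        using z' unfolding growth_at_def p \<rho>_def by (auto simp: dist_norm norm_minus_commute)
      have "(y' - e *\<^sub>R u) \<bullet> (u' - u) - real n * (norm (u' - u))\<^sup>2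
         = y' \<bullet> (u' - u) + \<rho> * (norm (u' - u))\<^sup>2 - (e *\<^sub>R u) \<bullet> (u' - u) - e / 2 * (norm (u' - u))\<^sup>2"
        unfolding inner_diff_left[of y'] by (simp add: e_def algebra_simps)
      also have "\<dots> = y' \<bullet> (u' - u) + \<rho> * (norm (u' - u))\<^sup>2 + (e / 2 * (norm u)\<^sup>2 - e / 2 * (norm u')\<^sup>2)"
        using completed_square[of e u u'] by linarith
      finally have "ereal (a + (v \<bullet> (x' - x) + \<rho> * (norm (x' - x))\<^sup>2 + (y' \<bullet> (u' - u) + \<rho> * (norm (u' - u))\<^sup>2 + (e / 2 * (norm u)\<^sup>2 - e / 2 * (norm u')\<^sup>2)))) \<le> \<phi> (x', u')"
        using 1 unfolding a plus_ereal.simps by (elim order_trans[rotated]) simp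
      then show "penalized e \<phi> z + ereal (w \<bullet> (z' - z) + 2 * \<rho> / 2 * (norm (z' - z))\<^sup>2) \<le> penalized e \<phi> z'"
        unfolding p by (cases "\<phi> (x', u')") (auto simp: a norm_Pair_square algebra_simps)
    qed (use \<rho> in auto)
  qed (use \<rho> in simp)
qed

section \<open>From quadratic growth to substability\<close>

lemma ex_calm:
  assumes "\<delta> > 0" "\<And>x. norm (x - xbar) \<le> \<delta> \<Longrightarrow> x \<noteq> xbar \<Longrightarrow> ereal \<phi>b < \<phi> (x, 0)"
  shows "\<exists>\<epsilon> K. calm \<phi> xbar \<phi>b \<delta> \<epsilon> K"
proof -
  obtain \<epsilon> K where \<epsilon>: "\<epsilon> > 0" and bound: "\<And>x u v y. norm (x - xbar) < \<epsilon> \<Longrightarrow> norm u < \<epsilon> \<Longrightarrow> norm v < \<epsilon> \<Longrightarrow>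
       \<phi> (x, u) < ereal (\<phi>b + \<epsilon>) \<Longrightarrow> (v, y) \<in> regular_subdiff \<phi> (x, u) \<Longrightarrow> norm y \<le> K"
    using multiplier_bound[OF lsc \<phi>b bcq] by blast
  have "calm \<phi> xbar \<phi>b \<delta> \<epsilon> K"
    by (unfold_locales; (fact lsc nm \<phi>b \<epsilon> assms bound)?)
  then show ?thesis by blast
qed

text \<open>Minimizers have multipliers, so growth holds at each of them. Between minimizers at the
  same u it gives Lipschitz dependence on v. Between different u it is played against the penalty
  inequality, which bounds only the square of the distance: continuity results, but no Lipschitz
  bound in u.\<close>

lemma growth_imp_substability:
  assumes n: "uniform_growth n"
  shows "full_substability \<phi> xbar"
proof -
  define \<rho> where "\<rho> = inverse (real (Suc n))"
  have \<rho>: "\<rho> > 0" by (simp add: \<rho>_def)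
  \<comment> \<open>Without a reference multiplier, \<open>uniform_growth\<close> would say nothing
    at (xbar, 0).\<close>
  obtain y0 where y0: "y0 \<in> Y_bar \<phi> xbar" using Y_bar_nonempty by blast
  have strict: "ereal \<phi>b < \<phi> (x, 0)" if "norm (x - xbar) < \<rho>" "x \<noteq> xbar" for x
  proof -
    have "growth_at \<phi> xbar n xbar 0 0 y0"
      using n near_ref_bar[OF y0 \<rho>] unfolding uniform_growth_def \<rho>_def by blast
    then have "\<phi> (xbar, 0) + ereal (0 \<bullet> (x - xbar) + y0 \<bullet> (0 - 0) + \<rho> * (norm (x - xbar))\<^sup>2 - real n * (norm (0 - 0 :: 'u))\<^sup>2) \<le> \<phi> (x, 0)"
      using that \<rho> unfolding growth_at_def \<rho>_def by (metis norm_zero)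
    then have "ereal (\<phi>b + \<rho> * (norm (x - xbar))\<^sup>2) \<le> \<phi> (x, 0)" using \<phi>b by simp
    moreover have "\<rho> * (norm (x - xbar))\<^sup>2 > 0" using \<rho> that by simp
    then have "ereal \<phi>b < ereal (\<phi>b + \<rho> * (norm (x - xbar))\<^sup>2)" by simp
    ultimately show ?thesis by (rule order_less_le_trans[rotated])
  qed
  show ?thesis
    unfolding full_substability_def
  proof (rule exI[of _ \<rho>], rule conjI[OF \<rho>], intro allI impI)
    fix \<delta> assume \<delta>: "0 < \<delta> \<and> \<delta> < \<rho>"
    then have "\<exists>\<epsilon> K. calm \<phi> xbar \<phi>b \<delta> \<epsilon> K" by (intro ex_calm strict) auto
    then obtain \<epsilon> K where "calm \<phi> xbar \<phi>b \<delta> \<epsilon> K" by blast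
    then interpret c: calm \<phi> xbar \<phi>b \<delta> \<epsilon> K .
    obtain \<theta>0 K' where box0: "c.stable_box \<theta>0 K'" using c.ex_stable_box by blast
    obtain \<theta>1 where \<theta>1: "\<theta>1 > 0" "\<And>v u x. norm v \<le> \<theta>1 \<Longrightarrow> norm u \<le> \<theta>1 \<Longrightarrow> x \<in> M_delta \<phi> xbar \<delta> v u \<Longrightarrow>
      norm (x - xbar) < \<rho> \<and> \<phi> (x, u) < ereal (\<phi>b + \<rho>)" using c.minimizers_near[OF \<rho>] by blast
    define \<theta> where "\<theta> = min (min \<theta>0 \<theta>1) \<rho>"
    have \<theta>: "\<theta> > 0" "\<theta> \<le> \<theta>0" "\<theta> \<le> \<theta>1" "\<theta> \<le> \<rho>"
      unfolding \<theta>_def using box0 \<theta>1 \<rho> by (auto simp: c.stable_box_def)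
    have box: "c.stable_box \<theta> K'" by (rule c.stable_box_mono[OF box0 \<theta>(1,2)])
    then have K': "K' \<ge> 0" by (simp add: c.stable_box_def)
    define N where "N = ball (0::'x) \<theta> \<times> ball (0::'u) \<theta>"
    have N: "(v, u) \<in> N \<longleftrightarrow> norm v < \<theta> \<and> norm u < \<theta>" for v u by (auto simp: N_def)
    have near: "norm (x - xbar) < \<delta>" if "x \<in> M_delta \<phi> xbar \<delta> v u" for x v u
      using that unfolding M_delta_iff[OF nm] by simp
    have pt: "\<exists>y a. \<phi> (x, u) = ereal a \<and> (\<forall>x' u'. norm (x' - xbar) < \<rho> \<longrightarrow> norm u' < \<rho> \<longrightarrow>
        ereal (a + v \<bullet> (x' - x) + y \<bullet> (u' - u) + \<rho> * (norm (x' - x))\<^sup>2 - real n * (norm (u' - u))\<^sup>2) \<le> \<phi> (x', u'))"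
      if vu: "(v, u) \<in> N" and x: "x \<in> M_delta \<phi> xbar \<delta> v u" for v u x
    proof -
      obtain y where y: "(v, y) \<in> subdiff \<phi> (x, u)" using c.minimizer_multiplier[OF box _ _ x] vu N by blast
      obtain a where a: "\<phi> (x, u) = ereal a" using subdiff_finite[OF y] by blast
      have "near_ref \<phi> xbar \<rho> x u v y"
        using y \<theta>1(2)[OF _ _ x] vu \<theta> N \<phi>b by (auto simp: near_ref_def)
      then have "growth_at \<phi> xbar n x u v y" using n unfolding uniform_growth_def \<rho>_def by blast
      then show ?thesis unfolding growth_at_def \<rho>_def a plus_ereal.simps
        by (intro exI[of _ y] exI[of _ a]) (simp add: add.assoc add_diff_eq)
    qed
    \<comment> \<open>With equal u all terms in u drop out of the two growth inequalities, and their
      sum is strong monotonicity. Taking v = v' also gives uniqueness.\<close>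
    have pair: "\<rho> * norm (x' - x) \<le> norm (v' - v)"
      if vu: "(v, u) \<in> N" "(v', u) \<in> N" and x: "x \<in> M_delta \<phi> xbar \<delta> v u" "x' \<in> M_delta \<phi> xbar \<delta> v' u" for v v' u x x'
    proof -
      obtain y a where a: "\<phi> (x, u) = ereal a" "\<And>x' u'. norm (x' - xbar) < \<rho> \<Longrightarrow> norm u' < \<rho> \<Longrightarrow>
        ereal (a + v \<bullet> (x' - x) + y \<bullet> (u' - u) + \<rho> * (norm (x' - x))\<^sup>2 - real n * (norm (u' - u))\<^sup>2) \<le> \<phi> (x', u')"
        using pt[OF vu(1) x(1)] by blast
      obtain y' a' where a': "\<phi> (x', u) = ereal a'" "\<And>x1 u'. norm (x1 - xbar) < \<rho> \<Longrightarrow> norm u' < \<rho> \<Longrightarrow>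
        ereal (a' + v' \<bullet> (x1 - x') + y' \<bullet> (u' - u) + \<rho> * (norm (x1 - x'))\<^sup>2 - real n * (norm (u' - u))\<^sup>2) \<le> \<phi> (x1, u')"
        using pt[OF vu(2) x(2)] by blast
      have u: "norm u < \<rho>" using vu N \<theta> by auto
      have "a + v \<bullet> (x' - x) + \<rho> * (norm (x' - x))\<^sup>2 \<le> a'"
        using a(2)[of x' u] near[OF x(2)] \<delta> u a' by simp
      moreover have "a' + v' \<bullet> (x - x') + \<rho> * (norm (x' - x))\<^sup>2 \<le> a"
        using a'(2)[of x u] near[OF x(1)] \<delta> u a by (simp add: norm_minus_commute)
      ultimately have "2 * (\<rho> * (norm (x' - x))\<^sup>2) \<le> (v' - v) \<bullet> (x' - x)"
        by (simp add: inner_diff_left inner_diff_right)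
      moreover have "\<rho> * (norm (x' - x))\<^sup>2 \<ge> 0" using \<rho> by simp
      ultimately have "\<rho> * (norm (x' - x))\<^sup>2 \<le> norm (v' - v) * norm (x' - x)"
        using norm_cauchy_schwarz[of "v' - v" "x' - x"] by linarith
      then have "norm (x' - x) * (\<rho> * norm (x' - x)) \<le> norm (x' - x) * norm (v' - v)"
        by (simp add: power2_eq_square algebra_simps)
      then show ?thesis by (cases "x' = x") (auto simp: mult_le_cancel_left)
    qed
    define F where "F v u = the_elem (M_delta \<phi> xbar \<delta> v u)" for v u
    have single: "M_delta \<phi> xbar \<delta> v u = {F v u}" if vu: "(v, u) \<in> N" for v u
    proof -
      obtain x where x: "x \<in> M_delta \<phi> xbar \<delta> v u" using box vu N unfolding c.stable_box_def by blast
      have "x' = x" if "x' \<in> M_delta \<phi> xbar \<delta> v u" for x'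
        using pair[OF vu vu x that] \<rho> by (simp add: mult_le_0_iff)
      then have "M_delta \<phi> xbar \<delta> v u = {x}" using x by blast
      then show ?thesis by (simp add: F_def)
    qed
    have cont: "continuous_on N (\<lambda>(v, u). F v u)"
      unfolding continuous_on_def
    proof
      fix p assume "p \<in> N"
      then obtain v u where p: "p = (v, u)" "(v, u) \<in> N" by (cases p) auto
      have x: "F v u \<in> M_delta \<phi> xbar \<delta> v u" using single p by blast
      obtain y a where a: "\<phi> (F v u, u) = ereal a" "\<And>x' u'. norm (x' - xbar) < \<rho> \<Longrightarrow> norm u' < \<rho> \<Longrightarrow>
        ereal (a + v \<bullet> (x' - F v u) + y \<bullet> (u' - u) + \<rho> * (norm (x' - F v u))\<^sup>2 - real n * (norm (u' - u))\<^sup>2) \<le> \<phi> (x', u')"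
        using pt[OF p(2) x] by blast
      \<comment> \<open>The factor 2\<delta> bounds the distance between the minimizers, K' comes
        from the penalty inequality, and |y| and n from the linear and quadratic parts of the growth
        in u.\<close>
      define R where "R q = (2 * \<delta> * norm (fst q - v) + (K' + norm y) * norm (snd q - u) + real n * (norm (snd q - u))\<^sup>2) / \<rho>" for q
      have bound: "(norm (F v' u' - F v u))\<^sup>2 \<le> R (v', u')" if vu': "(v', u') \<in> N" for v' u'
      proof -
        have x': "F v' u' \<in> M_delta \<phi> xbar \<delta> v' u'" using single vu' by blast
        obtain a' where a': "\<phi> (F v' u', u') = ereal a'" using pt[OF vu' x'] by blast
        have "a' + v' \<bullet> (F v u - F v' u') - K' * norm (u - u') \<le> a"
          using c.minimizer_penalty[OF box _ _ x' a', of "F v u" u] near[OF x] vu' p(2) a(1) N by simp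
        moreover have "a + v \<bullet> (F v' u' - F v u) + y \<bullet> (u' - u) + \<rho> * (norm (F v' u' - F v u))\<^sup>2 - real n * (norm (u' - u))\<^sup>2 \<le> a'"
          using a(2)[of "F v' u'" u'] near[OF x'] \<delta> vu' \<theta> N a' by auto
        ultimately have "\<rho> * (norm (F v' u' - F v u))\<^sup>2 \<le> (v' - v) \<bullet> (F v' u' - F v u) + K' * norm (u' - u) - y \<bullet> (u' - u) + real n * (norm (u' - u))\<^sup>2"
          by (simp add: inner_diff_left inner_diff_right norm_minus_commute)
        moreover have "(v' - v) \<bullet> (F v' u' - F v u) \<le> 2 * \<delta> * norm (v' - v)"
        proof -
          have "norm (F v' u' - F v u) \<le> 2 * \<delta>"
            using norm_triangle_ineq4[of "F v' u' - xbar" "F v u - xbar"] near[OF x] near[OF x'] by simp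
          then have "norm (v' - v) * norm (F v' u' - F v u) \<le> norm (v' - v) * (2 * \<delta>)" by (intro mult_left_mono) auto
          then show ?thesis using norm_cauchy_schwarz[of "v' - v" "F v' u' - F v u"] by (simp add: mult.commute)
        qed
        moreover have "- (y \<bullet> (u' - u)) \<le> norm y * norm (u' - u)"
          using norm_cauchy_schwarz[of "- y" "u' - u"] by simp
        ultimately have "\<rho> * (norm (F v' u' - F v u))\<^sup>2 \<le> 2 * \<delta> * norm (v' - v) + (K' + norm y) * norm (u' - u) + real n * (norm (u' - u))\<^sup>2"
          unfolding distrib_right by linarith
        then show ?thesis unfolding R_def using \<rho> by (simp add: pos_le_divide_eq mult.commute)
      qed
      have "((\<lambda>q. sqrt (R q)) \<longlongrightarrow> sqrt (R p)) (at p within N)"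
        unfolding R_def by (intro tendsto_intros) (use \<rho> in auto)
      moreover have "R p = 0" by (simp add: R_def p)
      ultimately have R0: "((\<lambda>q. sqrt (R q)) \<longlongrightarrow> 0) (at p within N)" by simp
      have "((\<lambda>q. (case q of (v, u) \<Rightarrow> F v u) - F v u) \<longlongrightarrow> 0) (at p within N)"
      proof (rule Lim_null_comparison[OF _ R0])
        have "norm ((case q of (v, u) \<Rightarrow> F v u) - F v u) \<le> sqrt (R q)" if "q \<in> N" for q
          using that bound by (cases q) (auto intro!: real_le_rsqrt)
        then show "\<forall>\<^sub>F q in at p within N. norm ((case q of (v, u) \<Rightarrow> F v u) - F v u) \<le> sqrt (R q)"
          by (auto simp: eventually_at_filter)
      qed
      then show "((\<lambda>(v, u). F v u) \<longlongrightarrow> (case p of (v, u) \<Rightarrow> F v u)) (at p within N)"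
        by (simp add: p split_def LIM_zero_cancel)
    qed
    have mlip: "(\<delta> + K')-lipschitz_on N (\<lambda>(v, u). real_of_ereal (m_delta \<phi> xbar \<delta> v u))"
      unfolding N_def by (rule c.m_delta_lipschitz[OF box])
    show "M_delta \<phi> xbar \<delta> 0 0 = {xbar} \<and>
        (\<exists>N. open N \<and> (0, 0) \<in> N \<and>
           (\<forall>(v, u)\<in>N. is_singleton (M_delta \<phi> xbar \<delta> v u)) \<and>
           continuous_on N (\<lambda>(v, u). the_elem (M_delta \<phi> xbar \<delta> v u)) \<and>
           continuous_on N (\<lambda>(v, u). real_of_ereal (m_delta \<phi> xbar \<delta> v u)) \<and>
           (\<exists>L. \<forall>u. L-lipschitz_on {v. (v, u) \<in> N} (\<lambda>v. the_elem (M_delta \<phi> xbar \<delta> v u))) \<and>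
           (\<exists>L. \<forall>u. L-lipschitz_on {v. (v, u) \<in> N} (\<lambda>v. real_of_ereal (m_delta \<phi> xbar \<delta> v u))))"
    proof (rule conjI[OF c.M_delta_reference], rule exI[of _ N], intro conjI)
      show "open N" unfolding N_def by (intro open_Times open_ball)
      show "(0, 0) \<in> N" using N \<theta> by simp
      show "\<forall>(v, u)\<in>N. is_singleton (M_delta \<phi> xbar \<delta> v u)" using single by (auto simp: is_singleton_def)
      show "continuous_on N (\<lambda>(v, u). the_elem (M_delta \<phi> xbar \<delta> v u))" using cont by (simp add: F_def)
      show "continuous_on N (\<lambda>(v, u). real_of_ereal (m_delta \<phi> xbar \<delta> v u))"
        using mlip by (rule lipschitz_on_continuous_on)
      show "\<exists>L. \<forall>u. L-lipschitz_on {v. (v, u) \<in> N} (\<lambda>v. the_elem (M_delta \<phi> xbar \<delta> v u))"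
      proof (rule exI[of _ "1 / \<rho>"], intro allI lipschitz_onI)
        fix u v v' assume "v \<in> {v. (v, u) \<in> N}" "v' \<in> {v. (v, u) \<in> N}"
        then have *: "(v, u) \<in> N" "(v', u) \<in> N" by auto
        then have "\<rho> * norm (F v u - F v' u) \<le> norm (v - v')"
          using single by (intro pair[OF *(2,1)]) auto
        then show "dist (the_elem (M_delta \<phi> xbar \<delta> v u)) (the_elem (M_delta \<phi> xbar \<delta> v' u)) \<le> 1 / \<rho> * dist v v'"
          using \<rho> by (simp add: F_def dist_norm field_simps)
      qed (use \<rho> in simp)
      show "\<exists>L. \<forall>u. L-lipschitz_on {v. (v, u) \<in> N} (\<lambda>v. real_of_ereal (m_delta \<phi> xbar \<delta> v u))"
      proof (rule exI[of _ "\<delta> + K'"], intro allI lipschitz_onI)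
        fix u v v' assume *: "v \<in> {v. (v, u) \<in> N}" "v' \<in> {v. (v, u) \<in> N}"
        show "dist (real_of_ereal (m_delta \<phi> xbar \<delta> v u)) (real_of_ereal (m_delta \<phi> xbar \<delta> v' u)) \<le> (\<delta> + K') * dist v v'"
          using lipschitz_onD[OF mlip, of "(v, u)" "(v', u)"] * by (simp add: dist_Pair_Pair)
      qed (use \<delta> K' in simp)
    qed
  qed
qed

text \<open>If \<open>v\<close> is a proximal subgradient of \<open>\<phi>(\<cdot>, u)\<close> at \<open>x\<close>, one looks for \<open>w\<close> with
  \<open>F w u = x - (w - v) / \<kappa>\<close>; it exists since this is the optimality condition for minimizing
  the strongly convex function \<open>G\<close>. Optimality of \<open>F w u\<close> for \<open>w\<close> and the proximal inequality
  at \<open>x\<close> then force \<open>F w u = x\<close>, hence \<open>w = v\<close>.\<close>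

lemma subgradient_imp_minimizer:
  assumes calm: "calm \<phi> xbar \<phi>b \<delta> \<epsilon> K" and n: "uniform_prox n" and \<theta>: "\<theta> > 0"
    and single: "\<And>v u. norm v < \<theta> \<Longrightarrow> norm u < \<theta> \<Longrightarrow> M_delta \<phi> xbar \<delta> v u = {F v u}"
    and cont: "\<And>u. norm u < \<theta> \<Longrightarrow> continuous_on (ball 0 \<theta>) (\<lambda>v. F v u)"
  shows "\<exists>\<rho>>0. \<forall>x u v y. near_ref \<phi> xbar \<rho> x u v y \<longrightarrow> M_delta \<phi> xbar \<delta> v u = {x}"
proof -
  interpret c: calm \<phi> xbar \<phi>b \<delta> \<epsilon> K by (rule calm)
  obtain \<theta>0 K' where box: "c.stable_box \<theta>0 K'" using c.ex_stable_box by blast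
  then have \<theta>0: "\<theta>0 > 0" by (simp add: c.stable_box_def)
  \<comment> \<open>Any number above the prox constant n would do: the final comparison gives
    (\<kappa> - n) |F w u - x|^2 \<le> 0.\<close>
  define \<kappa> where "\<kappa> = real n + 1"
  have \<kappa>: "\<kappa> \<ge> 1" "\<kappa> > 0" by (auto simp: \<kappa>_def)
  have in0: "inverse (real (Suc n)) > 0" by simp
  obtain \<theta>1 where \<theta>1: "\<theta>1 > 0" "\<And>v u x. norm v \<le> \<theta>1 \<Longrightarrow> norm u \<le> \<theta>1 \<Longrightarrow> x \<in> M_delta \<phi> xbar \<delta> v u \<Longrightarrow>
      norm (x - xbar) < inverse (Suc n)" using c.minimizers_near[OF in0] by blast
  define \<eta> where "\<eta> = min (min \<theta> \<theta>0) \<theta>1 / 2"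
  have \<eta>: "\<eta> > 0" "\<eta> < \<theta>" "\<eta> < \<theta>0" "\<eta> \<le> \<theta>1"
    unfolding \<eta>_def using \<theta> \<theta>0 \<theta>1 by auto
  have "\<eta> / (8 * \<kappa>) > 0" using \<eta> \<kappa> by simp
  from c.minimizers_near[OF this] obtain \<theta>2 where \<theta>2: "\<theta>2 > 0" "\<And>v u x. norm v \<le> \<theta>2 \<Longrightarrow> norm u \<le> \<theta>2 \<Longrightarrow> x \<in> M_delta \<phi> xbar \<delta> v u \<Longrightarrow>
      norm (x - xbar) < \<eta> / (8 * \<kappa>)" by blast
  define \<rho> where "\<rho> = Min {inverse (real (Suc n)), \<theta>2, \<eta> / (8 * \<kappa>), \<delta>, \<eta> / 8}"
  have \<rho>: "\<rho> > 0" "\<rho> \<le> inverse (real (Suc n))" "\<rho> \<le> \<theta>2" "\<rho> \<le> \<eta> / (8 * \<kappa>)" "\<rho> \<le> \<delta>" "\<rho> \<le> \<eta> / 8"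
  proof -
    show "\<rho> > 0" unfolding \<rho>_def using \<theta>2 \<eta> \<kappa> c.\<delta> by auto
    show "\<rho> \<le> inverse (real (Suc n))" "\<rho> \<le> \<theta>2" "\<rho> \<le> \<eta> / (8 * \<kappa>)" "\<rho> \<le> \<delta>" "\<rho> \<le> \<eta> / 8"
      unfolding \<rho>_def by (rule Min_le; simp)+
  qed
  have "M_delta \<phi> xbar \<delta> v u = {x}" if nr: "near_ref \<phi> xbar \<rho> x u v y" for x u v y
  proof -
    have x: "norm (x - xbar) < \<rho>" and u: "norm u < \<rho>" and v: "norm v < \<rho>" and sub: "(v, y) \<in> subdiff \<phi> (x, u)"
      using nr by (auto simp: near_ref_def)
    have u\<eta>: "norm u < \<eta>" and v\<eta>: "norm v < \<eta>" using u v \<rho>(6) \<eta>(1) by auto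
    obtain a where a: "\<phi> (x, u) = ereal a" using subdiff_finite[OF sub] by blast
    have FM: "F w u \<in> M_delta \<phi> xbar \<delta> w u" if "norm w \<le> \<eta>" for w
      using single[of w u] that u\<eta> \<eta> by auto
    have near: "norm (F w u - xbar) < \<delta>" if "norm w \<le> \<eta>" for w
      using FM[OF that] unfolding M_delta_iff[OF nm] by simp
    define m where "m w = real_of_ereal (m_delta \<phi> xbar \<delta> w u)" for w
    have val: "\<exists>b. \<phi> (F w u, u) = ereal b \<and> m w = b - w \<bullet> (F w u - xbar) \<and>
       (\<forall>x'. norm (x' - xbar) < \<delta> \<longrightarrow> ereal (b + w \<bullet> (x' - F w u)) \<le> \<phi> (x', u))" if w: "norm w \<le> \<eta>" for w
    proof -
      obtain b where b: "\<phi> (F w u, u) = ereal b" "\<forall>x'. norm (x' - xbar) < \<delta> \<longrightarrow> ereal (b + w \<bullet> (x' - F w u)) \<le> \<phi> (x', u)"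
        using FM[OF w] unfolding M_delta_iff[OF nm] by blast
      have "m w = b - w \<bullet> (F w u - xbar)" unfolding m_def m_delta_eq[OF FM[OF w] b(1)] by simp
      then show ?thesis using b by blast
    qed
    \<comment> \<open>As an infimum of affine functions of w, m is concave, and xbar - F w u is a
      supergradient.\<close>
    have up: "m w' \<le> m w - (w' - w) \<bullet> (F w u - xbar)" if w: "norm w \<le> \<eta>" and w': "norm w' \<le> \<eta>" for w w'
    proof -
      obtain b where b: "\<phi> (F w u, u) = ereal b" "m w = b - w \<bullet> (F w u - xbar)" using val[OF w] by blast
      obtain b' where b': "m w' = b' - w' \<bullet> (F w' u - xbar)" "ereal (b' + w' \<bullet> (F w u - F w' u)) \<le> \<phi> (F w u, u)"
        using val[OF w'] near[OF w] by blast
      show ?thesis using b b' by (simp add: inner_diff_left inner_diff_right)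
    qed
    \<comment> \<open>Formally the gradient of G is F w u - x + (w - v)/\<kappa>, so stationarity of
      G is the desired equation.\<close>
    define G where "G w = - m w - w \<bullet> (x - xbar) + (norm (w - v))\<^sup>2 / (2 * \<kappa>)" for w
    have "continuous_on (ball 0 \<theta>0 \<times> ball 0 \<theta>0) (\<lambda>(v, u). real_of_ereal (m_delta \<phi> xbar \<delta> v u))"
      using c.m_delta_lipschitz[OF box] by (rule lipschitz_on_continuous_on)
    then have "continuous_on (cball 0 \<eta>) (\<lambda>w. (\<lambda>(v, u). real_of_ereal (m_delta \<phi> xbar \<delta> v u)) (w, u))"
      by (rule continuous_on_compose2) (use \<eta> u\<eta> in \<open>auto intro!: continuous_intros\<close>)
    then have "continuous_on (cball 0 \<eta>) m" by (simp add: m_def[abs_def])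
    then have contG: "continuous_on (cball 0 \<eta>) G" unfolding G_def
      by (intro continuous_intros) (use \<kappa> in auto)
    have "\<exists>w\<in>cball 0 \<eta>. \<forall>w'\<in>cball 0 \<eta>. G w \<le> G w'"
      by (rule continuous_attains_inf[OF compact_cball _ contG]) (use \<eta> in auto)
    then obtain w where w: "norm w \<le> \<eta>" and min: "\<And>w'. norm w' \<le> \<eta> \<Longrightarrow> G w \<le> G w'" by auto
    \<comment> \<open>Comparison with w = 0: on the boundary the quadratic term costs at least
      3\<eta>^2/(8\<kappa>), while the closeness of x, F 0 u and v to their reference values lets
      the rest gain at most \<eta>^2/(4\<kappa>).\<close>
    have wint: "norm w < \<eta>"
    proof (rule ccontr)
      assume "\<not> norm w < \<eta>"
      then have nw: "norm w = \<eta>" using w by simp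
      have F0: "norm (F 0 u - xbar) < \<eta> / (8 * \<kappa>)"
        using \<theta>2(2)[of 0 u "F 0 u"] FM[of 0] \<eta>(1) \<theta>2(1) u \<rho>(3) by simp
      then have "norm (F 0 u - x) < \<eta> / (8 * \<kappa>) + \<eta> / (8 * \<kappa>)"
        using x \<rho>(4) norm_triangle_ineq4[of "F 0 u - xbar" "x - xbar"] by simp
      then have Fx: "norm (F 0 u - x) < \<eta> / (4 * \<kappa>)" by (simp add: field_simps)
      have "- (w \<bullet> (F 0 u - x)) \<le> \<eta> * (\<eta> / (4 * \<kappa>))"
      proof -
        have "- (w \<bullet> (F 0 u - x)) \<le> norm w * norm (F 0 u - x)"
          using norm_cauchy_schwarz[of "- w" "F 0 u - x"] by simp
        also have "\<dots> \<le> \<eta> * (\<eta> / (4 * \<kappa>))" unfolding nw using Fx \<eta>(1) by (intro mult_left_mono) auto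
        finally show ?thesis .
      qed
      moreover have "w \<bullet> v \<le> \<eta> * (\<eta> / 8)"
      proof -
        have "w \<bullet> v \<le> norm w * norm v" by (rule norm_cauchy_schwarz)
        also have "\<dots> \<le> \<eta> * (\<eta> / 8)" unfolding nw using v \<rho>(6) \<eta>(1) by (intro mult_left_mono) auto
        finally show ?thesis .
      qed
      moreover have "G w \<le> G 0" using min[of 0] \<eta>(1) by simp
      then have "w \<bullet> (F 0 u - x) + ((norm (w - v))\<^sup>2 - (norm v)\<^sup>2) / (2 * \<kappa>) \<le> 0"
        using up[of 0 w] w \<eta>(1) unfolding G_def by (simp add: inner_diff_right diff_divide_distrib)
      moreover have "(norm (w - v))\<^sup>2 - (norm v)\<^sup>2 = \<eta>\<^sup>2 - 2 * (w \<bullet> v)"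
        unfolding nw[symmetric] power2_norm_eq_inner by (simp add: inner_diff_left inner_diff_right inner_commute)
      ultimately have 1: "(\<eta>\<^sup>2 - 2 * (w \<bullet> v)) / (2 * \<kappa>) \<le> \<eta> * (\<eta> / (4 * \<kappa>))" "w \<bullet> v \<le> \<eta> * (\<eta> / 8)" by auto
      have "(\<eta>\<^sup>2 - 2 * (\<eta> * (\<eta> / 8))) / (2 * \<kappa>) \<le> (\<eta>\<^sup>2 - 2 * (w \<bullet> v)) / (2 * \<kappa>)"
        using 1(2) \<kappa> by (intro divide_right_mono) auto
      then have "(\<eta>\<^sup>2 - 2 * (\<eta> * (\<eta> / 8))) / (2 * \<kappa>) \<le> \<eta> * (\<eta> / (4 * \<kappa>))" using 1(1) by linarith
      then have "\<eta>\<^sup>2 \<le> 0" using \<kappa> by (simp add: field_simps power2_eq_square)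
      then show False using \<eta>(1) by simp
    qed
    define e where "e = F w u - x + (1 / \<kappa>) *\<^sub>R (w - v)"
    \<comment> \<open>Differentiability of m is not at hand. Minimality is tested at w - t e
      instead, with the supergradient taken at that point, and continuity of F in v gives the
      inequality as t decreases to 0.\<close>
    have "e \<bullet> e \<le> 0"
    proof -
      have ineq: "e \<bullet> (F (w - t *\<^sub>R e) u - x + (1 / \<kappa>) *\<^sub>R (w - v)) \<le> t * (norm e)\<^sup>2 / (2 * \<kappa>)"
        if t: "t > 0" "norm (w - t *\<^sub>R e) \<le> \<eta>" for t
      proof -
        define w' where "w' = w - t *\<^sub>R e"
        have "m w \<le> m w' - (w - w') \<bullet> (F w' u - xbar)" using up[OF _ w, of w'] t(2) by (simp add: w'_def)
        moreover have "G w \<le> G w'" using min t(2) by (simp add: w'_def)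
        ultimately have 2: "(w - w') \<bullet> (F w' u - x) \<le> ((norm (w' - v))\<^sup>2 - (norm (w - v))\<^sup>2) / (2 * \<kappa>)"
          unfolding G_def by (simp add: inner_diff_left inner_diff_right diff_divide_distrib)
        have "(norm (w' - v))\<^sup>2 - (norm (w - v))\<^sup>2 = t\<^sup>2 * (norm e)\<^sup>2 - 2 * t * (e \<bullet> (w - v))"
          unfolding w'_def power2_norm_eq_inner
          by (simp add: inner_diff_left inner_diff_right inner_commute algebra_simps power2_eq_square)
        then have "t * (e \<bullet> (F w' u - x)) \<le> (t\<^sup>2 * (norm e)\<^sup>2 - 2 * t * (e \<bullet> (w - v))) / (2 * \<kappa>)"
          using 2 by (simp add: w'_def)
        also have "\<dots> = t * (t * (norm e)\<^sup>2 / (2 * \<kappa>) - (e \<bullet> (w - v)) / \<kappa>)"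
          using \<kappa> by (simp add: field_simps power2_eq_square)
        finally have "e \<bullet> (F w' u - x) \<le> t * (norm e)\<^sup>2 / (2 * \<kappa>) - (e \<bullet> (w - v)) / \<kappa>"
          using t(1) by (simp add: mult_le_cancel_left)
        then show ?thesis unfolding w'_def by (simp add: inner_add_right)
      qed
      have lim: "((\<lambda>t. w - t *\<^sub>R e) \<longlongrightarrow> w) (at_right (0::real))"
      proof -
        have "((\<lambda>t. w - t *\<^sub>R e) \<longlongrightarrow> w - 0 *\<^sub>R e) (at_right (0::real))" by (intro tendsto_intros)
        then show ?thesis by simp
      qed
      have "continuous_on (ball 0 \<theta>) (\<lambda>v. F v u)" using cont u\<eta> \<eta> by simp
      then have "isCont (\<lambda>v. F v u) w" using w \<eta>
        by (simp add: continuous_on_eq_continuous_at)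
      then have "((\<lambda>t. F (w - t *\<^sub>R e) u) \<longlongrightarrow> F w u) (at_right (0::real))"
        using lim by (rule isCont_tendsto_compose)
      then have "((\<lambda>t. e \<bullet> (F (w - t *\<^sub>R e) u - x + (1 / \<kappa>) *\<^sub>R (w - v))) \<longlongrightarrow> e \<bullet> (F w u - x + (1 / \<kappa>) *\<^sub>R (w - v))) (at_right 0)"
        by (intro tendsto_intros)
      moreover have "((\<lambda>t. t * (norm e)\<^sup>2 / (2 * \<kappa>)) \<longlongrightarrow> 0 * (norm e)\<^sup>2 / (2 * \<kappa>)) (at_right (0::real))"
        by (intro tendsto_intros) (use \<kappa> in auto)
      moreover have "\<forall>\<^sub>F t in at_right (0::real). e \<bullet> (F (w - t *\<^sub>R e) u - x + (1 / \<kappa>) *\<^sub>R (w - v)) \<le> t * (norm e)\<^sup>2 / (2 * \<kappa>)"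
      proof -
        have "((\<lambda>t. norm (w - t *\<^sub>R e)) \<longlongrightarrow> norm w) (at_right (0::real))" using lim by (rule tendsto_norm)
        then have "\<forall>\<^sub>F t in at_right (0::real). norm (w - t *\<^sub>R e) < \<eta>" using wint by (rule order_tendstoD)
        moreover have "\<forall>\<^sub>F t in at_right (0::real). t > 0" by (rule eventually_at_right_less)
        ultimately show ?thesis by eventually_elim (rule ineq; simp)
      qed
      ultimately have "e \<bullet> (F w u - x + (1 / \<kappa>) *\<^sub>R (w - v)) \<le> 0 * (norm e)\<^sup>2 / (2 * \<kappa>)"
        by (intro tendsto_le[OF trivial_limit_at_right_real])
      then show ?thesis by (simp add: e_def)
    qed
    then have "e = 0" using inner_ge_zero[of e] inner_eq_zero_iff[of e] by linarith
    then have "(1 / \<kappa>) *\<^sub>R (w - v) = x - F w u" by (simp add: e_def algebra_simps)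
    then have "\<kappa> *\<^sub>R ((1 / \<kappa>) *\<^sub>R (w - v)) = \<kappa> *\<^sub>R (x - F w u)" by simp
    \<comment> \<open>Optimality of F w u for this w is now compared, at x, with the proximal
      inequality of v at x; both are at the same u, so y drops out.\<close>
    then have wv: "w = v + \<kappa> *\<^sub>R (x - F w u)" using \<kappa> by (simp add: algebra_simps)
    obtain b where b: "\<phi> (F w u, u) = ereal b" "ereal (b + w \<bullet> (x - F w u)) \<le> \<phi> (x, u)"
      using val[OF w] order_less_le_trans[OF x \<rho>(5)] by blast
    have "prox_at \<phi> xbar n x u v y"
      using n near_ref_mono[OF nr \<rho>(2)] unfolding uniform_prox_def by blast
    moreover have "norm (F w u - xbar) < inverse (Suc n)"
      using \<theta>1(2)[OF _ _ FM[OF w]] w \<eta> u\<eta> by simp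
    moreover have "norm u < inverse (Suc n)" using u \<rho>(2) by linarith
    ultimately have "\<phi> (x, u) + ereal (v \<bullet> (F w u - x) + y \<bullet> (u - u) - real n * ((norm (F w u - x))\<^sup>2 + (norm (u - u))\<^sup>2)) \<le> \<phi> (F w u, u)"
      unfolding prox_at_def by blast
    then have "a + v \<bullet> (F w u - x) - real n * (norm (F w u - x))\<^sup>2 \<le> b" using a b(1) by simp
    moreover have "b + w \<bullet> (x - F w u) \<le> a" using b(2) a by simp
    moreover have "w \<bullet> (x - F w u) = v \<bullet> (x - F w u) + \<kappa> * (norm (F w u - x))\<^sup>2"
      by (subst wv) (simp add: inner_add_left power2_norm_eq_inner[symmetric] norm_minus_commute)
    ultimately have "(\<kappa> - real n) * (norm (F w u - x))\<^sup>2 \<le> 0"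
      by (simp add: inner_diff_right algebra_simps)
    then have "F w u = x" by (simp add: \<kappa>_def)
    then have "w = v" using wv by simp
    then show ?thesis using \<open>F w u = x\<close> single[of v u] v\<eta> u\<eta> \<eta> by simp
  qed
  then show ?thesis using \<rho>(1) by blast
qed

text \<open>A competitor x with value at most \<open>\<phi>b\<close> would also be a minimizer on an
  open ball of radius between its distance to \<open>xbar\<close> and \<delta>0, against uniqueness
  there.\<close>

lemma strict_of_singleton:
  assumes M: "\<And>\<delta>. 0 < \<delta> \<Longrightarrow> \<delta> < \<delta>0 \<Longrightarrow> M_delta \<phi> xbar \<delta> 0 0 = {xbar}"
    and x: "norm (x - xbar) < \<delta>0" "x \<noteq> xbar"
  shows "ereal \<phi>b < \<phi> (x, 0)"
proof (rule ccontr)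
  assume neg: "\<not> ereal \<phi>b < \<phi> (x, 0)"
  obtain \<delta> where \<delta>: "norm (x - xbar) < \<delta>" "\<delta> < \<delta>0" using dense x(1) by blast
  then have "\<delta> > 0" using norm_ge_zero[of "x - xbar"] by linarith
  then have M': "M_delta \<phi> xbar \<delta> 0 0 = {xbar}" using M \<delta> by blast
  then have "xbar \<in> M_delta \<phi> xbar \<delta> 0 0" by simp
  then obtain a where a: "\<phi> (xbar, 0) = ereal a" "\<And>x'. norm (x' - xbar) < \<delta> \<Longrightarrow> ereal (a + 0 \<bullet> (x' - xbar)) \<le> \<phi> (x', 0)"
    unfolding M_delta_iff[OF nm] by blast
  then have le: "ereal \<phi>b \<le> \<phi> (x', 0)" if "norm (x' - xbar) < \<delta>" for x' using that \<phi>b by simp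
  have "\<phi> (x, 0) = ereal \<phi>b" using neg le[OF \<delta>(1)] by (simp add: antisym)
  then have "x \<in> M_delta \<phi> xbar \<delta> 0 0" unfolding M_delta_iff[OF nm] using le \<delta>(1) by auto
  then show False using M' x(2) by simp
qed

section \<open>Stability notions on explicit boxes\<close>

definition sol :: "real \<Rightarrow> 'x \<Rightarrow> 'u \<Rightarrow> 'x" where
  "sol \<delta> v u = the_elem (M_delta \<phi> xbar \<delta> v u)"

definition substable_at :: "real \<Rightarrow> real \<Rightarrow> real \<Rightarrow> bool" where
  "substable_at \<delta> \<theta> L \<longleftrightarrow> \<theta> > 0 \<and> L \<ge> 0 \<and>
     (\<forall>v u. norm v < \<theta> \<longrightarrow> norm u < \<theta> \<longrightarrow> M_delta \<phi> xbar \<delta> v u = {sol \<delta> v u}) \<and>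
     continuous_on (ball 0 \<theta> \<times> ball 0 \<theta>) (\<lambda>(v, u). sol \<delta> v u) \<and>
     (\<forall>v v' u. norm v < \<theta> \<longrightarrow> norm v' < \<theta> \<longrightarrow> norm u < \<theta> \<longrightarrow> norm (sol \<delta> v u - sol \<delta> v' u) \<le> L * norm (v - v'))"

definition stable_at :: "real \<Rightarrow> real \<Rightarrow> real \<Rightarrow> bool" where
  "stable_at \<delta> \<theta> L \<longleftrightarrow> \<theta> > 0 \<and> L \<ge> 0 \<and>
     (\<forall>v u. norm v < \<theta> \<longrightarrow> norm u < \<theta> \<longrightarrow> M_delta \<phi> xbar \<delta> v u = {sol \<delta> v u}) \<and>
     (\<forall>v v' u u'. norm v < \<theta> \<longrightarrow> norm v' < \<theta> \<longrightarrow> norm u < \<theta> \<longrightarrow> norm u' < \<theta> \<longrightarrow>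
        norm (sol \<delta> v u - sol \<delta> v' u') \<le> L * (norm (v - v') + norm (u - u')))"

lemma box_in_open:
  fixes N :: "('x \<times> 'u) set"
  assumes "open N" "(0, 0) \<in> N"
  obtains \<theta> where "\<theta> > 0" "\<And>v u. norm v < \<theta> \<Longrightarrow> norm u < \<theta> \<Longrightarrow> (v, u) \<in> N"
proof -
  have "\<forall>\<^sub>F (v, u) in nhds (0, 0). (v, u) \<in> N" using eventually_nhds_in_open[OF assms] by (simp add: case_prod_unfold)
  then show ?thesis unfolding eventually_nhds_box using that by blast
qed

lemma the_elem_singleton: "is_singleton A \<Longrightarrow> A = {the_elem A}"
  by (auto simp: is_singleton_def)

lemma substability_local:
  assumes "full_substability \<phi> xbar"
  obtains \<delta>0 where "\<delta>0 > 0"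
    "\<And>\<delta>. 0 < \<delta> \<Longrightarrow> \<delta> < \<delta>0 \<Longrightarrow> (\<exists>\<epsilon> K. calm \<phi> xbar \<phi>b \<delta> \<epsilon> K) \<and> (\<exists>\<theta> L. substable_at \<delta> \<theta> L)"
proof -
  obtain \<delta>0 where \<delta>0: "\<delta>0 > 0" and sub: "\<And>\<delta>. 0 < \<delta> \<and> \<delta> < \<delta>0 \<Longrightarrow>
        M_delta \<phi> xbar \<delta> 0 0 = {xbar} \<and>
        (\<exists>N. open N \<and> (0, 0) \<in> N \<and>
           (\<forall>(v, u)\<in>N. is_singleton (M_delta \<phi> xbar \<delta> v u)) \<and>
           continuous_on N (\<lambda>(v, u). the_elem (M_delta \<phi> xbar \<delta> v u)) \<and>
           continuous_on N (\<lambda>(v, u). real_of_ereal (m_delta \<phi> xbar \<delta> v u)) \<and>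
           (\<exists>L. \<forall>u. L-lipschitz_on {v. (v, u) \<in> N} (\<lambda>v. the_elem (M_delta \<phi> xbar \<delta> v u))) \<and>
           (\<exists>L. \<forall>u. L-lipschitz_on {v. (v, u) \<in> N} (\<lambda>v. real_of_ereal (m_delta \<phi> xbar \<delta> v u))))"
    using assms unfolding full_substability_def by blast
  show ?thesis
  proof (rule that[OF \<delta>0], intro conjI)
    fix \<delta> assume \<delta>: "0 < \<delta>" "\<delta> < \<delta>0"
    show "\<exists>\<epsilon> K. calm \<phi> xbar \<phi>b \<delta> \<epsilon> K"
    proof (rule ex_calm[OF \<delta>(1)])
      fix x assume "norm (x - xbar) \<le> \<delta>" "x \<noteq> xbar"
      then show "ereal \<phi>b < \<phi> (x, 0)" using sub \<delta> by (intro strict_of_singleton[of \<delta>0]) auto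
    qed
    obtain N L where N: "open N" "(0, 0) \<in> N" "\<forall>(v, u)\<in>N. is_singleton (M_delta \<phi> xbar \<delta> v u)"
      "continuous_on N (\<lambda>(v, u). the_elem (M_delta \<phi> xbar \<delta> v u))"
      "\<forall>u. L-lipschitz_on {v. (v, u) \<in> N} (\<lambda>v. the_elem (M_delta \<phi> xbar \<delta> v u))"
      using sub[OF conjI[OF \<delta>]] by (elim conjE exE)
    obtain \<theta> where \<theta>: "\<theta> > 0" "\<And>v u. norm v < \<theta> \<Longrightarrow> norm u < \<theta> \<Longrightarrow> (v, u) \<in> N"
      using box_in_open[OF N(1,2)] by blast
    have "substable_at \<delta> \<theta> L" unfolding substable_at_def
    proof (intro conjI allI impI)
      show "L \<ge> 0" using N(5) lipschitz_on_nonneg by blast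
      show "M_delta \<phi> xbar \<delta> v u = {sol \<delta> v u}" if "norm v < \<theta>" "norm u < \<theta>" for v u
        unfolding sol_def using bspec[OF N(3) \<theta>(2)[OF that]] by (intro the_elem_singleton) simp
      show "continuous_on (ball 0 \<theta> \<times> ball 0 \<theta>) (\<lambda>(v, u). sol \<delta> v u)"
        unfolding sol_def by (rule continuous_on_subset[OF N(4)]) (use \<theta>(2) in auto)
      show "norm (sol \<delta> v u - sol \<delta> v' u) \<le> L * norm (v - v')" if "norm v < \<theta>" "norm v' < \<theta>" "norm u < \<theta>" for v v' u
        unfolding sol_def using lipschitz_onD[OF spec[OF N(5), of u], of v v'] that \<theta>(2) by (simp add: dist_norm)
    qed (use \<theta> in simp)
    then show "\<exists>\<theta> L. substable_at \<delta> \<theta> L" by blast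
  qed
qed

lemma stability_local:
  assumes "full_stability \<phi> xbar"
  obtains \<delta>0 where "\<delta>0 > 0"
    "\<And>\<delta>. 0 < \<delta> \<Longrightarrow> \<delta> < \<delta>0 \<Longrightarrow> (\<exists>\<epsilon> K. calm \<phi> xbar \<phi>b \<delta> \<epsilon> K) \<and> (\<exists>\<theta> L. stable_at \<delta> \<theta> L)"
proof -
  obtain \<delta>0 where \<delta>0: "\<delta>0 > 0" and sub: "\<And>\<delta>. 0 < \<delta> \<and> \<delta> < \<delta>0 \<Longrightarrow>
        M_delta \<phi> xbar \<delta> 0 0 = {xbar} \<and>
        (\<exists>N. open N \<and> (0, 0) \<in> N \<and>
           (\<forall>(v, u)\<in>N. is_singleton (M_delta \<phi> xbar \<delta> v u)) \<and>
           (\<exists>L. L-lipschitz_on N (\<lambda>(v, u). the_elem (M_delta \<phi> xbar \<delta> v u))) \<and>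
           (\<exists>L. L-lipschitz_on N (\<lambda>(v, u). real_of_ereal (m_delta \<phi> xbar \<delta> v u))))"
    using assms unfolding full_stability_def by blast
  show ?thesis
  proof (rule that[OF \<delta>0], intro conjI)
    fix \<delta> assume \<delta>: "0 < \<delta>" "\<delta> < \<delta>0"
    show "\<exists>\<epsilon> K. calm \<phi> xbar \<phi>b \<delta> \<epsilon> K"
    proof (rule ex_calm[OF \<delta>(1)])
      fix x assume "norm (x - xbar) \<le> \<delta>" "x \<noteq> xbar"
      then show "ereal \<phi>b < \<phi> (x, 0)" using sub \<delta> by (intro strict_of_singleton[of \<delta>0]) auto
    qed
    obtain N L where N: "open N" "(0, 0) \<in> N" "\<forall>(v, u)\<in>N. is_singleton (M_delta \<phi> xbar \<delta> v u)"
      "L-lipschitz_on N (\<lambda>(v, u). the_elem (M_delta \<phi> xbar \<delta> v u))"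
      using sub[OF conjI[OF \<delta>]] by (elim conjE exE)
    obtain \<theta> where \<theta>: "\<theta> > 0" "\<And>v u. norm v < \<theta> \<Longrightarrow> norm u < \<theta> \<Longrightarrow> (v, u) \<in> N"
      using box_in_open[OF N(1,2)] by blast
    have L: "L \<ge> 0" using N(4) lipschitz_on_nonneg by blast
    have "stable_at \<delta> \<theta> L" unfolding stable_at_def
    proof (intro conjI allI impI)
      show "M_delta \<phi> xbar \<delta> v u = {sol \<delta> v u}" if "norm v < \<theta>" "norm u < \<theta>" for v u
        unfolding sol_def using bspec[OF N(3) \<theta>(2)[OF that]] by (intro the_elem_singleton) simp
      show "norm (sol \<delta> v u - sol \<delta> v' u') \<le> L * (norm (v - v') + norm (u - u'))"
        if "norm v < \<theta>" "norm v' < \<theta>" "norm u < \<theta>" "norm u' < \<theta>" for v v' u u'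
      proof -
        have "norm (sol \<delta> v u - sol \<delta> v' u') \<le> L * norm (v - v', u - u')"
          unfolding sol_def using lipschitz_onD[OF N(4), of "(v, u)" "(v', u')"] that \<theta>(2) by (simp add: dist_norm)
        also have "\<dots> \<le> L * (norm (v - v') + norm (u - u'))" using L by (intro mult_left_mono norm_Pair_le)
        finally show ?thesis .
      qed
    qed (use \<theta> L in auto)
    then show "\<exists>\<theta> L. stable_at \<delta> \<theta> L" by blast
  qed
qed

lemma full_stability_imp_substability:
  assumes "full_stability \<phi> xbar" shows "full_substability \<phi> xbar"
proof -
  obtain \<delta>0 where \<delta>0: "\<delta>0 > 0" and stab: "\<And>\<delta>. 0 < \<delta> \<and> \<delta> < \<delta>0 \<Longrightarrow>
        M_delta \<phi> xbar \<delta> 0 0 = {xbar} \<and>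
        (\<exists>N. open N \<and> (0, 0) \<in> N \<and>
           (\<forall>(v, u)\<in>N. is_singleton (M_delta \<phi> xbar \<delta> v u)) \<and>
           (\<exists>L. L-lipschitz_on N (\<lambda>(v, u). the_elem (M_delta \<phi> xbar \<delta> v u))) \<and>
           (\<exists>L. L-lipschitz_on N (\<lambda>(v, u). real_of_ereal (m_delta \<phi> xbar \<delta> v u))))"
    using assms unfolding full_stability_def by blast
  have slice: "L-lipschitz_on {v. (v, u) \<in> N} (\<lambda>v. f v u)" if lip: "L-lipschitz_on N (\<lambda>(v, u). f v u)"
    for L N u and f :: "'x \<Rightarrow> 'u \<Rightarrow> 'b::metric_space"
  proof (rule lipschitz_onI)
    fix v v' assume "v \<in> {v. (v, u) \<in> N}" "v' \<in> {v. (v, u) \<in> N}"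
    then show "dist (f v u) (f v' u) \<le> L * dist v v'"
      using lipschitz_onD[OF lip, of "(v, u)" "(v', u)"] by (simp add: dist_Pair_Pair)
  qed (rule lipschitz_on_nonneg[OF lip])
  show ?thesis
    unfolding full_substability_def
  proof (rule exI[of _ \<delta>0], rule conjI[OF \<delta>0], intro allI impI)
    fix \<delta> assume \<delta>: "0 < \<delta> \<and> \<delta> < \<delta>0"
    obtain N L L' where M: "M_delta \<phi> xbar \<delta> 0 0 = {xbar}"
      and N: "open N" "(0, 0) \<in> N" "\<forall>(v, u)\<in>N. is_singleton (M_delta \<phi> xbar \<delta> v u)"
      "L-lipschitz_on N (\<lambda>(v, u). the_elem (M_delta \<phi> xbar \<delta> v u))"
      "L'-lipschitz_on N (\<lambda>(v, u). real_of_ereal (m_delta \<phi> xbar \<delta> v u))"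
      using stab[OF \<delta>] by (elim conjE exE)
    have L1: "\<exists>L. \<forall>u. L-lipschitz_on {v. (v, u) \<in> N} (\<lambda>v. the_elem (M_delta \<phi> xbar \<delta> v u))"
      using slice[OF N(4)] by (intro exI allI)
    have L2: "\<exists>L. \<forall>u. L-lipschitz_on {v. (v, u) \<in> N} (\<lambda>v. real_of_ereal (m_delta \<phi> xbar \<delta> v u))"
      using slice[OF N(5)] by (intro exI allI)
    show "M_delta \<phi> xbar \<delta> 0 0 = {xbar} \<and>
        (\<exists>N. open N \<and> (0, 0) \<in> N \<and>
           (\<forall>(v, u)\<in>N. is_singleton (M_delta \<phi> xbar \<delta> v u)) \<and>
           continuous_on N (\<lambda>(v, u). the_elem (M_delta \<phi> xbar \<delta> v u)) \<and>
           continuous_on N (\<lambda>(v, u). real_of_ereal (m_delta \<phi> xbar \<delta> v u)) \<and>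
           (\<exists>L. \<forall>u. L-lipschitz_on {v. (v, u) \<in> N} (\<lambda>v. the_elem (M_delta \<phi> xbar \<delta> v u))) \<and>
           (\<exists>L. \<forall>u. L-lipschitz_on {v. (v, u) \<in> N} (\<lambda>v. real_of_ereal (m_delta \<phi> xbar \<delta> v u))))"
      by (intro conjI exI[of _ N] M N(1-3) lipschitz_on_continuous_on[OF N(4)]
        lipschitz_on_continuous_on[OF N(5)] L1 L2)
  qed
qed

section \<open>Minimizers and the truncated solution mapping\<close>

lemma minimizers_in_trunc:
  assumes calm: "calm \<phi> xbar \<phi>b \<delta> \<epsilon> K" and \<delta>1: "\<delta>1 > 0" and \<alpha>: "\<phi>b < \<alpha>"
  obtains \<theta> where "\<theta> > 0"
    "\<And>v u. norm v < \<theta> \<Longrightarrow> norm u < \<theta> \<Longrightarrow> M_delta \<phi> xbar \<delta> v u \<noteq> {} \<and>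
       M_delta \<phi> xbar \<delta> v u \<subseteq> M_trunc \<phi> xbar \<delta>1 \<alpha> v u"
proof -
  interpret c: calm \<phi> xbar \<phi>b \<delta> \<epsilon> K by (rule calm)
  obtain \<theta>0 K' where box: "c.stable_box \<theta>0 K'" using c.ex_stable_box by blast
  have "min \<delta>1 (\<alpha> - \<phi>b) > 0" using \<delta>1 \<alpha> by simp
  from c.minimizers_near[OF this] obtain \<theta>1 where \<theta>1: "\<theta>1 > 0" "\<And>v u x. norm v \<le> \<theta>1 \<Longrightarrow> norm u \<le> \<theta>1 \<Longrightarrow> x \<in> M_delta \<phi> xbar \<delta> v u \<Longrightarrow>
      norm (x - xbar) < min \<delta>1 (\<alpha> - \<phi>b) \<and> \<phi> (x, u) < ereal (\<phi>b + min \<delta>1 (\<alpha> - \<phi>b))" by blast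
  have le: "ereal (\<phi>b + min \<delta>1 (\<alpha> - \<phi>b)) \<le> ereal \<alpha>" by simp
  show ?thesis
  proof (rule that[of "min \<theta>0 \<theta>1"])
    show "min \<theta>0 \<theta>1 > 0" using box \<theta>1 by (simp add: c.stable_box_def)
    fix v :: 'x and u :: 'u assume vu: "norm v < min \<theta>0 \<theta>1" "norm u < min \<theta>0 \<theta>1"
    have "x \<in> M_trunc \<phi> xbar \<delta>1 \<alpha> v u" if x: "x \<in> M_delta \<phi> xbar \<delta> v u" for x
    proof -
      obtain y where "(v, y) \<in> subdiff \<phi> (x, u)" using c.minimizer_multiplier[OF box _ _ x] vu by auto
      moreover have "norm (x - xbar) < \<delta>1" "\<phi> (x, u) < ereal (\<phi>b + min \<delta>1 (\<alpha> - \<phi>b))" using \<theta>1(2)[OF _ _ x] vu by auto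
      ultimately show ?thesis using order_less_le_trans[OF _ le]
        by (auto simp: M_trunc_def M_set_def Y_set_def)
    qed
    moreover have "M_delta \<phi> xbar \<delta> v u \<noteq> {}" using box vu by (auto simp: c.stable_box_def)
    ultimately show "M_delta \<phi> xbar \<delta> v u \<noteq> {} \<and> M_delta \<phi> xbar \<delta> v u \<subseteq> M_trunc \<phi> xbar \<delta>1 \<alpha> v u" by blast
  qed
qed

text \<open>\<open>suitable\<close> compares the two mappings at one radius \<delta>1; here \<delta>
  is any radius with a calm problem. The minimizers for \<delta> form a nonempty subset of the
  truncated set, which is a singleton.\<close>

lemma suitable_trunc_eq:
  assumes suit: "suitable \<phi> xbar \<delta>1 \<alpha>" and calm: "calm \<phi> xbar \<phi>b \<delta> \<epsilon> K"
  obtains \<theta> where "\<theta> > 0" "\<And>v u. norm v < \<theta> \<Longrightarrow> norm u < \<theta> \<Longrightarrow>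
     is_singleton (M_trunc \<phi> xbar \<delta>1 \<alpha> v u) \<and> M_trunc \<phi> xbar \<delta>1 \<alpha> v u = M_delta \<phi> xbar \<delta> v u"
proof -
  have "\<delta>1 > 0" "\<phi>b < \<alpha>" using suit \<phi>b by (auto simp: suitable_def)
  from minimizers_in_trunc[OF calm this] obtain \<theta>1 where \<theta>1: "\<theta>1 > 0" "\<And>v u. norm v < \<theta>1 \<Longrightarrow> norm u < \<theta>1 \<Longrightarrow> M_delta \<phi> xbar \<delta> v u \<noteq> {} \<and>
       M_delta \<phi> xbar \<delta> v u \<subseteq> M_trunc \<phi> xbar \<delta>1 \<alpha> v u" by blast
  have "\<forall>\<^sub>F (v, u) in nhds (0, 0). is_singleton (M_trunc \<phi> xbar \<delta>1 \<alpha> v u) \<and> M_trunc \<phi> xbar \<delta>1 \<alpha> v u = M_delta \<phi> xbar \<delta>1 v u"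
    using suit by (simp add: suitable_def)
  then obtain \<theta>2 where \<theta>2: "\<theta>2 > 0" "\<And>v u. norm v < \<theta>2 \<Longrightarrow> norm u < \<theta>2 \<Longrightarrow> is_singleton (M_trunc \<phi> xbar \<delta>1 \<alpha> v u)"
    unfolding eventually_nhds_box by blast
  show ?thesis
  proof (rule that[of "min \<theta>1 \<theta>2"])
    fix v :: 'x and u :: 'u assume vu: "norm v < min \<theta>1 \<theta>2" "norm u < min \<theta>1 \<theta>2"
    then have s: "is_singleton (M_trunc \<phi> xbar \<delta>1 \<alpha> v u)" using \<theta>2 by simp
    obtain x where x: "M_trunc \<phi> xbar \<delta>1 \<alpha> v u = {x}" using s by (auto simp: is_singleton_def)
    have "M_delta \<phi> xbar \<delta> v u \<noteq> {}" "M_delta \<phi> xbar \<delta> v u \<subseteq> {x}" using \<theta>1(2)[of v u] vu x by auto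
    then have "M_trunc \<phi> xbar \<delta>1 \<alpha> v u = M_delta \<phi> xbar \<delta> v u" unfolding x by blast
    then show "is_singleton (M_trunc \<phi> xbar \<delta>1 \<alpha> v u) \<and> M_trunc \<phi> xbar \<delta>1 \<alpha> v u = M_delta \<phi> xbar \<delta> v u"
      using s by simp
  qed (use \<theta>1 \<theta>2 in simp)
qed

lemma substable_minimizer:
  assumes "calm \<phi> xbar \<phi>b \<delta> \<epsilon> K" "uniform_prox n" "substable_at \<delta> \<theta> L"
  shows "\<exists>\<rho>>0. \<forall>x u v y. near_ref \<phi> xbar \<rho> x u v y \<longrightarrow> M_delta \<phi> xbar \<delta> v u = {x}"
proof (rule subgradient_imp_minimizer[OF assms(1,2)])
  show "\<theta> > 0" using assms(3) by (simp add: substable_at_def)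
  show "M_delta \<phi> xbar \<delta> v u = {sol \<delta> v u}" if "norm v < \<theta>" "norm u < \<theta>" for v u
    using assms(3) that by (simp add: substable_at_def)
  fix u :: 'u assume u: "norm u < \<theta>"
  have "continuous_on (ball 0 \<theta> \<times> ball 0 \<theta>) (\<lambda>(v, u). sol \<delta> v u)" using assms(3) by (simp add: substable_at_def)
  then have "continuous_on (ball 0 \<theta>) (\<lambda>v. (\<lambda>(v, u). sol \<delta> v u) (v, u))"
    by (rule continuous_on_compose2) (use u in \<open>auto intro!: continuous_intros\<close>)
  then show "continuous_on (ball 0 \<theta>) (\<lambda>v. sol \<delta> v u)" by simp
qed

lemma stable_imp_substable:
  assumes "stable_at \<delta> \<theta> L" shows "substable_at \<delta> \<theta> L"
  unfolding substable_at_def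
proof (intro conjI allI impI)
  have lip: "norm (sol \<delta> v u - sol \<delta> v' u') \<le> L * (norm (v - v') + norm (u - u'))"
    if "norm v < \<theta>" "norm v' < \<theta>" "norm u < \<theta>" "norm u' < \<theta>" for v v' u u'
    using assms that unfolding stable_at_def by blast
  have L: "L \<ge> 0" using assms by (simp add: stable_at_def)
  have "(2 * L)-lipschitz_on (ball 0 \<theta> \<times> ball 0 \<theta>) (\<lambda>(v, u). sol \<delta> v u)"
  proof (rule lipschitz_onI)
    fix p p' :: "'x \<times> 'u" assume p: "p \<in> ball 0 \<theta> \<times> ball 0 \<theta>" "p' \<in> ball 0 \<theta> \<times> ball 0 \<theta>"
    obtain v u v' u' where e: "p = (v, u)" "p' = (v', u')" by (metis prod.exhaust)
    have "norm (sol \<delta> v u - sol \<delta> v' u') \<le> L * (norm (v - v') + norm (u - u'))" using p unfolding e by (intro lip) auto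
    also have "\<dots> \<le> L * (norm (v - v', u - u') + norm (v - v', u - u'))"
      using L by (intro mult_left_mono add_mono norm_fst_le norm_snd_le)
    finally show "dist (case p of (v, u) \<Rightarrow> sol \<delta> v u) (case p' of (v, u) \<Rightarrow> sol \<delta> v u) \<le> 2 * L * dist p p'"
      unfolding e by (simp add: dist_norm)
  qed (use L in simp)
  then show "continuous_on (ball 0 \<theta> \<times> ball 0 \<theta>) (\<lambda>(v, u). sol \<delta> v u)" by (rule lipschitz_on_continuous_on)
  show "norm (sol \<delta> v u - sol \<delta> v' u) \<le> L * norm (v - v')" if "norm v < \<theta>" "norm v' < \<theta>" "norm u < \<theta>" for v v' u
    using lip[OF that(1,2,3,3)] by simp
qed (use assms in \<open>auto simp: stable_at_def\<close>)

lemma ex_suitable: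
  assumes "full_substability \<phi> xbar" "full_multiplier_prox_regularity \<phi> xbar"
  shows "\<exists>\<delta> \<alpha>. suitable \<phi> xbar \<delta> \<alpha>"
proof -
  obtain n where n: "uniform_prox n" using assms(2) uniform_prox_iff by blast
  obtain \<delta>0 where \<delta>0: "\<delta>0 > 0"
    "\<And>\<delta>. 0 < \<delta> \<Longrightarrow> \<delta> < \<delta>0 \<Longrightarrow> (\<exists>\<epsilon> K. calm \<phi> xbar \<phi>b \<delta> \<epsilon> K) \<and> (\<exists>\<theta> L. substable_at \<delta> \<theta> L)"
    using substability_local[OF assms(1)] by blast
  define \<delta> where "\<delta> = \<delta>0 / 2"
  have \<delta>: "\<delta> > 0" "\<delta> < \<delta>0" using \<delta>0(1) by (auto simp: \<delta>_def)
  obtain \<epsilon> K \<theta> L where calm: "calm \<phi> xbar \<phi>b \<delta> \<epsilon> K" and sub: "substable_at \<delta> \<theta> L" using \<delta>0(2)[OF \<delta>] by blast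
  obtain \<rho> where \<rho>: "\<rho> > 0" "\<And>x u v y. near_ref \<phi> xbar \<rho> x u v y \<Longrightarrow> M_delta \<phi> xbar \<delta> v u = {x}"
    using substable_minimizer[OF calm n sub] by blast
  \<comment> \<open>With \<alpha> = \<phi>b + \<rho>, every truncated solution for small (v, u)
    satisfies \<open>near_ref\<close> with radius \<rho>, hence is the minimizer for
    \<delta>.\<close>
  define \<delta>1 where "\<delta>1 = min \<rho> \<delta>"
  have \<delta>1: "\<delta>1 > 0" "\<delta>1 \<le> \<rho>" "\<delta>1 \<le> \<delta>" using \<rho> \<delta> by (auto simp: \<delta>1_def)
  define \<alpha> where "\<alpha> = \<phi>b + \<rho>"
  have \<alpha>: "\<phi>b < \<alpha>" using \<rho> by (simp add: \<alpha>_def)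
  obtain \<theta>1 where \<theta>1: "\<theta>1 > 0" "\<And>v u. norm v < \<theta>1 \<Longrightarrow> norm u < \<theta>1 \<Longrightarrow> M_delta \<phi> xbar \<delta> v u \<noteq> {} \<and>
       M_delta \<phi> xbar \<delta> v u \<subseteq> M_trunc \<phi> xbar \<delta>1 \<alpha> v u" using minimizers_in_trunc[OF calm \<delta>1(1) \<alpha>] by blast
  have "is_singleton (M_trunc \<phi> xbar \<delta>1 \<alpha> v u) \<and> M_trunc \<phi> xbar \<delta>1 \<alpha> v u = M_delta \<phi> xbar \<delta>1 v u"
    if vu: "norm v < min \<theta>1 \<rho>" "norm u < min \<theta>1 \<rho>" for v u
  proof -
    have trunc: "M_delta \<phi> xbar \<delta> v u = {x}" if x: "x \<in> M_trunc \<phi> xbar \<delta>1 \<alpha> v u" for x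
    proof -
      obtain y where "(v, y) \<in> subdiff \<phi> (x, u)" using x by (auto simp: M_trunc_def M_set_def Y_set_def)
      then have "near_ref \<phi> xbar \<rho> x u v y"
        using x vu \<delta>1(2) \<phi>b by (auto simp: near_ref_def M_trunc_def \<alpha>_def)
      then show ?thesis by (rule \<rho>(2))
    qed
    obtain x where x: "x \<in> M_delta \<phi> xbar \<delta> v u" "x \<in> M_trunc \<phi> xbar \<delta>1 \<alpha> v u" using \<theta>1(2)[of v u] vu by auto
    have Mx: "M_delta \<phi> xbar \<delta> v u = {x}" by (rule trunc[OF x(2)])
    have T: "M_trunc \<phi> xbar \<delta>1 \<alpha> v u = {x}" using x(2) trunc Mx by blast
    obtain a where a: "\<phi> (x, u) = ereal a" "\<And>x'. norm (x' - xbar) < \<delta> \<Longrightarrow> ereal (a + v \<bullet> (x' - x)) \<le> \<phi> (x', u)"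
      using x(1) unfolding M_delta_iff[OF nm] by blast
    have x1: "norm (x - xbar) < \<delta>1" using x(2) by (simp add: M_trunc_def)
    have "x \<in> M_delta \<phi> xbar \<delta>1 v u"
      unfolding M_delta_iff[OF nm] using a x1 \<delta>1(3) by auto
    \<comment> \<open>On the smaller ball x' is at least as good as x, so it inherits the minorant
      of x on the larger ball and is a minimizer there.\<close>
    moreover have "x' = x" if x': "x' \<in> M_delta \<phi> xbar \<delta>1 v u" for x'
    proof -
      obtain a' where a': "norm (x' - xbar) < \<delta>1" "\<phi> (x', u) = ereal a'" "ereal (a' + v \<bullet> (x - x')) \<le> \<phi> (x, u)"
        using x' x1 unfolding M_delta_iff[OF nm] by blast
      have "ereal (a' + v \<bullet> (x'' - x')) \<le> \<phi> (x'', u)" if "norm (x'' - xbar) < \<delta>" for x''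
      proof -
        have "a' + v \<bullet> (x'' - x') \<le> a + v \<bullet> (x'' - x)" using a'(3) a(1) by (simp add: inner_diff_right)
        then show ?thesis using a(2)[OF that] by (meson ereal_less_eq(3) order_trans)
      qed
      then have "x' \<in> M_delta \<phi> xbar \<delta> v u" unfolding M_delta_iff[OF nm] using a' \<delta>1(3) by auto
      then show ?thesis using Mx by simp
    qed
    ultimately have "M_delta \<phi> xbar \<delta>1 v u = {x}" by blast
    then show ?thesis using T by simp
  qed
  moreover have "min \<theta>1 \<rho> > 0" using \<theta>1(1) \<rho>(1) by simp
  ultimately have "\<exists>\<theta>>0. \<forall>v u. norm v < \<theta> \<longrightarrow> norm u < \<theta> \<longrightarrow>
      is_singleton (M_trunc \<phi> xbar \<delta>1 \<alpha> v u) \<and> M_trunc \<phi> xbar \<delta>1 \<alpha> v u = M_delta \<phi> xbar \<delta>1 v u" by blast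
  then have "suitable \<phi> xbar \<delta>1 \<alpha>"
    unfolding suitable_def eventually_nhds_box using \<delta>1(1) \<alpha> \<phi>b by simp
  then show ?thesis by blast
qed

section \<open>The derivative condition and Lipschitz dependence on u\<close>

lemma stability_imp_derivative_condition:
  assumes "full_stability \<phi> xbar" and suit: "suitable \<phi> xbar \<delta>1 \<alpha>"
  shows "derivative_condition \<phi> xbar \<delta>1 \<alpha>"
proof -
  obtain \<delta>0 where \<delta>0: "\<delta>0 > 0"
    "\<And>\<delta>. 0 < \<delta> \<Longrightarrow> \<delta> < \<delta>0 \<Longrightarrow> (\<exists>\<epsilon> K. calm \<phi> xbar \<phi>b \<delta> \<epsilon> K) \<and> (\<exists>\<theta> L. stable_at \<delta> \<theta> L)"
    using stability_local[OF assms(1)] by blast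
  define \<delta> where "\<delta> = \<delta>0 / 2"
  have \<delta>: "\<delta> > 0" "\<delta> < \<delta>0" using \<delta>0(1) by (auto simp: \<delta>_def)
  obtain \<epsilon> K \<theta> L where calm: "calm \<phi> xbar \<phi>b \<delta> \<epsilon> K" and stab: "stable_at \<delta> \<theta> L" using \<delta>0(2)[OF \<delta>] by blast
  obtain \<theta>1 where \<theta>1: "\<theta>1 > 0" "\<And>v u. norm v < \<theta>1 \<Longrightarrow> norm u < \<theta>1 \<Longrightarrow>
     is_singleton (M_trunc \<phi> xbar \<delta>1 \<alpha> v u) \<and> M_trunc \<phi> xbar \<delta>1 \<alpha> v u = M_delta \<phi> xbar \<delta> v u"
    using suitable_trunc_eq[OF suit calm] by blast
  define \<theta>2 where "\<theta>2 = min \<theta> \<theta>1"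
  have "\<theta> > 0" and L: "L \<ge> 0" using stab by (auto simp: stable_at_def)
  then have \<theta>2: "\<theta>2 > 0" "\<theta>2 \<le> \<theta>" "\<theta>2 \<le> \<theta>1" using \<theta>1 by (auto simp: \<theta>2_def)
  have T: "M_trunc \<phi> xbar \<delta>1 \<alpha> v u = {sol \<delta> v u}" if "norm v < \<theta>2" "norm u < \<theta>2" for v u
    using \<theta>1(2)[of v u] that \<theta>2 stab by (auto simp: stable_at_def)
  have "inner_norm (graphical_derivative (M_trunc \<phi> xbar \<delta>1 \<alpha> v) u (the_elem (M_trunc \<phi> xbar \<delta>1 \<alpha> v u))) \<le> ereal L"
    if vu: "norm v < \<theta>2" "norm u < \<theta>2" for v u
  proof -
    have "norm (sol \<delta> v u' - sol \<delta> v u) \<le> L * norm (u' - u)" if "norm u < \<theta>2" "norm u' < \<theta>2" for u u'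
    proof -
      have "norm v < \<theta>" "norm u < \<theta>" "norm u' < \<theta>" using vu that \<theta>2 by auto
      then have "norm (sol \<delta> v u' - sol \<delta> v u) \<le> L * (norm (v - v) + norm (u' - u))"
        using stab unfolding stable_at_def by blast
      then show ?thesis by simp
    qed
    then have "inner_norm (graphical_derivative (M_trunc \<phi> xbar \<delta>1 \<alpha> v) u (sol \<delta> v u)) \<le> ereal L"
      by (intro inner_norm_lipschitz_le[of \<theta>2] T vu L)
    then show ?thesis using T[OF vu] by simp
  qed
  then have "\<forall>\<^sub>F (v, u) in nhds (0, 0). inner_norm (graphical_derivative (M_trunc \<phi> xbar \<delta>1 \<alpha> v) u (the_elem (M_trunc \<phi> xbar \<delta>1 \<alpha> v u))) \<le> ereal L"
    unfolding eventually_nhds_box using \<theta>2(1) by blast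
  then have "Limsup (nhds (0, 0)) (\<lambda>(v, u). inner_norm (graphical_derivative (M_trunc \<phi> xbar \<delta>1 \<alpha> v) u
         (the_elem (M_trunc \<phi> xbar \<delta>1 \<alpha> v u)))) \<le> ereal L"
    by (intro Limsup_bounded) (simp add: case_prod_unfold)
  then show ?thesis unfolding derivative_condition_def by (rule order_le_less_trans) simp
qed

text \<open>A finite upper limit gives one bound \<kappa> on a whole box, hence a Lipschitz constant
  in u that is the same for all v. Together with the Lipschitz dependence on v this gives joint
  dependence, through the intermediate point (v', u).\<close>

lemma substability_derivative_imp_stability:
  assumes "full_substability \<phi> xbar" and suit: "suitable \<phi> xbar \<delta>1 \<alpha>" and D: "derivative_condition \<phi> xbar \<delta>1 \<alpha>"
  shows "full_stability \<phi> xbar"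
proof -
  obtain \<delta>0 where \<delta>0: "\<delta>0 > 0"
    "\<And>\<delta>. 0 < \<delta> \<Longrightarrow> \<delta> < \<delta>0 \<Longrightarrow> (\<exists>\<epsilon> K. calm \<phi> xbar \<phi>b \<delta> \<epsilon> K) \<and> (\<exists>\<theta> L. substable_at \<delta> \<theta> L)"
    using substability_local[OF assms(1)] by blast
  obtain \<kappa> :: real where "Limsup (nhds (0, 0)) (\<lambda>(v, u). inner_norm (graphical_derivative (M_trunc \<phi> xbar \<delta>1 \<alpha> v) u
         (the_elem (M_trunc \<phi> xbar \<delta>1 \<alpha> v u)))) < ereal \<kappa>"
    using ereal_dense2[OF D[unfolded derivative_condition_def]] by blast
  then have "\<forall>\<^sub>F (v, u) in nhds (0, 0). inner_norm (graphical_derivative (M_trunc \<phi> xbar \<delta>1 \<alpha> v) u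
         (the_elem (M_trunc \<phi> xbar \<delta>1 \<alpha> v u))) < ereal \<kappa>"
    by (auto dest!: Limsup_lessD simp: case_prod_unfold)
  then obtain \<theta>d where \<theta>d: "\<theta>d > 0" "\<And>v u. norm v < \<theta>d \<Longrightarrow> norm u < \<theta>d \<Longrightarrow>
      inner_norm (graphical_derivative (M_trunc \<phi> xbar \<delta>1 \<alpha> v) u (the_elem (M_trunc \<phi> xbar \<delta>1 \<alpha> v u))) < ereal \<kappa>"
    unfolding eventually_nhds_box by blast
  show ?thesis
    unfolding full_stability_def
  proof (rule exI[of _ \<delta>0], rule conjI[OF \<delta>0(1)], intro allI impI)
    fix \<delta> assume \<delta>: "0 < \<delta> \<and> \<delta> < \<delta>0"
    then obtain \<epsilon> K \<theta> L where calm: "calm \<phi> xbar \<phi>b \<delta> \<epsilon> K" and sub: "substable_at \<delta> \<theta> L" using \<delta>0(2) by blast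
    interpret c: calm \<phi> xbar \<phi>b \<delta> \<epsilon> K by (rule calm)
    obtain \<theta>0 K' where box0: "c.stable_box \<theta>0 K'" using c.ex_stable_box by blast
    obtain \<theta>1 where \<theta>1: "\<theta>1 > 0" "\<And>v u. norm v < \<theta>1 \<Longrightarrow> norm u < \<theta>1 \<Longrightarrow>
       is_singleton (M_trunc \<phi> xbar \<delta>1 \<alpha> v u) \<and> M_trunc \<phi> xbar \<delta>1 \<alpha> v u = M_delta \<phi> xbar \<delta> v u"
      using suitable_trunc_eq[OF suit calm] by blast
    have \<theta>: "\<theta> > 0" and L: "L \<ge> 0"
      and single: "\<And>v u. norm v < \<theta> \<Longrightarrow> norm u < \<theta> \<Longrightarrow> M_delta \<phi> xbar \<delta> v u = {sol \<delta> v u}"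
      and cont: "continuous_on (ball 0 \<theta> \<times> ball 0 \<theta>) (\<lambda>(v, u). sol \<delta> v u)"
      and lip: "\<And>v v' u. norm v < \<theta> \<Longrightarrow> norm v' < \<theta> \<Longrightarrow> norm u < \<theta> \<Longrightarrow> norm (sol \<delta> v u - sol \<delta> v' u) \<le> L * norm (v - v')"
      using sub unfolding substable_at_def by blast+
    define \<theta>2 where "\<theta>2 = min (min \<theta> \<theta>1) (min \<theta>d \<theta>0)"
    have \<theta>2: "\<theta>2 > 0" "\<theta>2 \<le> \<theta>" "\<theta>2 \<le> \<theta>1" "\<theta>2 \<le> \<theta>d" "\<theta>2 \<le> \<theta>0"
      using \<theta>1 \<theta> \<theta>d box0 by (auto simp: \<theta>2_def c.stable_box_def)
    have T: "M_trunc \<phi> xbar \<delta>1 \<alpha> v u = {sol \<delta> v u}" if "norm v < \<theta>2" "norm u < \<theta>2" for v u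
      using \<theta>1(2)[of v u] that \<theta>2 single by auto
    have lipu: "norm (sol \<delta> v u' - sol \<delta> v u) \<le> (\<kappa> + 1) * norm (u' - u)"
      if v: "norm v < \<theta>2" and u: "norm u < \<theta>2 / 3" "norm u' < \<theta>2 / 3" for v u u'
    proof (rule lipschitz_of_inner_norm_less[of \<theta>2 "M_trunc \<phi> xbar \<delta>1 \<alpha> v" "sol \<delta> v", OF T[OF v] _ _ u])
      have "continuous_on (ball 0 \<theta>2) (\<lambda>u. (\<lambda>(v, u). sol \<delta> v u) (v, u))"
        by (rule continuous_on_compose2[OF cont]) (use v \<theta>2 in \<open>auto intro!: continuous_intros\<close>)
      then show "continuous_on (ball 0 \<theta>2) (sol \<delta> v)" by simp
      show "inner_norm (graphical_derivative (M_trunc \<phi> xbar \<delta>1 \<alpha> v) u (sol \<delta> v u)) < ereal \<kappa>" if u: "norm u < \<theta>2" for u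
        using \<theta>d(2)[of v u] v u \<theta>2 T[OF v u] by simp
    qed
    define C where "C = max 0 (\<kappa> + 1)"
    have C: "C \<ge> 0" "\<kappa> + 1 \<le> C" by (auto simp: C_def)
    define N where "N = ball (0::'x) (\<theta>2 / 3) \<times> ball (0::'u) (\<theta>2 / 3)"
    have box: "c.stable_box (\<theta>2 / 3) K'" using \<theta>2 by (intro c.stable_box_mono[OF box0]) auto
    show "M_delta \<phi> xbar \<delta> 0 0 = {xbar} \<and>
        (\<exists>N. open N \<and> (0, 0) \<in> N \<and>
           (\<forall>(v, u)\<in>N. is_singleton (M_delta \<phi> xbar \<delta> v u)) \<and>
           (\<exists>L. L-lipschitz_on N (\<lambda>(v, u). the_elem (M_delta \<phi> xbar \<delta> v u))) \<and>
           (\<exists>L. L-lipschitz_on N (\<lambda>(v, u). real_of_ereal (m_delta \<phi> xbar \<delta> v u))))"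
    proof (rule conjI[OF c.M_delta_reference], rule exI[of _ N], intro conjI)
      show "open N" unfolding N_def by (intro open_Times open_ball)
      show "(0, 0) \<in> N" using \<theta>2 by (simp add: N_def)
      show "\<forall>(v, u)\<in>N. is_singleton (M_delta \<phi> xbar \<delta> v u)"
        using single \<theta>2 by (auto simp: is_singleton_def N_def)
      show "\<exists>L. L-lipschitz_on N (\<lambda>(v, u). real_of_ereal (m_delta \<phi> xbar \<delta> v u))"
        using c.m_delta_lipschitz[OF box] unfolding N_def by blast
      have "(L + C)-lipschitz_on N (\<lambda>(v, u). the_elem (M_delta \<phi> xbar \<delta> v u))"
      proof (rule lipschitz_onI)
        fix p p' assume p: "p \<in> N" "p' \<in> N"
        obtain v u v' u' where e: "p = (v, u)" "p' = (v', u')" by (metis prod.exhaust)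
        have *: "norm v < \<theta>2 / 3" "norm u < \<theta>2 / 3" "norm v' < \<theta>2 / 3" "norm u' < \<theta>2 / 3"
          using p by (auto simp: N_def e)
        have "norm (sol \<delta> v u - sol \<delta> v' u') \<le> norm (sol \<delta> v u - sol \<delta> v' u) + norm (sol \<delta> v' u - sol \<delta> v' u')"
          using norm_triangle_ineq[of "sol \<delta> v u - sol \<delta> v' u" "sol \<delta> v' u - sol \<delta> v' u'"] by simp
        also have "norm (sol \<delta> v u - sol \<delta> v' u) \<le> L * norm (v - v')" using * \<theta>2 by (intro lip) auto
        also have "\<dots> \<le> L * norm (v - v', u - u')" using L by (intro mult_left_mono norm_fst_le)
        also have "norm (sol \<delta> v' u - sol \<delta> v' u') \<le> (\<kappa> + 1) * norm (u - u')" using * \<theta>2 by (intro lipu) auto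
        also have "\<dots> \<le> C * norm (v - v', u - u')" using C by (intro mult_mono norm_snd_le) auto
        finally have "norm (sol \<delta> v u - sol \<delta> v' u') \<le> (L + C) * norm (v - v', u - u')" by (simp add: distrib_right)
        then show "dist (case p of (v, u) \<Rightarrow> the_elem (M_delta \<phi> xbar \<delta> v u)) (case p' of (v, u) \<Rightarrow> the_elem (M_delta \<phi> xbar \<delta> v u)) \<le> (L + C) * dist p p'"
          unfolding e by (simp add: dist_norm sol_def)
      qed (use L C in simp)
      then show "\<exists>L. L-lipschitz_on N (\<lambda>(v, u). the_elem (M_delta \<phi> xbar \<delta> v u))" by blast
    qed
  qed
qed

text \<open>Comparing \<open>(x', u')\<close> with \<open>x = M(v, u)\<close> through \<open>x'' = M(v, u')\<close>: the Lipschitz dependence on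
  \<open>v\<close> gives quadratic growth of \<open>\<phi>(\<cdot>, u')\<close> at \<open>x''\<close>, prox-regularity compares \<open>(x'', u')\<close> with
  \<open>(x, u)\<close>, and the Lipschitz dependence on \<open>u\<close> bounds \<open>x'' - x\<close> by \<open>u' - u\<close>.\<close>

lemma stability_imp_sufficiency:
  assumes "full_stability \<phi> xbar" "full_multiplier_prox_regularity \<phi> xbar"
  shows "strong_variational_sufficiency \<phi> xbar"
proof -
  obtain n where n: "uniform_prox n" using assms(2) uniform_prox_iff by blast
  obtain \<delta>0 where \<delta>0: "\<delta>0 > 0"
    "\<And>\<delta>. 0 < \<delta> \<Longrightarrow> \<delta> < \<delta>0 \<Longrightarrow> (\<exists>\<epsilon> K. calm \<phi> xbar \<phi>b \<delta> \<epsilon> K) \<and> (\<exists>\<theta> L. stable_at \<delta> \<theta> L)"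
    using stability_local[OF assms(1)] by blast
  define \<delta> where "\<delta> = \<delta>0 / 2"
  have \<delta>: "\<delta> > 0" "\<delta> < \<delta>0" using \<delta>0(1) by (auto simp: \<delta>_def)
  obtain \<epsilon> K \<theta> L0 where calm: "calm \<phi> xbar \<phi>b \<delta> \<epsilon> K" and stab: "stable_at \<delta> \<theta> L0" using \<delta>0(2)[OF \<delta>] by blast
  interpret c: calm \<phi> xbar \<phi>b \<delta> \<epsilon> K by (rule calm)
  obtain \<rho> where \<rho>: "\<rho> > 0" "\<And>x u v y. near_ref \<phi> xbar \<rho> x u v y \<Longrightarrow> M_delta \<phi> xbar \<delta> v u = {x}"
    using substable_minimizer[OF calm n stable_imp_substable[OF stab]] by blast
  define L where "L = max 1 L0"
  have L: "L \<ge> 1" "L \<ge> L0" by (auto simp: L_def)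
  have \<theta>: "\<theta> > 0" and single: "\<And>v u. norm v < \<theta> \<Longrightarrow> norm u < \<theta> \<Longrightarrow> M_delta \<phi> xbar \<delta> v u = {sol \<delta> v u}"
    using stab unfolding stable_at_def by blast+
  have lip: "norm (sol \<delta> v u - sol \<delta> v' u') \<le> L * (norm (v - v') + norm (u - u'))"
    if "norm v < \<theta>" "norm v' < \<theta>" "norm u < \<theta>" "norm u' < \<theta>" for v v' u u'
  proof -
    have "norm (sol \<delta> v u - sol \<delta> v' u') \<le> L0 * (norm (v - v') + norm (u - u'))"
      using stab that unfolding stable_at_def by blast
    also have "\<dots> \<le> L * (norm (v - v') + norm (u - u'))" using L by (intro mult_right_mono) auto
    finally show ?thesis .
  qed
  have sol0: "sol \<delta> 0 0 = xbar" unfolding sol_def c.M_delta_reference by simp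
  \<comment> \<open>L \<tau> = 1/2: tilting by \<tau> times a vector moves the minimizer by at most
    half the length of that vector.\<close>
  define \<tau> where "\<tau> = 1 / (2 * L)"
  have \<tau>: "\<tau> > 0" "\<tau> \<le> 1" "L * \<tau> = 1 / 2" using L by (auto simp: \<tau>_def)
  \<comment> \<open>Chosen so that x'' stays in the prox neighborhood and the tilted w stays in the
    box of stability.\<close>
  define \<rho>' where "\<rho>' = Min {\<rho>, \<delta>, \<theta> / 2 / (2 * L + 1), inverse (real (Suc n)) / (2 * L), \<theta> / 2, inverse (real (Suc n))}"
  have \<rho>': "\<rho>' > 0" "\<rho>' \<le> \<rho>" "\<rho>' \<le> \<delta>" "\<rho>' \<le> \<theta> / 2 / (2 * L + 1)" "\<rho>' \<le> inverse (real (Suc n)) / (2 * L)" "\<rho>' \<le> \<theta> / 2"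
    "\<rho>' \<le> inverse (real (Suc n))"
  proof -
    show "\<rho>' > 0" unfolding \<rho>'_def using \<rho> \<delta> L \<theta> by auto
    show "\<rho>' \<le> \<rho>" "\<rho>' \<le> \<delta>" "\<rho>' \<le> \<theta> / 2 / (2 * L + 1)" "\<rho>' \<le> inverse (real (Suc n)) / (2 * L)" "\<rho>' \<le> \<theta> / 2"
      "\<rho>' \<le> inverse (real (Suc n))"
      unfolding \<rho>'_def by (rule Min_le; simp)+
  qed
  have \<rho>L: "(2 * L + 1) * \<rho>' \<le> \<theta> / 2" "2 * L * \<rho>' \<le> inverse (real (Suc n))"
  proof -
    have "2 * L + 1 > 0" using L by simp
    from \<rho>'(4)[unfolded pos_le_divide_eq[OF this]]
    show "(2 * L + 1) * \<rho>' \<le> \<theta> / 2" by (simp only: mult.commute)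
    have "2 * L * \<rho>' \<le> 2 * L * (inverse (real (Suc n)) / (2 * L))" using \<rho>'(5) L by (intro mult_left_mono) auto
    then show "2 * L * \<rho>' \<le> inverse (real (Suc n))" using L by simp
  qed
  have "min \<rho>' (1 / (8 * L)) > 0" using \<rho>'(1) L by simp
  \<comment> \<open>Since |x' - x|^2 \<le> 2 |x' - x''|^2 + 2 |x'' - x|^2, the factor 1/(8L) turns
    the gain \<tau>/2 = 1/(4L) into growth in |x' - x| at the cost L/4 in u; n (L^2 + 1) is the prox
    loss once |x'' - x| \<le> L |u' - u| is inserted.\<close>
  then obtain k :: nat where k: "inverse (real (Suc k)) < min \<rho>' (1 / (8 * L))" "real n * (L\<^sup>2 + 1) + L / 4 \<le> real k"
    by (rule ex_nat_large)
  have "uniform_growth k"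
    unfolding uniform_growth_def growth_at_def
  proof (intro allI impI)
    fix x u v y x' and u' :: 'u
    assume nr: "near_ref \<phi> xbar (inverse (Suc k)) x u v y"
      and x': "norm (x' - xbar) < inverse (Suc k)" "norm u' < inverse (Suc k)"
    have nr': "near_ref \<phi> xbar \<rho>' x u v y" by (rule near_ref_mono[OF nr]) (use k(1) in simp)
    then have v: "norm v < \<rho>'" and u: "norm u < \<rho>'" and sub: "(v, y) \<in> subdiff \<phi> (x, u)" by (auto simp: near_ref_def)
    have u': "norm u' < \<rho>'" and x'\<rho>: "norm (x' - xbar) < \<rho>'" using x' k(1) by auto
    have small: "norm v < \<theta>" "norm u < \<theta>" "norm u' < \<theta>" using v u u' \<rho>'(6) \<theta> by auto
    have Mx: "sol \<delta> v u = x" using \<rho>(2)[OF near_ref_mono[OF nr' \<rho>'(2)]] by (simp add: sol_def)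
    obtain a where a: "\<phi> (x, u) = ereal a" using subdiff_finite[OF sub] by blast
    define x'' where "x'' = sol \<delta> v u'"
    have x''M: "x'' \<in> M_delta \<phi> xbar \<delta> v u'" using single small by (simp add: x''_def)
    have x''x: "norm (x'' - x) \<le> L * norm (u' - u)"
      using lip[OF small(1,1,3,2)] by (simp add: x''_def Mx)
    have "norm (x'' - xbar) \<le> L * (norm v + norm u')"
      using lip[of v 0 u' 0] small \<theta> by (simp add: x''_def sol0)
    also have "\<dots> < L * (\<rho>' + \<rho>')" using v u' L by (intro mult_strict_left_mono) auto
    finally have x''b: "norm (x'' - xbar) < 2 * L * \<rho>'" by simp
    obtain b where b: "\<phi> (x'', u') = ereal b" "\<And>z. norm (z - xbar) < \<delta> \<Longrightarrow> ereal (b + v \<bullet> (z - x'')) \<le> \<phi> (z, u')"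
      using x''M unfolding M_delta_iff[OF nm] by blast
    \<comment> \<open>Tilting v towards x' moves the minimizer from x'' to p, at most half as far as
      x' is from x''. So x' - p keeps an inner product of at least |x' - x''|^2 / 2 with x' - x'',
      and optimality of p for w yields growth beyond the tilt v.\<close>
    define w where "w = v + \<tau> *\<^sub>R (x' - x'')"
    have w: "norm w < \<theta>"
    proof -
      have "norm (x' - x'') \<le> norm (x' - xbar) + norm (x'' - xbar)"
        using norm_triangle_ineq4[of "x' - xbar" "x'' - xbar"] by simp
      then have "norm (x' - x'') < (2 * L + 1) * \<rho>'" using x'\<rho> x''b by (simp add: algebra_simps)
      then have "norm (\<tau> *\<^sub>R (x' - x'')) \<le> \<theta> / 2"
        using \<tau> \<rho>L(1) mult_mono[of \<tau> 1 "norm (x' - x'')" "\<theta> / 2"] by simp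
      then show ?thesis unfolding w_def using norm_triangle_ineq[of v "\<tau> *\<^sub>R (x' - x'')"] v \<rho>'(6) by simp
    qed
    define p where "p = sol \<delta> w u'"
    have pM: "p \<in> M_delta \<phi> xbar \<delta> w u'" using single w small by (simp add: p_def)
    have px: "norm (p - x'') \<le> norm (x' - x'') / 2"
    proof -
      have "norm (p - x'') \<le> L * (\<tau> * norm (x' - x''))"
        using lip[OF w small(1,3,3)] \<tau> by (simp add: p_def x''_def w_def)
      also have "\<dots> = norm (x' - x'') / 2" using \<tau>(3) by (simp add: mult.assoc[symmetric])
      finally show ?thesis .
    qed
    obtain d where d: "norm (p - xbar) < \<delta>" "\<phi> (p, u') = ereal d" "\<And>z. norm (z - xbar) < \<delta> \<Longrightarrow> ereal (d + w \<bullet> (z - p)) \<le> \<phi> (z, u')"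
      using pM unfolding M_delta_iff[OF nm] by blast
    have bd: "b + v \<bullet> (p - x'') \<le> d" using b(2)[OF d(1)] d(2) by simp
    have dx': "ereal (d + w \<bullet> (x' - p)) \<le> \<phi> (x', u')" using x'\<rho> \<rho>'(3) by (intro d) simp
    have "(x' - x'') \<bullet> (p - x'') \<le> norm (x' - x'') * norm (p - x'')" by (rule norm_cauchy_schwarz)
    also have "\<dots> \<le> norm (x' - x'') * (norm (x' - x'') / 2)" using px by (intro mult_left_mono) auto
    also have "\<dots> = (norm (x' - x''))\<^sup>2 / 2" by (simp add: power2_eq_square)
    also have "(x' - x'') \<bullet> (p - x'') = (norm (x' - x''))\<^sup>2 - (x' - x'') \<bullet> (x' - p)"
      unfolding power2_norm_eq_inner by (simp add: inner_diff_right)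
    finally have "(norm (x' - x''))\<^sup>2 / 2 \<le> (x' - x'') \<bullet> (x' - p)" by linarith
    then have "\<tau> * ((norm (x' - x''))\<^sup>2 / 2) \<le> \<tau> * ((x' - x'') \<bullet> (x' - p))" using \<tau>(1) by (intro mult_left_mono) auto
    moreover have "w \<bullet> (x' - p) = v \<bullet> (x' - p) + \<tau> * ((x' - x'') \<bullet> (x' - p))"
      by (simp add: w_def inner_add_left)
    moreover have "v \<bullet> (x' - x'') = v \<bullet> (x' - p) + v \<bullet> (p - x'')" by (simp add: inner_diff_right)
    moreover have "\<tau> * ((norm (x' - x''))\<^sup>2 / 2) = \<tau> / 2 * (norm (x' - x''))\<^sup>2" by simp
    ultimately have 1: "b + v \<bullet> (x' - x'') + \<tau> / 2 * (norm (x' - x''))\<^sup>2 \<le> d + w \<bullet> (x' - p)"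
      using bd by linarith
    have "prox_at \<phi> xbar n x u v y"
      using n near_ref_mono[OF nr' \<rho>'(7)] unfolding uniform_prox_def by blast
    moreover have "norm (x'' - xbar) < inverse (Suc n)" using x''b \<rho>L(2) by linarith
    moreover have "norm u' < inverse (Suc n)" using u' \<rho>'(7) by linarith
    ultimately have "\<phi> (x, u) + ereal (v \<bullet> (x'' - x) + y \<bullet> (u' - u) - real n * ((norm (x'' - x))\<^sup>2 + (norm (u' - u))\<^sup>2)) \<le> \<phi> (x'', u')"
      unfolding prox_at_def by blast
    then have 2: "a + v \<bullet> (x'' - x) + y \<bullet> (u' - u) - real n * ((norm (x'' - x))\<^sup>2 + (norm (u' - u))\<^sup>2) \<le> b"
      using a b(1) by simp
    have sq: "(norm (x'' - x))\<^sup>2 \<le> L\<^sup>2 * (norm (u' - u))\<^sup>2"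
      using power_mono[OF x''x, of 2] by (simp add: power_mult_distrib)
    have 3: "real n * ((norm (x'' - x))\<^sup>2 + (norm (u' - u))\<^sup>2) \<le> real n * (L\<^sup>2 + 1) * (norm (u' - u))\<^sup>2"
    proof -
      have "(norm (x'' - x))\<^sup>2 + (norm (u' - u))\<^sup>2 \<le> (L\<^sup>2 + 1) * (norm (u' - u))\<^sup>2"
        using sq by (simp add: distrib_right)
      then show ?thesis unfolding mult.assoc by (intro mult_left_mono) auto
    qed
    have "(norm (x' - x))\<^sup>2 \<le> 2 * (norm (x' - x''))\<^sup>2 + 2 * (norm (x'' - x))\<^sup>2"
    proof -
      have "norm (x' - x) \<le> norm (x' - x'') + norm (x'' - x)" using norm_triangle_ineq[of "x' - x''" "x'' - x"] by simp
      then have "(norm (x' - x))\<^sup>2 \<le> (norm (x' - x'') + norm (x'' - x))\<^sup>2" by (intro power_mono) auto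
      also have "\<dots> \<le> 2 * (norm (x' - x''))\<^sup>2 + 2 * (norm (x'' - x))\<^sup>2"
        using zero_le_power2[of "norm (x' - x'') - norm (x'' - x)"] by (simp add: power2_sum power2_diff)
      finally show ?thesis .
    qed
    then have "(norm (x' - x))\<^sup>2 \<le> 2 * (norm (x' - x''))\<^sup>2 + 2 * (L\<^sup>2 * (norm (u' - u))\<^sup>2)" using sq by linarith
    then have "1 / (8 * L) * (norm (x' - x))\<^sup>2 \<le> 1 / (8 * L) * (2 * (norm (x' - x''))\<^sup>2 + 2 * (L\<^sup>2 * (norm (u' - u))\<^sup>2))"
      using L by (intro mult_left_mono) auto
    also have "\<dots> = \<tau> / 2 * (norm (x' - x''))\<^sup>2 + L / 4 * (norm (u' - u))\<^sup>2"
      using L by (simp add: \<tau>_def field_simps power2_eq_square)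
    finally have 4: "1 / (8 * L) * (norm (x' - x))\<^sup>2 - L / 4 * (norm (u' - u))\<^sup>2 \<le> \<tau> / 2 * (norm (x' - x''))\<^sup>2" by simp
    have "inverse (real (Suc k)) * (norm (x' - x))\<^sup>2 \<le> 1 / (8 * L) * (norm (x' - x))\<^sup>2"
      using k(1) by (intro mult_right_mono) auto
    moreover have "(real n * (L\<^sup>2 + 1) + L / 4) * (norm (u' - u))\<^sup>2 \<le> real k * (norm (u' - u))\<^sup>2"
      using k(2) by (intro mult_right_mono) auto
    then have "real n * (L\<^sup>2 + 1) * (norm (u' - u))\<^sup>2 + L / 4 * (norm (u' - u))\<^sup>2 \<le> real k * (norm (u' - u))\<^sup>2"
      by (simp only: distrib_right)
    moreover have "v \<bullet> (x' - x) = v \<bullet> (x' - x'') + v \<bullet> (x'' - x)" by (simp add: inner_diff_right)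
    ultimately have "a + (v \<bullet> (x' - x) + y \<bullet> (u' - u) + inverse (real (Suc k)) * (norm (x' - x))\<^sup>2 - real k * (norm (u' - u))\<^sup>2)
        \<le> d + w \<bullet> (x' - p)"
      using 1 2 3 4 by linarith
    then show "\<phi> (x, u) + ereal (v \<bullet> (x' - x) + y \<bullet> (u' - u) + inverse (Suc k) * (norm (x' - x))\<^sup>2 - real k * (norm (u' - u))\<^sup>2) \<le> \<phi> (x', u')"
      using dx' unfolding a plus_ereal.simps by (meson ereal_less_eq(3) order_trans)
  qed
  then show ?thesis using uniform_growth_iff by blast
qed

lemma sufficiency_imp_substability:
  assumes "strong_variational_sufficiency \<phi> xbar"
  shows "full_substability \<phi> xbar \<and> full_multiplier_prox_regularity \<phi> xbar"
proof -
  obtain n where n: "uniform_growth n" using assms uniform_growth_iff by blast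
  then have "uniform_prox n"
    unfolding uniform_growth_def uniform_prox_def using growth_at_imp_prox_at by blast
  then show ?thesis using growth_imp_substability[OF n] uniform_prox_iff by blast
qed

end

theorem theorem1p2:
  fixes \<phi> :: "(real ^ 'n) \<times> (real ^ 'm) \<Rightarrow> ereal"
    and xbar :: "real ^ 'n"
  assumes "closed_proper \<phi>"
    and "\<bar>\<phi> (xbar, 0)\<bar> \<noteq> \<infinity>"
    and "\<forall>\<^sub>F x in nhds xbar. \<phi> (xbar, 0) \<le> \<phi> (x, 0)"
    and "\<And>y. (0, y) \<in> horizon_subdiff \<phi> (xbar, 0) \<Longrightarrow> y = 0"
  defines "A \<equiv> full_stability \<phi> xbar \<and> full_multiplier_prox_regularity \<phi> xbar"
    and "B \<equiv> strong_variational_sufficiency \<phi> xbar"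
    and "C \<equiv> full_substability \<phi> xbar \<and> full_multiplier_prox_regularity \<phi> xbar"
  shows "(A \<or> B \<or> C \<longrightarrow> (\<exists>\<delta> \<alpha>. suitable \<phi> xbar \<delta> \<alpha>)) \<and>
    (\<forall>\<delta> \<alpha>. suitable \<phi> xbar \<delta> \<alpha> \<longrightarrow>
       (A \<longleftrightarrow> C \<and> derivative_condition \<phi> xbar \<delta> \<alpha>) \<and>
       (A \<longleftrightarrow> B \<and> derivative_condition \<phi> xbar \<delta> \<alpha>))"
proof -
  obtain \<phi>b where "\<phi> (xbar, 0) = ereal \<phi>b" using assms(2) by (cases "\<phi> (xbar, 0)") auto
  then interpret perturbed_problem \<phi> xbar \<phi>b
    using assms(1,3,4) by unfold_locales
  \<comment> \<open>Since A implies B and B implies C, both equivalences follow once A yields the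
    derivative condition and C together with it yields A.\<close>
  have AC: "A \<Longrightarrow> C" unfolding A_def C_def using full_stability_imp_substability by blast
  have BC: "B \<Longrightarrow> C" unfolding B_def C_def by (rule sufficiency_imp_substability)
  have AB: "A \<Longrightarrow> B" unfolding A_def B_def using stability_imp_sufficiency by blast
  have "C \<Longrightarrow> \<exists>\<delta> \<alpha>. suitable \<phi> xbar \<delta> \<alpha>" unfolding C_def using ex_suitable by blast
  moreover have "A \<Longrightarrow> derivative_condition \<phi> xbar \<delta> \<alpha>" if "suitable \<phi> xbar \<delta> \<alpha>" for \<delta> \<alpha>
    unfolding A_def using stability_imp_derivative_condition that by blast
  moreover have "C \<Longrightarrow> derivative_condition \<phi> xbar \<delta> \<alpha> \<Longrightarrow> A" if "suitable \<phi> xbar \<delta> \<alpha>" for \<delta> \<alpha>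
    unfolding A_def C_def using substability_derivative_imp_stability that by blast
  ultimately show ?thesis using AC BC AB by blast
qed

end
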